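(* Suppose that the triple $(\boldsymbol V_h,\boldsymbol W_h,Q_h)$ is Stokes-Biot stable. Then: (i) the bilinear form $B(\cdot,\cdot,\cdot\,;\,\cdot,\cdot,\cdot)$ is continuous on $\boldsymbol V_h\times\boldsymbol W_h\times Q_h$ with respect to the norm $\|(\cdot,\cdot,\cdot)\|_\tau$; and (ii) the following inf-sup condition holds: for every $(\boldsymbol u_h,\boldsymbol w_h,p_h)\in\boldsymbol V_h\times\boldsymbol W_h\times Q_h$, $$\sup_{0\neq(\boldsymbol v_h,\boldsymbol r_h,q_h)\in\boldsymbol V_h\times\boldsymbol W_h\times Q_h}\frac{B(\boldsymbol u_h,\boldsymbol w_h,p_h;\boldsymbol v_h,\boldsymbol r_h,q_h)}{\|(\boldsymbol v_h,\boldsymbol r_h,q_h)\|_\tau}\ \ge\ \gamma\,\|(\boldsymbol u_h,\boldsymbol w_h,p_h)\|_\tau,$$ with a constant $\gamma>0$ independent of the mesh size $h$ and of the time step size $\tau$.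
   Context: Let $d\in\{2,3\}$, let $\Omega\subset\mathbb R^d$ be a bounded domain with boundary $\Gamma=\overline\Gamma_t\cup\overline\Gamma_c$, where $\Gamma_t,\Gamma_c$ are relatively open subsets of $\Gamma$ of nonzero measure, and let $\boldsymbol n$ be the outward unit normal. $(\cdot,\cdot)$ and $\|\cdot\|$ are the $L^2(\Omega)$ inner product and norm, $\|\cdot\|_1$ the $\boldsymbol H^1(\Omega)$ norm. Set $\boldsymbol V=\{\boldsymbol u\in\boldsymbol H^1(\Omega):\boldsymbol u|_{\overline\Gamma_c}=\boldsymbol 0\}$, $\boldsymbol W=\{\boldsymbol w\in\boldsymbol H(\operatorname{div},\Omega):(\boldsymbol w\cdot\boldsymbol n)|_{\Gamma_c}=0\}$, $Q=L^2(\Omega)$. Physical parameters (fixed): Lamé coefficients $\mu>0,\lambda\ge0$, Biot modulus $M>0$, Biot-Willis constant $\alpha>0$, fluid viscosity $\mu_f>0$, symmetric positive definite permeability tensor $K$. Time step size $\tau>0$. Put $\boldsymbol\varepsilon(\boldsymbol u)=\frac12(\nabla\boldsymbol u+\nabla\boldsymbol u^t)$ and $$a(\boldsymbol u,\boldsymbol v)=2\mu\int_\Omega\boldsymbol\varepsilon(\boldsymbol u):\boldsymbol\varepsilon(\boldsymbol v)+\lambda\int_\Omega\operatorname{div}\boldsymbol u\,\operatorname{div}\boldsymbol v .$$ Mesh and spaces: $\mathcal T_h$ is a partition of $\Omega$ into $d$-simplices, shape regular: $h_T/\rho_T$ is bounded uniformly in $T$ (and in $h$), where $h_T=\operatorname{diam}T$,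 $\rho_T$ is the inradius, $h=\max_Th_T$. $\boldsymbol W_h=\{\boldsymbol w_h\in\boldsymbol W:\boldsymbol w_h|_T=\boldsymbol a+\eta\,\boldsymbol x,\ \boldsymbol a\in\mathbb R^d,\ \eta\in\mathbb R,\ \forall T\in\mathcal T_h\}$ (lowest order Raviart-Thomas) and $Q_h=\{q_h\in Q: q_h|_T\in\mathbb P_0(T)\ \forall T\in\mathcal T_h\}$ (piecewise constants). $\boldsymbol V_{h,1}=\{\boldsymbol v_h\in\boldsymbol V:\boldsymbol v_h|_T\in[\mathbb P_1(T)]^d\ \forall T\in\mathcal T_h\}$. Let $\mathcal E^{o,t}$ be the set of $(d-1)$-dimensional faces that are either interior faces or boundary faces on $\Gamma_t$. Each $e\in\mathcal E^{o,t}$ carries a fixed unit normal $\boldsymbol n_e$ (outward on boundary faces), and $\boldsymbol\Phi_e=\varphi_e\boldsymbol n_e$, where on each simplex $T$ having $e$ as a face $\varphi_e$ is the product of the $d$ barycentric coordinates of $T$ associated with the vertices of $e$ (i.e. all except that of the vertex opposite to $e$), and $\varphi_e=0$ on all other simplices. $\boldsymbol V_h=\boldsymbol V_{h,1}\oplus\boldsymbol V_b$, $\boldsymbol V_b=\operatorname{span}\{\boldsymbol\Phi_e\}_{e\in\mathcal E^{o,t}}$. Definition (Stokes-Biot stable). A triple $(\widetilde{\boldsymbol V}_h,\widetilde{\boldsymbol W}_h,\widetilde Q_h)$ is Stokes-Biot stable if and only if, with constants independent of $h$: (1) $a(\boldsymbol u_h,\boldsymbol v_h)\le C_{\boldsymbol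 V}\|\boldsymbol u_h\|_1\|\boldsymbol v_h\|_1$ for all $\boldsymbol u_h,\boldsymbol v_h\in\widetilde{\boldsymbol V}_h$; (2) $a(\boldsymbol u_h,\boldsymbol u_h)\ge\alpha_{\boldsymbol V}\|\boldsymbol u_h\|_1^2$ for all $\boldsymbol u_h\in\widetilde{\boldsymbol V}_h$ ($\alpha_{\boldsymbol V}>0$); (3) $(\widetilde{\boldsymbol W}_h,\widetilde Q_h)$ is Poisson stable, i.e. satisfies the standard continuity and stability (coercivity on the discrete kernel and inf-sup in $\boldsymbol H(\operatorname{div})\times L^2$) conditions for the mixed discretization of the Poisson equation; (4) $(\widetilde{\boldsymbol V}_h,\widetilde Q_h)$ is Stokes stable, i.e. there is $\beta>0$ with $\sup_{0\ne\boldsymbol v_h\in\widetilde{\boldsymbol V}_h}(\operatorname{div}\boldsymbol v_h,q_h)/\|\boldsymbol v_h\|_1\ge\beta\|q_h\|$ for all $q_h\in\widetilde Q_h$. Norm: $\|(\boldsymbol u_h,\boldsymbol w_h,p_h)\|_\tau=\big(\|\boldsymbol u_h\|_1^2+\tau\|\boldsymbol w_h\|^2+\tau^2\|\operatorname{div}\boldsymbol w_h\|^2+\|p_h\|^2\big)^{1/2}$. Bilinear form: $$B(\boldsymbol u_h,\boldsymbol w_h,p_h;\boldsymbol v_h,\boldsymbol r_h,q_h)=a(\boldsymbol u_h,\boldsymbol v_h)-(\alpha p_h,\operatorname{div}\boldsymbol v_h)+\tau(K^{-1}\mu_f\boldsymbol w_h,\boldsymbol r_h)-\tau(p_h,\operatorname{div}\boldsymbol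 r_h)-\Big(\tfrac1Mp_h,q_h\Big)-(\alpha\operatorname{div}\boldsymbol u_h,q_h)-\tau(\operatorname{div}\boldsymbol w_h,q_h).$$ *)

theory Defs
  imports "HOL-Analysis.Analysis"
begin

section \<open>Square-integrable functions\<close>

text \<open>Elements of Lebesgue and Sobolev spaces are represented by functions, so every statement
  about them is understood up to almost-everywhere equality; in particular "nonzero" means
  "not almost everywhere zero".\<close>

definition L2 :: "'a measure \<Rightarrow> ('a \<Rightarrow> 'b::euclidean_space) set" where
  "L2 M = {f \<in> borel_measurable M. integrable M (\<lambda>x. (norm (f x))\<^sup>2)}"

definition L2_inner :: "'a measure \<Rightarrow> ('a \<Rightarrow> 'b::euclidean_space) \<Rightarrow> ('a \<Rightarrow> 'b) \<Rightarrow> real" where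
  "L2_inner M f g = (\<integral>x. f x \<bullet> g x \<partial>M)"

definition L2_norm :: "'a measure \<Rightarrow> ('a \<Rightarrow> 'b::euclidean_space) \<Rightarrow> real" where
  "L2_norm M f = sqrt (L2_inner M f f)"

definition ae_zero :: "'a measure \<Rightarrow> ('a \<Rightarrow> 'b::zero) \<Rightarrow> bool" where
  "ae_zero M f \<longleftrightarrow> (AE x in M. f x = 0)"


section \<open>Surface measure\<close>

definition hausdorff_pre :: "real \<Rightarrow> real \<Rightarrow> 'a::euclidean_space set \<Rightarrow> ennreal" where
  "hausdorff_pre s \<delta> A =
    (INF U \<in> {U :: nat \<Rightarrow> 'a set. A \<subseteq> (\<Union>n. U n) \<and> (\<forall>n. bounded (U n) \<and> diameter (U n) \<le> \<delta>)}.
       \<Sum>n. ennreal (unit_ball_vol s * (diameter (U n) / 2) powr s))"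

definition hausdorff_outer :: "real \<Rightarrow> 'a::euclidean_space set \<Rightarrow> ennreal" where
  "hausdorff_outer s A = (SUP \<delta> \<in> {0<..}. hausdorff_pre s \<delta> A)"

text \<open>For \<open>s > 0\<close> this is the s-dimensional Hausdorff measure on the Borel sets, normalised so
  that it agrees with surface area on smooth s-dimensional surfaces.\<close>

definition hausdorff_measure :: "real \<Rightarrow> 'a::euclidean_space measure" where
  "hausdorff_measure s = measure_of UNIV (sets borel) (hausdorff_outer s)"

definition boundary_measure :: "(real ^ 'd) set \<Rightarrow> (real ^ 'd) measure" where
  "boundary_measure \<Omega> =
    restrict_space (hausdorff_measure (real CARD('d) - 1)) (frontier \<Omega>)"


section \<open>Weak derivatives and Sobolev spaces\<close>

primrec Ck :: "nat \<Rightarrow> ('a::euclidean_space \<Rightarrow> real) \<Rightarrow> bool" where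
  "Ck 0 f \<longleftrightarrow> continuous_on UNIV f"
| "Ck (Suc k) f \<longleftrightarrow>
     (\<forall>x. f differentiable (at x)) \<and> (\<forall>v. Ck k (\<lambda>x. frechet_derivative f (at x) v))"

definition test_functions :: "'a::euclidean_space set \<Rightarrow> ('a \<Rightarrow> real) set" where
  "test_functions \<Omega> =
    {\<phi>. (\<forall>k. Ck k \<phi>) \<and> compact (closure {x. \<phi> x \<noteq> 0}) \<and> closure {x. \<phi> x \<noteq> 0} \<subseteq> \<Omega>}"

definition classical_grad :: "(real ^ 'd \<Rightarrow> real) \<Rightarrow> real ^ 'd \<Rightarrow> real ^ 'd" where
  "classical_grad \<phi> x = (\<chi> j. frechet_derivative \<phi> (at x) (axis j 1))"

definition has_weak_grad ::
  "(real ^ 'd) set \<Rightarrow> (real ^ 'd \<Rightarrow> real) \<Rightarrow> (real ^ 'd \<Rightarrow> real ^ 'd) \<Rightarrow> bool" where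
  "has_weak_grad \<Omega> f g \<longleftrightarrow> g \<in> L2 (lebesgue_on \<Omega>) \<and>
    (\<forall>\<phi> \<in> test_functions \<Omega>.
       (\<integral>x. f x *\<^sub>R classical_grad \<phi> x \<partial>(lebesgue_on \<Omega>)) = - (\<integral>x. \<phi> x *\<^sub>R g x \<partial>(lebesgue_on \<Omega>)))"

text \<open>Weak gradients and divergences are unique only almost everywhere; the operators below
  choose a representative.\<close>

definition weak_grad ::
  "(real ^ 'd) set \<Rightarrow> (real ^ 'd \<Rightarrow> real) \<Rightarrow> real ^ 'd \<Rightarrow> real ^ 'd" where
  "weak_grad \<Omega> f = (SOME g. has_weak_grad \<Omega> f g)"

definition has_weak_div ::
  "(real ^ 'd) set \<Rightarrow> (real ^ 'd \<Rightarrow> real ^ 'd) \<Rightarrow> (real ^ 'd \<Rightarrow> real) \<Rightarrow> bool" where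
  "has_weak_div \<Omega> w g \<longleftrightarrow> g \<in> L2 (lebesgue_on \<Omega>) \<and>
    (\<forall>\<phi> \<in> test_functions \<Omega>.
       (\<integral>x. w x \<bullet> classical_grad \<phi> x \<partial>(lebesgue_on \<Omega>)) = - (\<integral>x. g x * \<phi> x \<partial>(lebesgue_on \<Omega>)))"

definition weak_div ::
  "(real ^ 'd) set \<Rightarrow> (real ^ 'd \<Rightarrow> real ^ 'd) \<Rightarrow> real ^ 'd \<Rightarrow> real" where
  "weak_div \<Omega> w = (SOME g. has_weak_div \<Omega> w g)"

definition H1 :: "(real ^ 'd) set \<Rightarrow> (real ^ 'd \<Rightarrow> real) set" where
  "H1 \<Omega> = {f \<in> L2 (lebesgue_on \<Omega>). \<exists>g. has_weak_grad \<Omega> f g}"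

definition H1_norm :: "(real ^ 'd) set \<Rightarrow> (real ^ 'd \<Rightarrow> real) \<Rightarrow> real" where
  "H1_norm \<Omega> f =
    sqrt ((L2_norm (lebesgue_on \<Omega>) f)\<^sup>2 + (L2_norm (lebesgue_on \<Omega>) (weak_grad \<Omega> f))\<^sup>2)"

definition H1_vec :: "(real ^ 'd) set \<Rightarrow> (real ^ 'd \<Rightarrow> real ^ 'd) set" where
  "H1_vec \<Omega> = {u. \<forall>i. (\<lambda>x. u x $ i) \<in> H1 \<Omega>}"

definition weak_jacobian ::
  "(real ^ 'd) set \<Rightarrow> (real ^ 'd \<Rightarrow> real ^ 'd) \<Rightarrow> real ^ 'd \<Rightarrow> real ^ 'd ^ 'd" where
  "weak_jacobian \<Omega> u x = (\<chi> i. weak_grad \<Omega> (\<lambda>y. u y $ i) x)"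

text \<open>The inner product of \<open>real ^ 'd ^ 'd\<close> is the Frobenius product.\<close>

definition H1_vec_norm :: "(real ^ 'd) set \<Rightarrow> (real ^ 'd \<Rightarrow> real ^ 'd) \<Rightarrow> real" where
  "H1_vec_norm \<Omega> u =
    sqrt ((L2_norm (lebesgue_on \<Omega>) u)\<^sup>2 + (L2_norm (lebesgue_on \<Omega>) (weak_jacobian \<Omega> u))\<^sup>2)"

definition Hdiv :: "(real ^ 'd) set \<Rightarrow> (real ^ 'd \<Rightarrow> real ^ 'd) set" where
  "Hdiv \<Omega> = {w \<in> L2 (lebesgue_on \<Omega>). \<exists>g. has_weak_div \<Omega> w g}"

definition Hdiv_norm :: "(real ^ 'd) set \<Rightarrow> (real ^ 'd \<Rightarrow> real ^ 'd) \<Rightarrow> real" where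
  "Hdiv_norm \<Omega> w =
    sqrt ((L2_norm (lebesgue_on \<Omega>) w)\<^sup>2 + (L2_norm (lebesgue_on \<Omega>) (weak_div \<Omega> w))\<^sup>2)"


section \<open>Traces and essential boundary conditions\<close>

text \<open>The trace operator is the continuous extension, from the H1 norm to the L2 norm of the
  boundary, of the restriction map on H1 functions that are continuous up to the boundary.\<close>

definition has_trace ::
  "(real ^ 'd) set \<Rightarrow> (real ^ 'd \<Rightarrow> real) \<Rightarrow> (real ^ 'd \<Rightarrow> real) \<Rightarrow> bool" where
  "has_trace \<Omega> f g \<longleftrightarrow> f \<in> H1 \<Omega> \<and> g \<in> L2 (boundary_measure \<Omega>) \<and>
    (\<exists>F :: nat \<Rightarrow> real ^ 'd \<Rightarrow> real.
       (\<forall>n. F n \<in> H1 \<Omega> \<and> continuous_on (closure \<Omega>) (F n) \<and> F n \<in> L2 (boundary_measure \<Omega>)) \<and>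
       (\<lambda>n. H1_norm \<Omega> (\<lambda>x. F n x - f x)) \<longlonglongrightarrow> 0 \<and>
       (\<lambda>n. L2_norm (boundary_measure \<Omega>) (\<lambda>x. F n x - g x)) \<longlonglongrightarrow> 0)"

definition trace_vanishes_on :: "(real ^ 'd) set \<Rightarrow> (real ^ 'd) set \<Rightarrow> (real ^ 'd \<Rightarrow> real) \<Rightarrow> bool" where
  "trace_vanishes_on \<Omega> S f \<longleftrightarrow>
    (\<exists>g. has_trace \<Omega> f g \<and> (AE x in boundary_measure \<Omega>. x \<in> S \<longrightarrow> g x = 0))"

definition space_V :: "(real ^ 'd) set \<Rightarrow> (real ^ 'd) set \<Rightarrow> (real ^ 'd \<Rightarrow> real ^ 'd) set" where
  "space_V \<Omega> \<Gamma>c = {u \<in> H1_vec \<Omega>. \<forall>i. trace_vanishes_on \<Omega> (closure \<Gamma>c) (\<lambda>x. u x $ i)}"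

text \<open>The normal trace of \<open>w \<in> Hdiv \<Omega>\<close> is the functional on boundary traces defined by Green's
  formula, \<open>\<langle>w \<cdot> n, \<phi>\<rangle> = (w, grad \<phi>) + (div w, \<phi>)\<close>. It vanishes on \<open>\<Gamma>c\<close> iff it annihilates
  every \<open>\<phi>\<close> in H1 whose trace vanishes on the rest of the boundary.\<close>

definition normal_trace ::
  "(real ^ 'd) set \<Rightarrow> (real ^ 'd \<Rightarrow> real ^ 'd) \<Rightarrow> (real ^ 'd \<Rightarrow> real) \<Rightarrow> real" where
  "normal_trace \<Omega> w \<phi> =
    L2_inner (lebesgue_on \<Omega>) w (weak_grad \<Omega> \<phi>) + L2_inner (lebesgue_on \<Omega>) (weak_div \<Omega> w) \<phi>"

definition space_W :: "(real ^ 'd) set \<Rightarrow> (real ^ 'd) set \<Rightarrow> (real ^ 'd \<Rightarrow> real ^ 'd) set" where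
  "space_W \<Omega> \<Gamma>c = {w \<in> Hdiv \<Omega>.
    \<forall>\<phi> \<in> H1 \<Omega>. trace_vanishes_on \<Omega> (frontier \<Omega> - \<Gamma>c) \<phi> \<longrightarrow> normal_trace \<Omega> w \<phi> = 0}"

abbreviation space_Q :: "(real ^ 'd) set \<Rightarrow> (real ^ 'd \<Rightarrow> real) set" where
  "space_Q \<Omega> \<equiv> L2 (lebesgue_on \<Omega>)"


section \<open>Simplicial meshes\<close>

definition simplicial_mesh :: "(real ^ 'd) set \<Rightarrow> (real ^ 'd) set set \<Rightarrow> bool" where
  "simplicial_mesh \<Omega> \<T> \<longleftrightarrow> triangulation \<T> \<and> (\<forall>T\<in>\<T>. int CARD('d) simplex T) \<and>
    \<Union>\<T> = closure \<Omega> \<and> (\<forall>T\<in>\<T>. interior T \<subseteq> \<Omega>)"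

definition inradius :: "'a::euclidean_space set \<Rightarrow> real" where
  "inradius T = Sup {r. 0 \<le> r \<and> (\<exists>c. cball c r \<subseteq> T)}"

definition shape_regular :: "('h \<Rightarrow> 'a::euclidean_space set set) \<Rightarrow> bool" where
  "shape_regular \<T> \<longleftrightarrow> (\<exists>\<sigma>. \<forall>h. \<forall>T \<in> \<T> h. diameter T / inradius T \<le> \<sigma>)"

definition vertices :: "'a::euclidean_space set \<Rightarrow> 'a set" where
  "vertices T = {v. v extreme_point_of T}"

definition barycentric :: "'a::euclidean_space set \<Rightarrow> 'a \<Rightarrow> 'a \<Rightarrow> real" where
  "barycentric T v x =
    (SOME c. (\<Sum>w\<in>vertices T. c w) = 1 \<and> (\<Sum>w\<in>vertices T. c w *\<^sub>R w) = x) v"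

text \<open>The interior faces, and the boundary faces lying on \<open>\<Gamma>t\<close> (faces are closed, hence the
  closure).\<close>

definition faces_ot :: "(real ^ 'd) set \<Rightarrow> (real ^ 'd) set \<Rightarrow> (real ^ 'd) set set \<Rightarrow> (real ^ 'd) set set"
  where "faces_ot \<Omega> \<Gamma>t \<T> =
    {e. (\<exists>T\<in>\<T>. e facet_of T) \<and> (\<not> e \<subseteq> frontier \<Omega> \<or> e \<subseteq> closure \<Gamma>t)}"

definition unit_normal_to :: "'a::euclidean_space \<Rightarrow> 'a set \<Rightarrow> bool" where
  "unit_normal_to n e \<longleftrightarrow> norm n = 1 \<and> (\<forall>x\<in>e. \<forall>y\<in>e. n \<bullet> (x - y) = 0)"

definition outward_on :: "'a::euclidean_space \<Rightarrow> 'a set \<Rightarrow> 'a set \<Rightarrow> bool" where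
  "outward_on n e T \<longleftrightarrow> (\<forall>x\<in>T. \<forall>y\<in>e. n \<bullet> (x - y) \<le> 0)"

definition admissible_normals ::
  "(real ^ 'd) set \<Rightarrow> (real ^ 'd) set \<Rightarrow> (real ^ 'd) set set \<Rightarrow> ((real ^ 'd) set \<Rightarrow> real ^ 'd) \<Rightarrow> bool"
  where "admissible_normals \<Omega> \<Gamma>t \<T> n \<longleftrightarrow>
    (\<forall>e \<in> faces_ot \<Omega> \<Gamma>t \<T>. unit_normal_to (n e) e \<and>
       (e \<subseteq> frontier \<Omega> \<longrightarrow> (\<forall>T\<in>\<T>. e facet_of T \<longrightarrow> outward_on (n e) e T)))"


section \<open>Discrete spaces\<close>

text \<open>In a triangulation the value does not depend on the chosen simplex \<open>T\<close>: on a common face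
  the barycentric coordinates of the two simplices agree.\<close>

definition face_bubble :: "(real ^ 'd) set set \<Rightarrow> (real ^ 'd) set \<Rightarrow> real ^ 'd \<Rightarrow> real" where
  "face_bubble \<T> e x =
    (if \<exists>T\<in>\<T>. e facet_of T \<and> x \<in> T
     then \<Prod>v\<in>vertices e. barycentric (SOME T. T \<in> \<T> \<and> e facet_of T \<and> x \<in> T) v x
     else 0)"

definition space_Vh1 ::
  "(real ^ 'd) set \<Rightarrow> (real ^ 'd) set \<Rightarrow> (real ^ 'd) set set \<Rightarrow> (real ^ 'd \<Rightarrow> real ^ 'd) set" where
  "space_Vh1 \<Omega> \<Gamma>c \<T> = {v \<in> space_V \<Omega> \<Gamma>c.
    \<forall>T\<in>\<T>. \<exists>(A :: real ^ 'd ^ 'd) b. AE x in lebesgue_on T. v x = A *v x + b}"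

definition space_Vb ::
  "(real ^ 'd) set \<Rightarrow> (real ^ 'd) set \<Rightarrow> (real ^ 'd) set set \<Rightarrow> ((real ^ 'd) set \<Rightarrow> real ^ 'd)
    \<Rightarrow> (real ^ 'd \<Rightarrow> real ^ 'd) set" where
  "space_Vb \<Omega> \<Gamma>t \<T> n =
    {\<lambda>x. \<Sum>e\<in>faces_ot \<Omega> \<Gamma>t \<T>. c e *\<^sub>R (face_bubble \<T> e x *\<^sub>R n e) | c. True}"

definition space_Vh ::
  "(real ^ 'd) set \<Rightarrow> (real ^ 'd) set \<Rightarrow> (real ^ 'd) set \<Rightarrow> (real ^ 'd) set set
    \<Rightarrow> ((real ^ 'd) set \<Rightarrow> real ^ 'd) \<Rightarrow> (real ^ 'd \<Rightarrow> real ^ 'd) set" where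
  "space_Vh \<Omega> \<Gamma>t \<Gamma>c \<T> n =
    {\<lambda>x. v x + b x | v b. v \<in> space_Vh1 \<Omega> \<Gamma>c \<T> \<and> b \<in> space_Vb \<Omega> \<Gamma>t \<T> n}"

definition space_Wh ::
  "(real ^ 'd) set \<Rightarrow> (real ^ 'd) set \<Rightarrow> (real ^ 'd) set set \<Rightarrow> (real ^ 'd \<Rightarrow> real ^ 'd) set" where
  "space_Wh \<Omega> \<Gamma>c \<T> = {w \<in> space_W \<Omega> \<Gamma>c.
    \<forall>T\<in>\<T>. \<exists>a \<eta>. AE x in lebesgue_on T. w x = a + \<eta> *\<^sub>R x}"

definition space_Qh :: "(real ^ 'd) set \<Rightarrow> (real ^ 'd) set set \<Rightarrow> (real ^ 'd \<Rightarrow> real) set" where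
  "space_Qh \<Omega> \<T> = {q \<in> space_Q \<Omega>. \<forall>T\<in>\<T>. \<exists>c. AE x in lebesgue_on T. q x = c}"


section \<open>Bilinear forms and stability\<close>

definition strain ::
  "(real ^ 'd) set \<Rightarrow> (real ^ 'd \<Rightarrow> real ^ 'd) \<Rightarrow> real ^ 'd \<Rightarrow> real ^ 'd ^ 'd" where
  "strain \<Omega> u x = (1 / 2) *\<^sub>R (weak_jacobian \<Omega> u x + transpose (weak_jacobian \<Omega> u x))"

definition elasticity_form ::
  "(real ^ 'd) set \<Rightarrow> real \<Rightarrow> real \<Rightarrow> (real ^ 'd \<Rightarrow> real ^ 'd) \<Rightarrow> (real ^ 'd \<Rightarrow> real ^ 'd) \<Rightarrow> real" where
  "elasticity_form \<Omega> \<mu> lam u v =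
    2 * \<mu> * L2_inner (lebesgue_on \<Omega>) (strain \<Omega> u) (strain \<Omega> v) +
    lam * L2_inner (lebesgue_on \<Omega>) (weak_div \<Omega> u) (weak_div \<Omega> v)"

text \<open>Families of discrete spaces are indexed by \<open>'h\<close>; constants quantified outside \<open>\<forall>h\<close> are
  independent of the mesh. Suprema are taken in \<open>ereal\<close>, where they always exist.\<close>

definition poisson_stable ::
  "(real ^ 'd) set \<Rightarrow> ('h \<Rightarrow> (real ^ 'd \<Rightarrow> real ^ 'd) set) \<Rightarrow> ('h \<Rightarrow> (real ^ 'd \<Rightarrow> real) set) \<Rightarrow> bool"
  where "poisson_stable \<Omega> Wh Qh \<longleftrightarrow>
    (\<exists>C. \<forall>h. \<forall>w \<in> Wh h. \<forall>r \<in> Wh h.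
        \<bar>L2_inner (lebesgue_on \<Omega>) w r\<bar> \<le> C * Hdiv_norm \<Omega> w * Hdiv_norm \<Omega> r) \<and>
    (\<exists>C. \<forall>h. \<forall>w \<in> Wh h. \<forall>q \<in> Qh h.
        \<bar>L2_inner (lebesgue_on \<Omega>) (weak_div \<Omega> w) q\<bar> \<le> C * Hdiv_norm \<Omega> w * L2_norm (lebesgue_on \<Omega>) q) \<and>
    (\<exists>\<alpha>>0. \<forall>h. \<forall>w \<in> Wh h. (\<forall>q \<in> Qh h. L2_inner (lebesgue_on \<Omega>) (weak_div \<Omega> w) q = 0) \<longrightarrow>
        L2_inner (lebesgue_on \<Omega>) w w \<ge> \<alpha> * (Hdiv_norm \<Omega> w)\<^sup>2) \<and>
    (\<exists>\<beta>>0. \<forall>h. \<forall>q \<in> Qh h.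
        (SUP w \<in> {w \<in> Wh h. \<not> ae_zero (lebesgue_on \<Omega>) w}.
           ereal (L2_inner (lebesgue_on \<Omega>) (weak_div \<Omega> w) q / Hdiv_norm \<Omega> w))
        \<ge> ereal (\<beta> * L2_norm (lebesgue_on \<Omega>) q))"

definition stokes_stable ::
  "(real ^ 'd) set \<Rightarrow> ('h \<Rightarrow> (real ^ 'd \<Rightarrow> real ^ 'd) set) \<Rightarrow> ('h \<Rightarrow> (real ^ 'd \<Rightarrow> real) set) \<Rightarrow> bool"
  where "stokes_stable \<Omega> Vh Qh \<longleftrightarrow>
    (\<exists>\<beta>>0. \<forall>h. \<forall>q \<in> Qh h.
        (SUP v \<in> {v \<in> Vh h. \<not> ae_zero (lebesgue_on \<Omega>) v}.
           ereal (L2_inner (lebesgue_on \<Omega>) (weak_div \<Omega> v) q / H1_vec_norm \<Omega> v))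
        \<ge> ereal (\<beta> * L2_norm (lebesgue_on \<Omega>) q))"

definition stokes_biot_stable ::
  "(real ^ 'd) set \<Rightarrow> real \<Rightarrow> real \<Rightarrow> ('h \<Rightarrow> (real ^ 'd \<Rightarrow> real ^ 'd) set)
    \<Rightarrow> ('h \<Rightarrow> (real ^ 'd \<Rightarrow> real ^ 'd) set) \<Rightarrow> ('h \<Rightarrow> (real ^ 'd \<Rightarrow> real) set) \<Rightarrow> bool"
  where "stokes_biot_stable \<Omega> \<mu> lam Vh Wh Qh \<longleftrightarrow>
    (\<exists>C. \<forall>h. \<forall>u \<in> Vh h. \<forall>v \<in> Vh h.
        elasticity_form \<Omega> \<mu> lam u v \<le> C * H1_vec_norm \<Omega> u * H1_vec_norm \<Omega> v) \<and>
    (\<exists>\<alpha>>0. \<forall>h. \<forall>u \<in> Vh h. elasticity_form \<Omega> \<mu> lam u u \<ge> \<alpha> * (H1_vec_norm \<Omega> u)\<^sup>2) \<and>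
    poisson_stable \<Omega> Wh Qh \<and> stokes_stable \<Omega> Vh Qh"

definition tau_norm ::
  "(real ^ 'd) set \<Rightarrow> real
    \<Rightarrow> (real ^ 'd \<Rightarrow> real ^ 'd) \<times> (real ^ 'd \<Rightarrow> real ^ 'd) \<times> (real ^ 'd \<Rightarrow> real) \<Rightarrow> real" where
  "tau_norm \<Omega> \<tau> = (\<lambda>(u, w, p).
    sqrt ((H1_vec_norm \<Omega> u)\<^sup>2 + \<tau> * (L2_norm (lebesgue_on \<Omega>) w)\<^sup>2 +
          \<tau>\<^sup>2 * (L2_norm (lebesgue_on \<Omega>) (weak_div \<Omega> w))\<^sup>2 + (L2_norm (lebesgue_on \<Omega>) p)\<^sup>2))"

definition triple_zero ::
  "(real ^ 'd) set
    \<Rightarrow> (real ^ 'd \<Rightarrow> real ^ 'd) \<times> (real ^ 'd \<Rightarrow> real ^ 'd) \<times> (real ^ 'd \<Rightarrow> real) \<Rightarrow> bool" where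
  "triple_zero \<Omega> = (\<lambda>(u, w, p).
    ae_zero (lebesgue_on \<Omega>) u \<and> ae_zero (lebesgue_on \<Omega>) w \<and> ae_zero (lebesgue_on \<Omega>) p)"

definition biot_form ::
  "(real ^ 'd) set \<Rightarrow> real \<Rightarrow> real \<Rightarrow> real \<Rightarrow> real \<Rightarrow> real \<Rightarrow> real ^ 'd ^ 'd \<Rightarrow> real
    \<Rightarrow> (real ^ 'd \<Rightarrow> real ^ 'd) \<times> (real ^ 'd \<Rightarrow> real ^ 'd) \<times> (real ^ 'd \<Rightarrow> real)
    \<Rightarrow> (real ^ 'd \<Rightarrow> real ^ 'd) \<times> (real ^ 'd \<Rightarrow> real ^ 'd) \<times> (real ^ 'd \<Rightarrow> real) \<Rightarrow> real" where
  "biot_form \<Omega> \<mu> lam M \<alpha> \<mu>f K \<tau> = (\<lambda>(u, w, p) (v, r, q).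
     elasticity_form \<Omega> \<mu> lam u v
     - L2_inner (lebesgue_on \<Omega>) (\<lambda>x. \<alpha> * p x) (weak_div \<Omega> v)
     + \<tau> * L2_inner (lebesgue_on \<Omega>) (\<lambda>x. matrix_inv K *v (\<mu>f *\<^sub>R w x)) r
     - \<tau> * L2_inner (lebesgue_on \<Omega>) p (weak_div \<Omega> r)
     - L2_inner (lebesgue_on \<Omega>) (\<lambda>x. 1 / M * p x) q
     - L2_inner (lebesgue_on \<Omega>) (\<lambda>x. \<alpha> * weak_div \<Omega> u x) q
     - \<tau> * L2_inner (lebesgue_on \<Omega>) (weak_div \<Omega> w) q)"

end

theory Submission
  imports Defs
begin

text \<open>Test the form at \<open>(u, w, - p)\<close>: the coupling terms cancel in pairs and what remains is
\<open>a(u, u) + \<tau> (inverse K \<mu>f w, w) + (1/M) \<parallel>p\<parallel>\<^sup>2\<close>. By the coercivity of the elasticity form and the positivity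
of \<open>inverse K\<close> this controls every part of the norm except \<open>\<tau>\<^sup>2 \<parallel>div w\<parallel>\<^sup>2\<close>. Because the divergence of a
Raviart-Thomas field is piecewise constant, \<open>q = - p - \<theta> \<tau> div w\<close> is an admissible pressure test
function as well. The extra term contributes \<open>\<theta> \<tau>\<^sup>2 \<parallel>div w\<parallel>\<^sup>2\<close> together with the cross terms
\<open>\<theta> \<tau> (p, div w) / M\<close> and \<open>\<theta> \<alpha> \<tau> (div u, div w)\<close>, which Young's inequality absorbs once \<open>\<theta>\<close> is small.
How small depends only on \<open>M\<close>, \<open>\<alpha>\<close>, the dimension and the coercivity constant, hence neither on the
mesh nor on \<open>\<tau>\<close> (lemma \<open>inf_sup_algebra\<close>). The norm of \<open>(u, w, q)\<close> is at most \<open>2 + \<theta>\<close> times that of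
\<open>(u, w, p)\<close>, and dividing gives the inf-sup constant (lemma \<open>biot_form_stabilising_test\<close>).
Continuity is Cauchy-Schwarz applied to each of the seven terms.

The form is written with representatives of weak derivatives picked by choice, so these
estimates rest on three facts about them. Weak gradients and divergences are unique almost
everywhere, because a function orthogonal to all test functions vanishes
(lemma \<open>AE_zero_if_zero_against_test_functions\<close>); this makes the divergence of an \<open>H1\<close> field the
trace of its Jacobian, bounded by the \<open>H1\<close> norm. The displacements do
possess weak gradients: the piecewise linear part by definition, and the face bubbles because
they are continuous and piecewise polynomial, hence Lipschitz along segments inside the domain,
so that a discrete integration by parts passes to the limit
(lemmas \<open>has_weak_grad_if_piecewise_lipschitz\<close> and \<open>face_bubble_on_simplex\<close>). Finally, the weak
divergence of a Raviart-Thomas field is constant on each simplex (lemma \<open>weak_div_space_Wh\<close>).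

When \<open>(u, w, p)\<close> has norm zero the supremum must still be shown to be nonnegative, which needs some
nonzero test triple; \<open>(u, w, 1)\<close> is one, and the form vanishes there by continuity.\<close>

section \<open>Test functions\<close>

lemma Ck_const: "Ck k (\<lambda>x. c)"
  by (induction k arbitrary: c) auto

text \<open>Differentiability is part of every level but the lowest, so the induction starts from differentiable functions being continuous.\<close>

lemma Ck_lower: "Ck (Suc k) f \<Longrightarrow> Ck k f"
proof (induction k arbitrary: f)
  case 0
  then show ?case
    by (auto intro!: differentiable_imp_continuous_on simp: differentiable_on_def)
next
  case (Suc k)
  then show ?case by (metis Ck.simps(2))
qed

lemma frechet_derivative_mult:
  fixes f g :: "'a::euclidean_space \<Rightarrow> real"
  assumes "f differentiable (at x)" "g differentiable (at x)"
  shows "frechet_derivative (\<lambda>x. f x * g x) (at x) v =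
    f x * frechet_derivative g (at x) v + frechet_derivative f (at x) v * g x"
proof -
  have "((\<lambda>x. f x * g x) has_derivative
      (\<lambda>h. f x * frechet_derivative g (at x) h + frechet_derivative f (at x) h * g x)) (at x)"
    using assms by (intro has_derivative_mult) (simp_all add: frechet_derivative_works[THEN iffD1])
  from frechet_derivative_at[OF this] show ?thesis by metis
qed

lemma frechet_derivative_add:
  fixes f g :: "'a::euclidean_space \<Rightarrow> real"
  assumes "f differentiable (at x)" "g differentiable (at x)"
  shows "frechet_derivative (\<lambda>x. f x + g x) (at x) v =
    frechet_derivative f (at x) v + frechet_derivative g (at x) v"
proof -
  have "((\<lambda>x. f x + g x) has_derivative
      (\<lambda>h. frechet_derivative f (at x) h + frechet_derivative g (at x) h)) (at x)"
    using assms by (intro has_derivative_add) (simp_all add: frechet_derivative_works[THEN iffD1])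
  from frechet_derivative_at[OF this] show ?thesis by metis
qed

lemma Ck_add: "Ck k f \<Longrightarrow> Ck k g \<Longrightarrow> Ck k (\<lambda>x. f x + g x)"
proof (induction k arbitrary: f g)
  case 0
  then show ?case by (auto intro: continuous_intros)
next
  case (Suc k)
  then show ?case
    by (auto simp: frechet_derivative_add)
qed

lemma Ck_mult: "Ck k f \<Longrightarrow> Ck k g \<Longrightarrow> Ck k (\<lambda>x. f x * g x)"
proof (induction k arbitrary: f g)
  case 0
  then show ?case by (auto intro: continuous_intros)
next
  case (Suc k)
  have fg: "Ck k f" "Ck k g" using Suc.prems by (auto intro: Ck_lower simp del: Ck.simps)
  have d: "f differentiable (at x)" "g differentiable (at x)" for x
    using Suc.prems by auto
  show ?case
    using Suc.prems fg d
    by (auto simp: frechet_derivative_mult simp del: Ck.simps intro!: Ck_add Suc.IH simp: Ck.simps(2))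
qed

lemma Ck_prod: "finite I \<Longrightarrow> (\<And>i. i \<in> I \<Longrightarrow> Ck k (f i)) \<Longrightarrow> Ck k (\<lambda>x. \<Prod>i\<in>I. f i x)"
  by (induction I rule: finite_induct) (auto intro: Ck_const Ck_mult)

text \<open>The smooth functions that are flat at the origin. Dividing \<open>exp (- c / t)\<close> by powers of \<open>t\<close> makes the
family closed under differentiation, so that smoothness follows by one induction over all \<open>m\<close>
at once.\<close>

definition flat_exp :: "real \<Rightarrow> nat \<Rightarrow> real \<Rightarrow> real" where
  "flat_exp c m t = (if t \<le> 0 then 0 else exp (- c / t) / t ^ m)"

lemma flat_exp_tendsto_0:
  assumes "c > 0" shows "(flat_exp c m \<longlongrightarrow> 0) (at 0)"
proof -
  have r: "((\<lambda>t. exp (- c / t) / t ^ m) \<longlongrightarrow> 0) (at_right 0)"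
  proof -
    have "((\<lambda>s. (s / c) ^ m / exp s) \<longlongrightarrow> 0) at_top"
      using tendsto_mult_right_zero[OF tendsto_power_div_exp_0[of m], of "(1/c)^m"]
      by (simp add: power_divide)
    moreover have "filterlim (\<lambda>t. c / t) at_top (at_right 0)"
      using filterlim_tendsto_pos_mult_at_top[OF tendsto_const[of c] assms filterlim_inverse_at_top_right]
      by (simp add: divide_inverse)
    ultimately have "((\<lambda>t. ((c / t) / c) ^ m / exp (c / t)) \<longlongrightarrow> 0) (at_right 0)"
      by (rule filterlim_compose)
    then show ?thesis
      using assms by (simp add: exp_minus power_divide field_simps)
  qed
  have "((\<lambda>t. flat_exp c m t) \<longlongrightarrow> 0) (at_right 0)"
    by (rule Lim_transform_eventually[OF r])
      (auto simp: flat_exp_def eventually_at_filter)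
  moreover have "((\<lambda>t. flat_exp c m t) \<longlongrightarrow> 0) (at_left 0)"
    by (rule Lim_transform_eventually[OF tendsto_const]) (auto simp: flat_exp_def eventually_at_filter)
  ultimately show ?thesis by (rule filterlim_split_at_real[rotated])
qed

text \<open>At the origin the difference quotient of \<open>flat_exp c m\<close> is \<open>flat_exp c (Suc m)\<close>, which tends to \<open>0\<close>.\<close>

lemma flat_exp_has_derivative:
  assumes "c > 0"
  shows "(flat_exp c m has_real_derivative c * flat_exp c (m + 2) t - m * flat_exp c (m + 1) t) (at t)"
proof (cases "t = 0")
  case True
  have "((\<lambda>h. flat_exp c m h / h) \<longlongrightarrow> 0) (at 0)"
    by (rule Lim_transform_eventually[OF flat_exp_tendsto_0[OF assms, of "Suc m"]])
      (auto simp: flat_exp_def eventually_at_filter)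
  then show ?thesis using True by (simp add: DERIV_def flat_exp_def)
next
  case False
  show ?thesis
  proof (cases "t > 0")
    case t: True
    have 1: "((\<lambda>t. exp (- c / t) / t ^ m) has_real_derivative
        c * flat_exp c (m + 2) t - m * flat_exp c (m + 1) t) (at t)"
      using t power_eq_if[of t m]
      by (auto intro!: derivative_eq_intros simp: flat_exp_def field_simps power2_eq_square)
    have "\<forall>\<^sub>F s in nhds t. flat_exp c m s = exp (- c / s) / s ^ m"
      by (rule eventually_nhds_in_open[of "{0<..}", THEN eventually_mono]) (use t in \<open>auto simp: flat_exp_def\<close>)
    from DERIV_cong_ev[OF refl this refl] 1 show ?thesis by simp
  next
    case f: False
    have "\<forall>\<^sub>F s in nhds t. flat_exp c m s = 0"
      by (rule eventually_nhds_in_open[of "{..<0}", THEN eventually_mono]) (use f False in \<open>auto simp: flat_exp_def\<close>)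
    note cong = DERIV_cong_ev[OF refl this refl]
    show ?thesis unfolding cong using f by (simp add: flat_exp_def)
  qed
qed

lemma Ck_flat_exp_affine:
  assumes "c > 0"
  shows "Ck k (\<lambda>x::'a::euclidean_space. flat_exp c m (x \<bullet> i + d))"
proof (induction k arbitrary: m)
  case 0
  have "continuous_on UNIV (flat_exp c m)"
    using flat_exp_has_derivative[OF assms] by (meson DERIV_continuous continuous_at_imp_continuous_on)
  then show ?case
    by (auto intro!: continuous_on_compose2[of UNIV "flat_exp c m"] continuous_intros)
next
  case (Suc k)
  let ?D = "\<lambda>x::'a. c * flat_exp c (m + 2) (x \<bullet> i + d) + - real m * flat_exp c (m + 1) (x \<bullet> i + d)"
  have d: "((\<lambda>x. flat_exp c m (x \<bullet> i + d)) has_derivative (\<lambda>v. (v \<bullet> i) * ?D x)) (at x)" for x :: 'a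
  proof -
    have "((\<lambda>x::'a. x \<bullet> i + d) has_derivative (\<lambda>v. v \<bullet> i)) (at x)"
      by (auto intro!: derivative_eq_intros)
    moreover have "(flat_exp c m has_derivative (\<lambda>s. s * ?D x)) (at (x \<bullet> i + d))"
      using flat_exp_has_derivative[OF assms, of m "x \<bullet> i + d"]
      unfolding has_field_derivative_def by (simp add: mult.commute[of _ "_ - _"])
    ultimately show ?thesis
      using has_derivative_compose by fastforce
  qed
  then have "frechet_derivative (\<lambda>x. flat_exp c m (x \<bullet> i + d)) (at x) v = (v \<bullet> i) * ?D x" for x v :: 'a
    using frechet_derivative_at by metis
  moreover have "Ck k (\<lambda>x. (v \<bullet> i) * ?D x)" for v :: 'a
    by (intro Ck_mult Ck_add Ck_const Suc.IH)
  moreover have "(\<lambda>x. flat_exp c m (x \<bullet> i + d)) differentiable (at x)" for x :: 'a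
    using d by (rule differentiableI)
  ultimately show ?case by simp
qed

text \<open>Test functions supported in a box that increase to its indicator function: as \<open>n\<close> grows, the exponent
\<open>1 / Suc n\<close> pushes every factor at a positive argument towards \<open>1\<close>.\<close>

definition box_bump :: "'a::euclidean_space \<Rightarrow> 'a \<Rightarrow> nat \<Rightarrow> 'a \<Rightarrow> real" where
  "box_bump a b n x = (\<Prod>i\<in>Basis. flat_exp (1 / Suc n) 0 (x \<bullet> i + - (a \<bullet> i)) * flat_exp (1 / Suc n) 0 (x \<bullet> (- i) + b \<bullet> i))"

lemma box_bump_eq_0: "x \<notin> box a b \<Longrightarrow> box_bump a b n x = 0"
  unfolding box_bump_def mem_box by (rule prod_zero) (auto simp: flat_exp_def not_less)

lemma box_bump_bounds: "0 \<le> box_bump a b n x" "box_bump a b n x \<le> 1"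
  by (auto simp: box_bump_def flat_exp_def intro!: prod_nonneg prod_le_1 mult_le_one divide_nonneg_nonneg)

lemma box_bump_test_function:
  assumes "cbox a b \<subseteq> \<Omega>" shows "box_bump a b n \<in> test_functions \<Omega>"
proof -
  have "closure {x. box_bump a b n x \<noteq> 0} \<subseteq> cbox a b"
    by (rule closure_minimal) (use box_bump_eq_0[of _ a b n] box_subset_cbox[of a b] in auto)
  moreover have "Ck k (box_bump a b n)" for k
    unfolding box_bump_def[abs_def] by (intro Ck_prod Ck_mult Ck_flat_exp_affine) auto
  ultimately show ?thesis
    using assms bounded_subset[OF bounded_cbox] unfolding test_functions_def compact_eq_bounded_closed
    by blast
qed

lemma box_bump_tendsto: "(\<lambda>n. box_bump a b n x) \<longlonglongrightarrow> indicator (box a b) x"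
proof (cases "x \<in> box a b")
  case True
  have *: "(\<lambda>n. flat_exp (1 / Suc n) 0 t) \<longlonglongrightarrow> 1" if "t > 0" for t
  proof -
    have "(\<lambda>n. exp (- (1 / Suc n) / t)) \<longlonglongrightarrow> exp (- 0 / t)"
      by (intro tendsto_intros LIMSEQ_inverse_real_of_nat[unfolded inverse_eq_divide]) (use that in auto)
    then show ?thesis using that by (simp add: flat_exp_def)
  qed
  have "(\<lambda>n. box_bump a b n x) \<longlonglongrightarrow> (\<Prod>i\<in>(Basis::'a set). 1 * 1)"
    unfolding box_bump_def using True by (intro tendsto_intros *) (auto simp: mem_box)
  then show ?thesis using True by simp
next
  case False
  then show ?thesis by (simp add: box_bump_eq_0)
qed

section \<open>Square-integrable functions\<close>

lemma L2_measurable [measurable_dest]: "f \<in> L2 M \<Longrightarrow> f \<in> borel_measurable M"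
  by (simp add: L2_def)

lemma L2_integrable_inner:
  assumes "f \<in> L2 M" "g \<in> L2 M" shows "integrable M (\<lambda>x. f x \<bullet> g x)"
proof (rule Bochner_Integration.integrable_bound)
  show "integrable M (\<lambda>x. (norm (f x))\<^sup>2 + (norm (g x))\<^sup>2)"
    using assms by (auto simp: L2_def)
  show "(\<lambda>x. f x \<bullet> g x) \<in> borel_measurable M"
    using assms[THEN L2_measurable] by measurable
  have "\<bar>f x \<bullet> g x\<bar> \<le> (norm (f x))\<^sup>2 + (norm (g x))\<^sup>2" for x
  proof -
    have "\<bar>f x \<bullet> g x\<bar> \<le> norm (f x) * norm (g x)" by (rule Cauchy_Schwarz_ineq2)
    also have "\<dots> \<le> (norm (f x))\<^sup>2 + (norm (g x))\<^sup>2"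
      using sum_squares_bound[of "norm (f x)" "norm (g x)"]
        mult_nonneg_nonneg[OF norm_ge_zero[of "f x"] norm_ge_zero[of "g x"]] by linarith
    finally show ?thesis .
  qed
  then show "AE x in M. norm (f x \<bullet> g x) \<le> norm ((norm (f x))\<^sup>2 + (norm (g x))\<^sup>2)"
    by auto
qed

lemma L2_integrable_mult: "f \<in> L2 M \<Longrightarrow> g \<in> L2 M \<Longrightarrow> integrable M (\<lambda>x. f x * g x :: real)"
  using L2_integrable_inner[of f M g] by simp

lemma L2_scaleR: "f \<in> L2 M \<Longrightarrow> (\<lambda>x. c *\<^sub>R f x) \<in> L2 M"
  by (auto simp: L2_def power_mult_distrib)

lemma L2_add:
  assumes "f \<in> L2 M" "g \<in> L2 M" shows "(\<lambda>x. f x + g x) \<in> L2 M"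
proof -
  have "integrable M (\<lambda>x. (norm (f x))\<^sup>2 + 2 * (f x \<bullet> g x) + (norm (g x))\<^sup>2)"
    using assms L2_integrable_inner[OF assms] by (auto simp: L2_def)
  moreover have "(norm (f x))\<^sup>2 + 2 * (f x \<bullet> g x) + (norm (g x))\<^sup>2 = (norm (f x + g x))\<^sup>2" for x
    by (simp add: power2_norm_eq_inner inner_add inner_commute)
  ultimately show ?thesis using assms by (auto simp: L2_def)
qed

lemma L2_diff: "f \<in> L2 M \<Longrightarrow> g \<in> L2 M \<Longrightarrow> (\<lambda>x. f x - g x) \<in> L2 M"
  using L2_add[of f M "\<lambda>x. (-1) *\<^sub>R g x"] L2_scaleR[of g M "-1"] by simp

lemma L2_zero: "(\<lambda>x. 0) \<in> L2 M"
  by (simp add: L2_def)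

lemma L2_sum: "(\<And>i. i \<in> I \<Longrightarrow> f i \<in> L2 M) \<Longrightarrow> (\<lambda>x. \<Sum>i\<in>I. f i x) \<in> L2 M"
  by (induction I rule: infinite_finite_induct) (auto intro: L2_add L2_zero)

lemma L2_norm_power2: "(L2_norm M f)\<^sup>2 = (\<integral>x. (norm (f x))\<^sup>2 \<partial>M)"
  by (simp add: L2_norm_def L2_inner_def power2_norm_eq_inner)

lemma L2_norm_nonneg: "0 \<le> L2_norm M f"
  by (simp add: L2_norm_def L2_inner_def)

text \<open>Pointwise domination is how every operation on square-integrable functions below, from taking
components to multiplying by a matrix, is seen to be bounded.\<close>

lemma L2_dominated:
  assumes f: "f \<in> L2 M" and g: "g \<in> borel_measurable M" and c: "0 \<le> c"
    and le: "AE x in M. norm (g x) \<le> c * norm (f x)"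
  shows "g \<in> L2 M" "L2_norm M g \<le> c * L2_norm M f"
proof -
  have sq: "AE x in M. (norm (g x))\<^sup>2 \<le> c\<^sup>2 * (norm (f x))\<^sup>2"
    using le by eventually_elim (metis norm_ge_zero power_mono power_mult_distrib)
  have "integrable M (\<lambda>x. (norm (g x))\<^sup>2)"
    by (rule Bochner_Integration.integrable_bound[of _ "\<lambda>x. c\<^sup>2 * (norm (f x))\<^sup>2"])
      (use f g sq in \<open>auto simp: L2_def\<close>)
  then show gL: "g \<in> L2 M" using g by (simp add: L2_def)
  have "(L2_norm M g)\<^sup>2 \<le> (\<integral>x. c\<^sup>2 * (norm (f x))\<^sup>2 \<partial>M)"
    unfolding L2_norm_power2 by (rule integral_mono_AE) (use f gL sq in \<open>auto simp: L2_def\<close>)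
  also have "\<dots> = (c * L2_norm M f)\<^sup>2"
    by (simp add: power_mult_distrib L2_norm_power2)
  finally show "L2_norm M g \<le> c * L2_norm M f"
    by (rule power2_le_imp_le) (use c L2_norm_nonneg[of M f] in simp)
qed

lemma borel_measurable_vec_nth_comp:
  fixes f :: "'a \<Rightarrow> 'b::euclidean_space ^ 'n"
  shows "f \<in> borel_measurable M \<Longrightarrow> (\<lambda>x. f x $ i) \<in> borel_measurable M"
  by (rule borel_measurable_continuous_on[of "\<lambda>y. y $ i"])
    (auto intro: linear_continuous_on bounded_linear_vec_nth)

lemma L2_vec:
  fixes f :: "'a \<Rightarrow> 'b::euclidean_space ^ 'n"
  shows "f \<in> L2 M \<longleftrightarrow> (\<forall>i. (\<lambda>x. f x $ i) \<in> L2 M)"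
proof
  assume f: "f \<in> L2 M"
  have "(\<lambda>x. f x $ i) \<in> L2 M" for i
    by (rule L2_dominated(1)[OF f borel_measurable_vec_nth_comp[OF L2_measurable[OF f]], of 1])
      (auto intro: Finite_Cartesian_Product.norm_nth_le)
  then show "\<forall>i. (\<lambda>x. f x $ i) \<in> L2 M" by blast
next
  assume f: "\<forall>i. (\<lambda>x. f x $ i) \<in> L2 M"
  have m: "(\<lambda>x. f x $ i) \<in> borel_measurable M" for i
    using f by (intro L2_measurable) (rule spec)
  have "f \<in> borel_measurable M"
  proof (rule borel_measurable_euclidean_space[THEN iffD2], rule ballI)
    fix b :: "'b ^ 'n" assume "b \<in> Basis"
    then obtain i u where b: "b = axis i u" by (auto simp: Basis_vec_def)
    show "(\<lambda>x. f x \<bullet> b) \<in> borel_measurable M"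
      unfolding b inner_axis using m by (intro borel_measurable_inner measurable_const) auto
  qed
  moreover have "(norm (f x))\<^sup>2 = (\<Sum>i\<in>UNIV. (norm (f x $ i))\<^sup>2)" for x
    unfolding power2_norm_eq_inner inner_vec_def ..
  moreover have "integrable M (\<lambda>x. \<Sum>i\<in>UNIV. (norm (f x $ i))\<^sup>2)"
    using f by (intro Bochner_Integration.integrable_sum) (simp add: L2_def)
  ultimately show "f \<in> L2 M" by (simp add: L2_def)
qed

text \<open>The quadratic \<open>t \<mapsto> \<parallel>f - t g\<parallel>\<^sup>2\<close> is nonnegative. Unless \<open>\<parallel>g\<parallel> = 0\<close>, evaluate it at its minimum; otherwise it
is affine in \<open>t\<close>, which forces the inner product to vanish.\<close>

lemma L2_Cauchy_Schwarz:
  assumes f: "f \<in> L2 M" and g: "g \<in> L2 M"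
  shows "\<bar>L2_inner M f g\<bar> \<le> L2_norm M f * L2_norm M g"
proof -
  let ?a = "(L2_norm M f)\<^sup>2" and ?b = "L2_inner M f g" and ?c = "(L2_norm M g)\<^sup>2"
  have quad: "0 \<le> ?a - 2 * t * ?b + t\<^sup>2 * ?c" for t
  proof -
    have "0 \<le> (\<integral>x. (norm (f x - t *\<^sub>R g x))\<^sup>2 \<partial>M)" by simp
    also have "\<dots> = (\<integral>x. (norm (f x))\<^sup>2 - 2 * t * (f x \<bullet> g x) + t\<^sup>2 * (norm (g x))\<^sup>2 \<partial>M)"
    proof (rule Bochner_Integration.integral_cong[OF refl])
      fix x
      have "(norm (f x - t *\<^sub>R g x))\<^sup>2 = (f x - t *\<^sub>R g x) \<bullet> (f x - t *\<^sub>R g x)"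
        by (rule power2_norm_eq_inner)
      also have "\<dots> = f x \<bullet> f x - 2 * t * (f x \<bullet> g x) + t * t * (g x \<bullet> g x)"
        by (simp add: inner_diff_left inner_diff_right inner_commute[of "g x" "f x"] algebra_simps)
      finally show "(norm (f x - t *\<^sub>R g x))\<^sup>2 = (norm (f x))\<^sup>2 - 2 * t * (f x \<bullet> g x) + t\<^sup>2 * (norm (g x))\<^sup>2"
        by (simp only: power2_norm_eq_inner power2_eq_square[of t])
    qed
    also have "\<dots> = ?a - 2 * t * ?b + t\<^sup>2 * ?c"
      using f g L2_integrable_inner[OF f g] unfolding L2_norm_power2 by (simp add: L2_def L2_inner_def)
    finally show ?thesis .
  qed
  have "?b\<^sup>2 \<le> ?a * ?c"
  proof (cases "?c = 0")
    case True
    have "?b = 0"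
    proof (rule ccontr)
      assume b: "?b \<noteq> 0"
      have "0 \<le> ?a - 2 * ((?a + 1) / (2 * ?b)) * ?b"
        using quad[of "(?a + 1) / (2 * ?b)"] True by simp
      then show False using b by (simp add: field_simps)
    qed
    then show ?thesis by simp
  next
    case False
    then have "?c > 0" by simp
    have e: "?a - 2 * (?b / ?c) * ?b + (?b / ?c)\<^sup>2 * ?c = (?a * ?c - ?b\<^sup>2) / ?c"
      using False by (simp add: field_simps power2_eq_square)
    show ?thesis using quad[of "?b / ?c"] \<open>?c > 0\<close> unfolding e by (simp add: zero_le_divide_iff)
  qed
  then have "\<bar>?b\<bar>\<^sup>2 \<le> (L2_norm M f * L2_norm M g)\<^sup>2" by (simp add: power_mult_distrib)
  then show ?thesis by (rule power2_le_imp_le) (simp add: L2_norm_nonneg)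
qed

lemma L2_bounded:
  assumes "finite_measure M" "f \<in> borel_measurable M" "AE x in M. norm (f x) \<le> c"
  shows "f \<in> L2 M"
proof -
  interpret finite_measure M by fact
  have "AE x in M. norm ((norm (f x))\<^sup>2) \<le> c\<^sup>2"
    using assms(3) by eventually_elim (auto intro: power_mono)
  then have "integrable M (\<lambda>x. (norm (f x))\<^sup>2)"
    by (rule integrable_const_bound) (use assms(2) in measurable)
  then show ?thesis using assms(2) by (simp add: L2_def)
qed

lemma finite_measure_lebesgue_on: "S \<in> lmeasurable \<Longrightarrow> finite_measure (lebesgue_on S)"
  by (rule finite_measureI) (auto simp: emeasure_restrict_space fmeasurable_def)

lemma finite_measure_lebesgue_on_bounded_open:
  "open S \<Longrightarrow> bounded S \<Longrightarrow> finite_measure (lebesgue_on (S::'a::euclidean_space set))"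
  by (intro finite_measure_lebesgue_on lmeasurable_open)

lemma L2_imp_integrable:
  assumes "finite_measure M" "f \<in> L2 M" shows "integrable M f"
proof -
  interpret finite_measure M by fact
  have "integrable M (\<lambda>x. 1 + (norm (f x))\<^sup>2)" using assms by (auto simp: L2_def)
  moreover have "norm (f x) \<le> 1 + (norm (f x))\<^sup>2" for x
    using sum_squares_bound[of 1 "norm (f x)", simplified] norm_ge_zero[of "f x"] by linarith
  ultimately show ?thesis
    using assms by (auto intro!: Bochner_Integration.integrable_bound[of _ "\<lambda>x. 1 + (norm (f x))\<^sup>2" f] simp: L2_def)
qed

section \<open>The fundamental lemma of the calculus of variations\<close>

text \<open>The positive and the negative part of \<open>h\<close> are densities of finite measures that agree on all
boxes. Boxes form an intersection-stable generator of the Borel sets, so the measures, and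
with them their densities, coincide.\<close>

lemma AE_zero_if_zero_on_boxes:
  fixes h :: "'a::euclidean_space \<Rightarrow> real"
  assumes h: "integrable lborel h"
    and zero: "\<And>a b. (\<integral>x. indicator (box a b) x * h x \<partial>lborel) = 0"
  shows "AE x in lborel. h x = 0"
proof -
  note [measurable] = borel_measurable_integrable[OF h]
  let ?P = "density lborel (\<lambda>x. ennreal (h x))" and ?N = "density lborel (\<lambda>x. ennreal (- h x))"
  have e: "(\<integral>\<^sup>+x. ennreal (f x) * indicator A x \<partial>lborel) = ennreal (\<integral>x. indicator A x * max 0 (f x) \<partial>lborel)"
    if f: "integrable lborel f" and A: "A \<in> sets borel" for f :: "'a \<Rightarrow> real" and A
  proof -
    have "integrable lborel (\<lambda>x. indicator A x *\<^sub>R max 0 (f x))"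
      using f A by (intro integrable_mult_indicator integrable_max) auto
    then have "(\<integral>\<^sup>+x. ennreal (indicator A x * max 0 (f x)) \<partial>lborel) = ennreal (\<integral>x. indicator A x * max 0 (f x) \<partial>lborel)"
      by (intro nn_integral_eq_integral) auto
    moreover have "ennreal (f x) * indicator A x = ennreal (indicator A x * max 0 (f x))" for x
      by (auto simp: indicator_def max_def ennreal_neg)
    ultimately show ?thesis by simp
  qed
  have "?P = ?N"
  proof (rule measure_eqI_generator_eq)
    let ?E = "range (\<lambda>(a, b). box a b :: 'a set)"
    show "Int_stable ?E" by (auto simp: Int_stable_def box_Int_box)
    show "?E \<subseteq> Pow UNIV" "sets ?P = sigma_sets UNIV ?E" "sets ?N = sigma_sets UNIV ?E"
      by (simp_all add: borel_eq_box)
    let ?A = "\<lambda>n::nat. box (- (real n *\<^sub>R One)) (real n *\<^sub>R One) :: 'a set"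
    show "range ?A \<subseteq> ?E" "(\<Union>i. ?A i) = UNIV" unfolding UN_box_eq_UNIV by auto
    show "emeasure ?P (?A i) \<noteq> \<infinity>" for i
      using e[OF h, of "?A i"] by (simp add: emeasure_density)
    fix X assume "X \<in> ?E"
    then obtain a b where X: "X = box a b" by auto
    have int: "integrable lborel (\<lambda>x. indicator X x *\<^sub>R max 0 (h x))"
      "integrable lborel (\<lambda>x. indicator X x *\<^sub>R max 0 (- h x))"
      using h unfolding X by (intro integrable_mult_indicator integrable_max; simp)+
    have "(\<integral>x. indicator X x * max 0 (h x) \<partial>lborel) - (\<integral>x. indicator X x * max 0 (- h x) \<partial>lborel)
       = (\<integral>x. indicator X x * max 0 (h x) - indicator X x * max 0 (- h x) \<partial>lborel)"
      using int by (subst Bochner_Integration.integral_diff) simp_all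
    also have "\<dots> = (\<integral>x. indicator X x * h x \<partial>lborel)"
      by (rule Bochner_Integration.integral_cong) (auto simp: indicator_def max_def)
    finally have "(\<integral>x. indicator X x * max 0 (h x) \<partial>lborel) = (\<integral>x. indicator X x * max 0 (- h x) \<partial>lborel)"
      using zero X by simp
    then show "emeasure ?P X = emeasure ?N X"
      using e[OF h, of X] e[of "\<lambda>x. - h x" X] h X by (simp add: emeasure_density)
  qed
  then have "AE x in lborel. ennreal (h x) = ennreal (- h x)"
    by (intro sigma_finite_measure.density_unique[OF sigma_finite_lborel]) auto
  then show ?thesis
  proof eventually_elim
    case (elim x)
    then show ?case
      by (cases "0 \<le> h x") (auto simp: ennreal_neg ennreal_eq_0_iff dest: sym)
  qed
qed

lemma AE_lebesgue_on_open_iff: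
  "open \<Omega> \<Longrightarrow> (AE x in lebesgue_on \<Omega>. P x) \<longleftrightarrow> (AE x in lebesgue. x \<in> \<Omega> \<longrightarrow> P x)"
  by (subst AE_restrict_space_iff) auto

text \<open>The bumps converge to indicator functions, so \<open>h\<close> has integral zero over each box whose closure
lies in \<open>\<Omega>\<close>. Cutting \<open>h\<close> off outside one such box turns this into a statement about all boxes,
and countably many closed boxes cover \<open>\<Omega>\<close>.\<close>

lemma AE_zero_if_zero_against_test_functions:
  fixes h :: "'a::euclidean_space \<Rightarrow> real"
  assumes \<Omega>: "open \<Omega>" and h: "integrable (lebesgue_on \<Omega>) h"
    and zero: "\<And>\<phi>. \<phi> \<in> test_functions \<Omega> \<Longrightarrow> (\<integral>x. h x * \<phi> x \<partial>lebesgue_on \<Omega>) = 0"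
  shows "AE x in lebesgue_on \<Omega>. h x = 0"
proof -
  have \<Omega>s: "\<Omega> \<inter> space lebesgue \<in> sets lebesgue" using \<Omega> by auto
  have box0: "(\<integral>x. h x * indicator (box a b) x \<partial>lebesgue_on \<Omega>) = 0" if ab: "cbox a b \<subseteq> \<Omega>" for a b
  proof -
    have bm: "box_bump a b n \<in> borel_measurable (lebesgue_on \<Omega>)" for n
    proof -
      have "Ck 0 (box_bump a b n)" using box_bump_test_function[OF ab, of n] unfolding test_functions_def by blast
      then have "continuous_on UNIV (box_bump a b n)" by simp
      then show ?thesis
        using \<Omega> by (intro continuous_imp_measurable_on_sets_lebesgue) (auto intro: continuous_on_subset)
    qed
    have "(\<lambda>n. \<integral>x. h x * box_bump a b n x \<partial>lebesgue_on \<Omega>) \<longlonglongrightarrow> (\<integral>x. h x * indicator (box a b) x \<partial>lebesgue_on \<Omega>)"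
    proof (rule integral_dominated_convergence)
      show "integrable (lebesgue_on \<Omega>) (\<lambda>x. norm (h x))" using h by simp
      show "(\<lambda>x. h x * indicator (box a b) x) \<in> borel_measurable (lebesgue_on \<Omega>)"
        by (rule borel_measurable_times[OF borel_measurable_integrable[OF h]],
            intro measurable_restrict_space1 measurable_completion) auto
      show "(\<lambda>x. h x * box_bump a b n x) \<in> borel_measurable (lebesgue_on \<Omega>)" for n
        using h bm by auto
      show "AE x in lebesgue_on \<Omega>. (\<lambda>n. h x * box_bump a b n x) \<longlonglongrightarrow> h x * indicator (box a b) x"
        by (intro AE_I2 tendsto_intros box_bump_tendsto)
      show "AE x in lebesgue_on \<Omega>. norm (h x * box_bump a b n x) \<le> norm (h x)" for n
        using box_bump_bounds[of a b n] by (intro AE_I2) (simp add: abs_mult mult_left_le)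
    qed
    then show ?thesis using zero[OF box_bump_test_function[OF ab]] by (simp add: LIMSEQ_const_iff)
  qed
  let ?h0 = "\<lambda>x. indicator \<Omega> x * h x"
  have h0: "integrable lebesgue ?h0" using h by (simp add: integrable_restrict_space[OF \<Omega>s])
  \<comment> \<open>Lebesgue measurable functions agree almost everywhere with Borel ones, for which boxes are decisive.\<close>
  obtain h' where h'm [measurable]: "h' \<in> borel_measurable lborel" and h': "AE x in lborel. ?h0 x = h' x"
    using completion_ex_borel_measurable_real[OF borel_measurable_integrable[OF h0]] by auto
  have h'c: "AE x in lebesgue. ?h0 x = h' x" using h' by (rule AE_completion)
  have "integrable lebesgue h'"
    using integrable_cong_AE[THEN iffD1, OF borel_measurable_integrable[OF h0] measurable_completion[OF h'm] h'c h0] .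
  then have h'i: "integrable lborel h'" using integrable_completion[OF h'm] by simp
  have h'0: "(\<integral>x. indicator (box a b) x * h' x \<partial>lborel) = 0" if ab: "cbox a b \<subseteq> \<Omega>" for a b
  proof -
    have "(\<integral>x. indicator (box a b) x * h' x \<partial>lborel) = (\<integral>x. indicator (box a b) x * h' x \<partial>lebesgue)"
      by (rule integral_completion[symmetric]) measurable
    also have "\<dots> = (\<integral>x. indicator (box a b) x * ?h0 x \<partial>lebesgue)"
    proof (rule integral_cong_AE)
      show "AE x in lebesgue. indicator (box a b) x * h' x = indicator (box a b) x * ?h0 x"
        using h'c by eventually_elim auto
      show "(\<lambda>x. indicator (box a b) x * h' x) \<in> borel_measurable lebesgue"
        by (rule measurable_completion) measurable
      show "(\<lambda>x. indicator (box a b) x * ?h0 x) \<in> borel_measurable lebesgue"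
        by (rule borel_measurable_times[OF measurable_completion borel_measurable_integrable[OF h0]]) measurable
    qed
    also have "\<dots> = (\<integral>x. h x * indicator (box a b) x \<partial>lebesgue_on \<Omega>)"
      unfolding integral_restrict_space[OF \<Omega>s] by (rule Bochner_Integration.integral_cong) auto
    finally show ?thesis using box0[OF ab] by simp
  qed
  have local: "AE x in lborel. x \<in> cbox a b \<longrightarrow> h' x = 0" if ab: "cbox a b \<subseteq> \<Omega>" for a b
  proof -
    have "AE x in lborel. indicator (box a b) x * h' x = 0"
    proof (rule AE_zero_if_zero_on_boxes)
      show "integrable lborel (\<lambda>x. indicator (box a b) x * h' x)"
        using integrable_mult_indicator[OF _ h'i, of "box a b"] by simp
      fix c d :: 'a
      obtain a' b' where ab': "box c d \<inter> box a b = box a' b'" using box_Int_box[of c d a b] by blast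
      have "(\<integral>x. indicator (box a' b') x * h' x \<partial>lborel) = 0"
      proof (cases "box a' b' = {}")
        case False
        then have "cbox a' b' = closure (box a' b')" by simp
        also have "\<dots> \<subseteq> cbox a b"
          by (rule closure_minimal) (use ab' box_subset_cbox[of a b] in auto)
        finally show ?thesis using ab by (intro h'0) (rule order_trans)
      qed simp
      moreover have eq: "indicator (box c d) x * (indicator (box a b) x * h' x) = indicator (box a' b') x * h' x" for x
        unfolding ab'[symmetric] by (auto simp: indicator_def)
      ultimately show "(\<integral>x. indicator (box c d) x * (indicator (box a b) x * h' x) \<partial>lborel) = 0"
        by (simp only: eq)
    qed
    moreover have "AE x in lborel. x \<notin> cbox a b - box a b"
    proof (rule AE_not_in)
      have "negligible (cbox a b - box a b)" by (rule negligible_frontier_interval)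
      then show "cbox a b - box a b \<in> null_sets lborel"
        unfolding negligible_iff_null_sets by (auto simp: null_sets_completion_iff)
    qed
    ultimately show ?thesis by eventually_elim (auto simp: indicator_def split: if_splits)
  qed
  obtain D where D: "countable D" "D \<subseteq> Pow \<Omega>" "\<And>X. X \<in> D \<Longrightarrow> \<exists>a b. X = cbox a b" "\<Union>D = \<Omega>"
    using open_countable_Union_open_cbox[OF \<Omega>] by blast
  have "AE x in lborel. \<forall>X\<in>D. x \<in> X \<longrightarrow> h' x = 0"
  proof (subst AE_ball_countable[OF D(1)], intro ballI)
    fix X assume "X \<in> D"
    then show "AE x in lborel. x \<in> X \<longrightarrow> h' x = 0" using D(2,3) local by blast
  qed
  then have "AE x in lebesgue. \<forall>X\<in>D. x \<in> X \<longrightarrow> h' x = 0" by (rule AE_completion)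
  then have "AE x in lebesgue. x \<in> \<Omega> \<longrightarrow> h x = 0"
    using h'c by eventually_elim (use D(4) in \<open>force simp: indicator_def split: if_splits\<close>)
  then show ?thesis using AE_lebesgue_on_open_iff[OF \<Omega>] by blast
qed

section \<open>Weak gradients and divergences\<close>

lemma test_continuous: "\<phi> \<in> test_functions \<Omega> \<Longrightarrow> continuous_on UNIV \<phi>"
  unfolding test_functions_def using Ck.simps(1) by blast

text \<open>A linear functional is the inner product with the vector of its values on the standard basis.\<close>

lemma test_has_derivative:
  fixes \<phi> :: "real ^ 'd \<Rightarrow> real"
  assumes "\<phi> \<in> test_functions \<Omega>"
  shows "(\<phi> has_derivative (\<lambda>h. classical_grad \<phi> x \<bullet> h)) (at x)"
proof -
  let ?D = "frechet_derivative \<phi> (at x)"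
  have "Ck (Suc 0) \<phi>" using assms by (simp add: test_functions_def del: Ck.simps)
  then have D: "(\<phi> has_derivative ?D) (at x)" by (simp add: frechet_derivative_works[symmetric])
  interpret linear ?D using D by (rule has_derivative_linear)
  have "?D = (\<lambda>h. classical_grad \<phi> x \<bullet> h)"
  proof
    fix h
    have "?D h = ?D (\<Sum>j\<in>UNIV. (h $ j) *\<^sub>R axis j 1)"
      by (simp only: scalar_mult_eq_scaleR[symmetric] basis_expansion)
    also have "\<dots> = classical_grad \<phi> x \<bullet> h"
      by (simp add: sum scale classical_grad_def inner_vec_def mult.commute)
    finally show "?D h = classical_grad \<phi> x \<bullet> h" .
  qed
  then show ?thesis using D by simp
qed

lemma test_grad_continuous:
  fixes \<phi> :: "real ^ 'd \<Rightarrow> real"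
  assumes "\<phi> \<in> test_functions \<Omega>"
  shows "continuous_on UNIV (classical_grad \<phi>)"
proof -
  have "Ck (Suc 0) \<phi>" using assms by (simp add: test_functions_def del: Ck.simps)
  then have "continuous_on UNIV (\<lambda>x. frechet_derivative \<phi> (at x) v)" for v by simp
  then show ?thesis unfolding classical_grad_def[abs_def] by (rule continuous_on_vec_lambda)
qed

text \<open>Off the closed support a test function is locally constant, so its gradient has the same compact
support.\<close>

lemma test_support:
  fixes \<phi> :: "real ^ 'd \<Rightarrow> real"
  assumes "\<phi> \<in> test_functions \<Omega>"
  obtains S where "compact S" "S \<subseteq> \<Omega>" "\<forall>x\<in>- S. \<phi> x = 0" "\<forall>x\<in>- S. classical_grad \<phi> x = 0"
proof
  let ?S = "closure {x. \<phi> x \<noteq> 0}"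
  show "compact ?S" "?S \<subseteq> \<Omega>" using assms by (auto simp: test_functions_def)
  show z: "\<forall>x\<in>- ?S. \<phi> x = 0" using closure_subset[of "{x. \<phi> x \<noteq> 0}"] by blast
  show "\<forall>x\<in>- ?S. classical_grad \<phi> x = 0"
  proof
    fix x assume x: "x \<in> - ?S"
    have "(\<phi> has_derivative (\<lambda>h. 0)) (at x)"
    proof (rule has_derivative_transform_within_open[OF has_derivative_const])
      show "open (- ?S)" by (rule open_Compl) (rule closed_closure)
      show "x \<in> - ?S" by (rule x)
      show "0 = \<phi> y" if "y \<in> - ?S" for y using bspec[OF z that] by (rule sym)
    qed
    from frechet_derivative_at[OF this] have "frechet_derivative \<phi> (at x) v = 0" for v by metis
    then show "classical_grad \<phi> x = 0" by (simp add: classical_grad_def vec_eq_iff)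
  qed
qed

lemma bounded_if_compactly_supported:
  fixes f :: "'a::euclidean_space \<Rightarrow> 'b::real_normed_vector"
  assumes "continuous_on UNIV f" "compact S" "\<forall>x\<in>- S. f x = 0"
  obtains c where "0 \<le> c" "\<And>x. norm (f x) \<le> c"
proof -
  have "compact (f ` S)" using assms by (intro compact_continuous_image) (auto intro: continuous_on_subset)
  then have "bounded (f ` S)" by (rule compact_imp_bounded)
  then obtain c where c: "0 < c" "\<forall>y\<in>f ` S. norm y \<le> c" unfolding bounded_pos by blast
  show ?thesis
  proof
    show "0 \<le> c" using c by simp
    show "norm (f x) \<le> c" for x using c assms(3) by (cases "x \<in> S") auto
  qed
qed

lemma continuous_lebesgue_on_measurable:
  fixes f :: "'a::euclidean_space \<Rightarrow> 'b::euclidean_space"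
  shows "open \<Omega> \<Longrightarrow> continuous_on UNIV f \<Longrightarrow> f \<in> borel_measurable (lebesgue_on \<Omega>)"
  by (intro continuous_imp_measurable_on_sets_lebesgue) (auto intro: continuous_on_subset)

lemma test_L2:
  fixes \<phi> :: "real ^ 'd \<Rightarrow> real"
  assumes "open \<Omega>" "bounded \<Omega>" "\<phi> \<in> test_functions \<Omega>"
  shows "\<phi> \<in> L2 (lebesgue_on \<Omega>)" "classical_grad \<phi> \<in> L2 (lebesgue_on \<Omega>)"
proof -
  obtain S where S: "compact S" "S \<subseteq> \<Omega>" "\<forall>x\<in>- S. \<phi> x = 0" "\<forall>x\<in>- S. classical_grad \<phi> x = 0"
    by (rule test_support[OF assms(3)]) blast
  note fm = finite_measure_lebesgue_on_bounded_open[OF assms(1,2)]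
  obtain c where "\<And>x. norm (\<phi> x) \<le> c"
    using bounded_if_compactly_supported[OF test_continuous[OF assms(3)] S(1,3)] by blast
  then show "\<phi> \<in> L2 (lebesgue_on \<Omega>)"
    by (intro L2_bounded[OF fm] continuous_lebesgue_on_measurable assms(1) test_continuous[OF assms(3)]) auto
  obtain c where "\<And>x. norm (classical_grad \<phi> x) \<le> c"
    using bounded_if_compactly_supported[OF test_grad_continuous[OF assms(3)] S(1,4)] by blast
  then show "classical_grad \<phi> \<in> L2 (lebesgue_on \<Omega>)"
    by (intro L2_bounded[OF fm] continuous_lebesgue_on_measurable assms(1) test_grad_continuous[OF assms(3)]) auto
qed

lemma L2_integrable_scaleR:
  fixes g :: "'a \<Rightarrow> real ^ 'n"
  assumes f: "f \<in> L2 M" and g: "g \<in> L2 M"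
  shows "integrable M (\<lambda>x. f x *\<^sub>R g x)"
proof (rule Bochner_Integration.integrable_bound)
  have "(\<lambda>x. norm (g x)) \<in> L2 M" using g by (auto simp: L2_def)
  then show "integrable M (\<lambda>x. norm (f x) * norm (g x))"
    using L2_integrable_mult[of "\<lambda>x. norm (f x)"] f by (auto simp: L2_def)
qed (use assms[THEN L2_measurable] in auto)

text \<open>Integration commutes with taking components because all products below are integrable.\<close>

lemma has_weak_grad_iff:
  assumes "open \<Omega>" "bounded \<Omega>" and f: "f \<in> L2 (lebesgue_on \<Omega>)" and g: "g \<in> L2 (lebesgue_on \<Omega>)"
  shows "has_weak_grad \<Omega> f g \<longleftrightarrow> (\<forall>\<phi>\<in>test_functions \<Omega>. \<forall>j.
    (\<integral>x. f x * classical_grad \<phi> x $ j \<partial>lebesgue_on \<Omega>) = - (\<integral>x. \<phi> x * g x $ j \<partial>lebesgue_on \<Omega>))"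
proof -
  have comp: "(\<integral>x. a x *\<^sub>R b x \<partial>lebesgue_on \<Omega>) $ j = (\<integral>x. a x * b x $ j \<partial>lebesgue_on \<Omega>)"
    if "a \<in> L2 (lebesgue_on \<Omega>)" "b \<in> L2 (lebesgue_on \<Omega>)" for a and b :: "real ^ 'a \<Rightarrow> real ^ 'a" and j
    using integral_bounded_linear[OF bounded_linear_vec_nth L2_integrable_scaleR[OF that], of j] by simp
  show ?thesis
    unfolding has_weak_grad_def vec_eq_iff
    using g by (auto simp: comp f g test_L2[OF assms(1,2)])
qed

lemma has_weak_grad_unique:
  assumes \<Omega>: "open \<Omega>" "bounded \<Omega>" and g: "has_weak_grad \<Omega> f g" "has_weak_grad \<Omega> f g'"
  shows "AE x in lebesgue_on \<Omega>. g x = g' x"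
proof -
  let ?M = "lebesgue_on \<Omega>"
  have L: "g \<in> L2 ?M" "g' \<in> L2 ?M" using g by (auto simp: has_weak_grad_def)
  have "AE x in ?M. g x $ j - g' x $ j = 0" for j
  proof (rule AE_zero_if_zero_against_test_functions[OF \<Omega>(1)])
    have gj: "(\<lambda>x. g x $ j) \<in> L2 ?M" "(\<lambda>x. g' x $ j) \<in> L2 ?M" using L L2_vec by blast+
    then show "integrable ?M (\<lambda>x. g x $ j - g' x $ j)"
      by (intro L2_imp_integrable L2_diff finite_measure_lebesgue_on_bounded_open \<Omega>)
    fix \<phi> assume \<phi>: "\<phi> \<in> test_functions \<Omega>"
    have P: "\<phi> \<in> L2 ?M" using test_L2(1)[OF \<Omega> \<phi>] .
    have e: "(\<integral>x. f x *\<^sub>R classical_grad \<phi> x \<partial>?M) = - (\<integral>x. \<phi> x *\<^sub>R a x \<partial>?M)"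
      if "has_weak_grad \<Omega> f a" for a using that \<phi> unfolding has_weak_grad_def by blast
    have "(\<integral>x. \<phi> x *\<^sub>R g x \<partial>?M) = (\<integral>x. \<phi> x *\<^sub>R g' x \<partial>?M)"
      using e[OF g(1)] e[OF g(2)] by simp
    moreover have "(\<integral>x. \<phi> x *\<^sub>R a x \<partial>?M) $ j = (\<integral>x. \<phi> x * a x $ j \<partial>?M)" if "a \<in> L2 ?M" for a :: "real^'a \<Rightarrow> real^'a"
      using integral_bounded_linear[OF bounded_linear_vec_nth L2_integrable_scaleR[OF P that], of j] by simp
    note nth = this
    ultimately have "(\<integral>x. \<phi> x * g x $ j \<partial>?M) = (\<integral>x. \<phi> x * g' x $ j \<partial>?M)"
      unfolding nth[OF L(1), symmetric] nth[OF L(2), symmetric] by simp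
    moreover have "(\<integral>x. (g x $ j - g' x $ j) * \<phi> x \<partial>?M) = (\<integral>x. \<phi> x * g x $ j \<partial>?M) - (\<integral>x. \<phi> x * g' x $ j \<partial>?M)"
      using L2_integrable_mult[OF P gj(1)] L2_integrable_mult[OF P gj(2)]
      by (subst Bochner_Integration.integral_diff[symmetric]) (auto simp: algebra_simps)
    ultimately show "(\<integral>x. (g x $ j - g' x $ j) * \<phi> x \<partial>?M) = 0" by simp
  qed
  then have "AE x in ?M. \<forall>j\<in>UNIV. g x $ j - g' x $ j = 0" by (subst AE_ball_countable) (auto intro: countable_finite)
  then show ?thesis by eventually_elim (simp add: vec_eq_iff)
qed

lemma has_weak_div_unique:
  assumes \<Omega>: "open \<Omega>" "bounded \<Omega>" and g: "has_weak_div \<Omega> w g" "has_weak_div \<Omega> w g'"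
  shows "AE x in lebesgue_on \<Omega>. g x = g' x"
proof -
  let ?M = "lebesgue_on \<Omega>"
  have L: "g \<in> L2 ?M" "g' \<in> L2 ?M" using g by (auto simp: has_weak_div_def)
  have "AE x in ?M. g x - g' x = 0"
  proof (rule AE_zero_if_zero_against_test_functions[OF \<Omega>(1)])
    show "integrable ?M (\<lambda>x. g x - g' x)"
      by (intro L2_imp_integrable L2_diff finite_measure_lebesgue_on_bounded_open \<Omega> L)
    fix \<phi> assume \<phi>: "\<phi> \<in> test_functions \<Omega>"
    have P: "\<phi> \<in> L2 ?M" using test_L2(1)[OF \<Omega> \<phi>] .
    have e: "(\<integral>x. w x \<bullet> classical_grad \<phi> x \<partial>?M) = - (\<integral>x. a x * \<phi> x \<partial>?M)"
      if "has_weak_div \<Omega> w a" for a using that \<phi> unfolding has_weak_div_def by blast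
    have "(\<integral>x. g x * \<phi> x \<partial>?M) = (\<integral>x. g' x * \<phi> x \<partial>?M)"
      using e[OF g(1)] e[OF g(2)] by simp
    moreover have "(\<integral>x. (g x - g' x) * \<phi> x \<partial>?M) = (\<integral>x. g x * \<phi> x \<partial>?M) - (\<integral>x. g' x * \<phi> x \<partial>?M)"
      using L2_integrable_mult[OF L(1) P] L2_integrable_mult[OF L(2) P]
      by (subst Bochner_Integration.integral_diff[symmetric]) (auto simp: algebra_simps)
    ultimately show "(\<integral>x. (g x - g' x) * \<phi> x \<partial>?M) = 0" by simp
  qed
  then show ?thesis by eventually_elim simp
qed

lemma has_weak_grad_weak_grad: "has_weak_grad \<Omega> f g \<Longrightarrow> has_weak_grad \<Omega> f (weak_grad \<Omega> f)"
  unfolding weak_grad_def by (rule someI[of "has_weak_grad \<Omega> f"])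

text \<open>The operators \<open>weak_grad\<close> and \<open>weak_div\<close> are choices; they have the property they are chosen for as soon
as some weak derivative exists.\<close>

lemma has_weak_grad_of_H1: "f \<in> H1 \<Omega> \<Longrightarrow> has_weak_grad \<Omega> f (weak_grad \<Omega> f)"
  unfolding H1_def using has_weak_grad_weak_grad by blast

lemma has_weak_div_weak_div: "has_weak_div \<Omega> w g \<Longrightarrow> has_weak_div \<Omega> w (weak_div \<Omega> w)"
  unfolding weak_div_def by (rule someI[of "has_weak_div \<Omega> w"])

text \<open>The zero field is a weak gradient here, and by uniqueness the chosen one agrees with it almost everywhere.\<close>

lemma weak_grad_zero:
  assumes "open \<Omega>" "bounded \<Omega>" "AE x in lebesgue_on \<Omega>. f x = 0"
  shows "AE x in lebesgue_on \<Omega>. weak_grad \<Omega> f x = 0"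
proof -
  have "(\<integral>x. f x *\<^sub>R classical_grad \<phi> x \<partial>lebesgue_on \<Omega>) = 0" for \<phi>
    by (rule integral_eq_zero_AE) (use assms(3) in eventually_elim, simp)
  then have z: "has_weak_grad \<Omega> f (\<lambda>x. 0)" by (simp add: has_weak_grad_def L2_zero)
  then have "has_weak_grad \<Omega> f (weak_grad \<Omega> f)" by (rule has_weak_grad_weak_grad)
  from has_weak_grad_unique[OF assms(1,2) this z] show ?thesis .
qed

lemma weak_div_zero:
  assumes "open \<Omega>" "bounded \<Omega>" "AE x in lebesgue_on \<Omega>. w x = 0"
  shows "AE x in lebesgue_on \<Omega>. weak_div \<Omega> w x = 0"
proof -
  have "(\<integral>x. w x \<bullet> classical_grad \<phi> x \<partial>lebesgue_on \<Omega>) = 0" for \<phi>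
    by (rule integral_eq_zero_AE) (use assms(3) in eventually_elim, simp)
  then have z: "has_weak_div \<Omega> w (\<lambda>x. 0)" by (simp add: has_weak_div_def L2_zero)
  from has_weak_div_unique[OF assms(1,2) has_weak_div_weak_div[OF z] z] show ?thesis .
qed

lemma H1_scaleR:
  assumes "f \<in> H1 \<Omega>" shows "(\<lambda>x. c * f x) \<in> H1 \<Omega>"
proof -
  obtain g where g: "has_weak_grad \<Omega> f g" and f: "f \<in> L2 (lebesgue_on \<Omega>)" using assms by (auto simp: H1_def)
  have "(\<integral>x. (c * f x) *\<^sub>R classical_grad \<phi> x \<partial>(lebesgue_on \<Omega>)) = - (\<integral>x. \<phi> x *\<^sub>R (c *\<^sub>R g x) \<partial>(lebesgue_on \<Omega>))"
    if \<phi>: "\<phi> \<in> test_functions \<Omega>" for \<phi>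
  proof -
    have "(\<integral>x. (c * f x) *\<^sub>R classical_grad \<phi> x \<partial>(lebesgue_on \<Omega>)) = (\<integral>x. c *\<^sub>R (f x *\<^sub>R classical_grad \<phi> x) \<partial>(lebesgue_on \<Omega>))"
      by simp
    also have "\<dots> = c *\<^sub>R (- (\<integral>x. \<phi> x *\<^sub>R g x \<partial>(lebesgue_on \<Omega>)))"
      using g \<phi> by (subst integral_scaleR_right) (auto simp: has_weak_grad_def)
    also have "\<dots> = - (\<integral>x. c *\<^sub>R (\<phi> x *\<^sub>R g x) \<partial>(lebesgue_on \<Omega>))"
      by (subst integral_scaleR_right) auto
    finally show ?thesis by (simp add: mult.commute)
  qed
  then have "has_weak_grad \<Omega> (\<lambda>x. c * f x) (\<lambda>x. c *\<^sub>R g x)"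
    using g by (auto simp: has_weak_grad_def intro: L2_scaleR)
  moreover have "(\<lambda>x. c * f x) \<in> L2 (lebesgue_on \<Omega>)" using L2_scaleR[OF f, of c] by simp
  ultimately show ?thesis by (auto simp: H1_def)
qed

lemma H1_add:
  assumes \<Omega>: "open \<Omega>" "bounded \<Omega>" and f1: "f1 \<in> H1 \<Omega>" and f2: "f2 \<in> H1 \<Omega>"
  shows "(\<lambda>x. f1 x + f2 x) \<in> H1 \<Omega>"
proof -
  let ?M = "lebesgue_on \<Omega>"
  obtain g1 g2 where g: "has_weak_grad \<Omega> f1 g1" "has_weak_grad \<Omega> f2 g2"
    and f: "f1 \<in> L2 ?M" "f2 \<in> L2 ?M" using f1 f2 by (auto simp: H1_def)
  have gL: "g1 \<in> L2 ?M" "g2 \<in> L2 ?M" using g by (auto simp: has_weak_grad_def)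
  have "(\<integral>x. (f1 x + f2 x) *\<^sub>R classical_grad \<phi> x \<partial>?M) = - (\<integral>x. \<phi> x *\<^sub>R (g1 x + g2 x) \<partial>?M)"
    if \<phi>: "\<phi> \<in> test_functions \<Omega>" for \<phi>
  proof -
    note t = test_L2[OF \<Omega> \<phi>]
    show ?thesis
      using g \<phi> L2_integrable_scaleR[OF f(1) t(2)] L2_integrable_scaleR[OF f(2) t(2)]
        L2_integrable_scaleR[OF t(1) gL(1)] L2_integrable_scaleR[OF t(1) gL(2)]
      by (simp add: scaleR_left_distrib scaleR_right_distrib has_weak_grad_def)
  qed
  then have "has_weak_grad \<Omega> (\<lambda>x. f1 x + f2 x) (\<lambda>x. g1 x + g2 x)"
    using gL by (auto simp: has_weak_grad_def intro: L2_add)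
  then show ?thesis using f by (auto simp: H1_def intro: L2_add)
qed

lemma H1_zero: "(\<lambda>x. 0) \<in> H1 \<Omega>"
  by (auto simp: H1_def has_weak_grad_def L2_zero intro!: exI[of _ "\<lambda>x. 0"])

lemma H1_sum:
  assumes "open \<Omega>" "bounded \<Omega>" "\<And>i. i \<in> I \<Longrightarrow> f i \<in> H1 \<Omega>"
  shows "(\<lambda>x. \<Sum>i\<in>I. f i x) \<in> H1 \<Omega>"
  using assms(3) by (induction I rule: infinite_finite_induct) (auto intro: H1_add assms H1_zero)

lemma weak_jacobian_L2:
  assumes "u \<in> H1_vec \<Omega>" shows "weak_jacobian \<Omega> u \<in> L2 (lebesgue_on \<Omega>)"
proof (subst L2_vec, intro allI)
  fix i
  have "(\<lambda>x. u x $ i) \<in> H1 \<Omega>" using assms by (simp add: H1_vec_def)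
  from has_weak_grad_of_H1[OF this] show "(\<lambda>x. weak_jacobian \<Omega> u x $ i) \<in> L2 (lebesgue_on \<Omega>)"
    by (simp add: weak_jacobian_def has_weak_grad_def)
qed

lemma has_weak_div_of_gradients:
  assumes \<Omega>: "open \<Omega>" "bounded \<Omega>" and u: "\<And>i. (\<lambda>x. u x $ i) \<in> L2 (lebesgue_on \<Omega>)"
    and g: "\<And>i. has_weak_grad \<Omega> (\<lambda>x. u x $ i) (g i)"
  shows "has_weak_div \<Omega> u (\<lambda>x. \<Sum>i\<in>UNIV. g i x $ i)"
proof -
  let ?M = "lebesgue_on \<Omega>"
  have gL: "g i \<in> L2 ?M" for i using g by (auto simp: has_weak_grad_def)
  then have gLi: "(\<lambda>x. g i x $ i) \<in> L2 ?M" for i using L2_vec by blast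
  have "(\<integral>x. u x \<bullet> classical_grad \<phi> x \<partial>?M) = - (\<integral>x. (\<Sum>i\<in>UNIV. g i x $ i) * \<phi> x \<partial>?M)"
    if \<phi>: "\<phi> \<in> test_functions \<Omega>" for \<phi>
  proof -
    note t = test_L2[OF \<Omega> \<phi>]
    have ti: "(\<lambda>x. classical_grad \<phi> x $ i) \<in> L2 ?M" for i using t(2) L2_vec by blast
    have "(\<integral>x. u x \<bullet> classical_grad \<phi> x \<partial>?M) = (\<Sum>i\<in>UNIV. (\<integral>x. u x $ i * classical_grad \<phi> x $ i \<partial>?M))"
      unfolding inner_vec_def using L2_integrable_mult[OF u ti] by (simp add: integral_sum)
    also have "\<dots> = (\<Sum>i\<in>UNIV. - (\<integral>x. g i x $ i * \<phi> x \<partial>?M))"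
      using has_weak_grad_iff[OF \<Omega> u gL, THEN iffD1, OF g] \<phi> by (simp add: mult.commute)
    also have "\<dots> = - (\<integral>x. (\<Sum>i\<in>UNIV. g i x $ i) * \<phi> x \<partial>?M)"
      using L2_integrable_mult[OF gLi t(1)] by (simp add: sum_distrib_right sum_negf integral_sum)
    finally show ?thesis .
  qed
  then show ?thesis using gLi by (auto simp: has_weak_div_def intro: L2_sum)
qed

text \<open>The divergence and the Jacobian are chosen independently of each other; uniqueness of the weak
divergence ties them together almost everywhere.\<close>

lemma weak_div_eq_trace_jacobian:
  assumes \<Omega>: "open \<Omega>" "bounded \<Omega>" and u: "u \<in> H1_vec \<Omega>"
  shows "weak_div \<Omega> u \<in> L2 (lebesgue_on \<Omega>)"
    and "AE x in lebesgue_on \<Omega>. weak_div \<Omega> u x = (\<Sum>i\<in>UNIV. weak_jacobian \<Omega> u x $ i $ i)"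
proof -
  have "has_weak_div \<Omega> u (\<lambda>x. \<Sum>i\<in>UNIV. weak_grad \<Omega> (\<lambda>y. u y $ i) x $ i)"
    using u by (intro has_weak_div_of_gradients \<Omega>) (auto simp: H1_vec_def H1_def intro: has_weak_grad_of_H1)
  note d = this has_weak_div_weak_div[OF this]
  show "weak_div \<Omega> u \<in> L2 (lebesgue_on \<Omega>)" using d(2) by (simp add: has_weak_div_def)
  show "AE x in lebesgue_on \<Omega>. weak_div \<Omega> u x = (\<Sum>i\<in>UNIV. weak_jacobian \<Omega> u x $ i $ i)"
    using has_weak_div_unique[OF \<Omega> d(2,1)] by (simp add: weak_jacobian_def)
qed

lemma weak_div_le_H1_norm:
  fixes \<Omega> :: "(real ^ 'd) set"
  assumes \<Omega>: "open \<Omega>" "bounded \<Omega>" and u: "u \<in> H1_vec \<Omega>"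
  shows "L2_norm (lebesgue_on \<Omega>) (weak_div \<Omega> u) \<le> CARD('d) * H1_vec_norm \<Omega> u"
proof -
  have "L2_norm (lebesgue_on \<Omega>) (weak_div \<Omega> u) \<le> CARD('d) * L2_norm (lebesgue_on \<Omega>) (weak_jacobian \<Omega> u)"
  proof (rule L2_dominated(2)[OF weak_jacobian_L2[OF u]])
    show "weak_div \<Omega> u \<in> borel_measurable (lebesgue_on \<Omega>)"
      using weak_div_eq_trace_jacobian(1)[OF assms] by (rule L2_measurable)
    have tr: "\<bar>\<Sum>i\<in>UNIV. A $ i $ i\<bar> \<le> CARD('d) * norm A" for A :: "real ^ 'd ^ 'd"
    proof -
      have "\<bar>A $ i $ i\<bar> \<le> norm A" for i
        using Finite_Cartesian_Product.norm_nth_le[of "A $ i" i] Finite_Cartesian_Product.norm_nth_le[of A i] by simp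
      then have "(\<Sum>i\<in>UNIV. \<bar>A $ i $ i\<bar>) \<le> CARD('d) * norm A"
        using sum_bounded_above[of UNIV "\<lambda>i. \<bar>A $ i $ i\<bar>" "norm A"] by simp
      then show ?thesis using sum_abs[of "\<lambda>i. A $ i $ i" UNIV] by linarith
    qed
    show "AE x in lebesgue_on \<Omega>. norm (weak_div \<Omega> u x) \<le> CARD('d) * norm (weak_jacobian \<Omega> u x)"
      using weak_div_eq_trace_jacobian(2)[OF assms] by eventually_elim (simp add: tr)
  qed simp
  also have "L2_norm (lebesgue_on \<Omega>) (weak_jacobian \<Omega> u) \<le> H1_vec_norm \<Omega> u"
    unfolding H1_vec_norm_def by (rule real_le_rsqrt) simp
  finally show ?thesis by (simp add: mult_left_mono)
qed

text \<open>A test function on the smaller set, extended by zero, is one on the larger set.\<close>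

lemma has_weak_div_mono:
  assumes \<Omega>: "open \<Omega>'" "open \<Omega>" "\<Omega>' \<subseteq> \<Omega>" and w: "has_weak_div \<Omega> w g"
  shows "has_weak_div \<Omega>' w g"
proof -
  have s: "\<Omega> \<inter> space lebesgue \<in> sets lebesgue" "\<Omega>' \<inter> space lebesgue \<in> sets lebesgue" using \<Omega> by auto
  have r: "lebesgue_on \<Omega>' = restrict_space (lebesgue_on \<Omega>) \<Omega>'"
    using \<Omega> by (simp add: restrict_restrict_space Int_absorb1)
  have "integrable (lebesgue_on \<Omega>') (\<lambda>x. (norm (g x))\<^sup>2)"
  proof -
    have "integrable (lebesgue_on \<Omega>) (\<lambda>x. (norm (g x))\<^sup>2)"
      using w by (simp add: has_weak_div_def L2_def)
    then have "set_integrable lebesgue \<Omega> (\<lambda>x. (norm (g x))\<^sup>2)"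
      by (simp add: set_integrable_def integrable_restrict_space[OF s(1)])
    then have "set_integrable lebesgue \<Omega>' (\<lambda>x. (norm (g x))\<^sup>2)"
      by (rule set_integrable_subset) (use \<Omega> in auto)
    then show ?thesis
      by (simp add: set_integrable_def integrable_restrict_space[OF s(2)])
  qed
  then have L: "g \<in> L2 (lebesgue_on \<Omega>')"
    using w unfolding has_weak_div_def L2_def by (auto simp: r intro: measurable_restrict_space1)
  have "(\<integral>x. w x \<bullet> classical_grad \<phi> x \<partial>lebesgue_on \<Omega>') = - (\<integral>x. g x * \<phi> x \<partial>lebesgue_on \<Omega>')"
    if \<phi>: "\<phi> \<in> test_functions \<Omega>'" for \<phi>
  proof -
    obtain S where S: "compact S" "S \<subseteq> \<Omega>'" "\<forall>x\<in>- S. \<phi> x = 0" "\<forall>x\<in>- S. classical_grad \<phi> x = 0"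
      by (rule test_support[OF \<phi>]) blast
    have e: "indicator \<Omega>' x *\<^sub>R (w x \<bullet> classical_grad \<phi> x) = indicator \<Omega> x *\<^sub>R (w x \<bullet> classical_grad \<phi> x)"
      "indicator \<Omega>' x *\<^sub>R (g x * \<phi> x) = indicator \<Omega> x *\<^sub>R (g x * \<phi> x)" for x
      using S \<Omega>(3) by (cases "x \<in> S"; force simp: indicator_def)+
    have "\<phi> \<in> test_functions \<Omega>" using \<phi> \<Omega>(3) by (auto simp: test_functions_def)
    then show ?thesis using w
      unfolding has_weak_div_def integral_restrict_space[OF s(1)] integral_restrict_space[OF s(2)] e by blast
  qed
  then show ?thesis using L by (simp add: has_weak_div_def)
qed

lemma has_weak_div_cong_AE:
  assumes \<Omega>: "open \<Omega>" "bounded \<Omega>" and w: "has_weak_div \<Omega> w g"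
    and m: "w \<in> borel_measurable (lebesgue_on \<Omega>)" "w' \<in> borel_measurable (lebesgue_on \<Omega>)"
    and ae: "AE x in lebesgue_on \<Omega>. w x = w' x"
  shows "has_weak_div \<Omega> w' g"
proof -
  have "(\<integral>x. w' x \<bullet> classical_grad \<phi> x \<partial>lebesgue_on \<Omega>) = (\<integral>x. w x \<bullet> classical_grad \<phi> x \<partial>lebesgue_on \<Omega>)"
    if "\<phi> \<in> test_functions \<Omega>" for \<phi>
    using test_L2(2)[OF \<Omega> that, THEN L2_measurable] m ae
    by (intro integral_cong_AE borel_measurable_inner) auto
  then show ?thesis using w by (simp add: has_weak_div_def)
qed

section \<open>Weak gradients of piecewise smooth functions\<close>

text \<open>Restricted to the segment, the function lives on a real interval covered by finitely many closed
pieces, where Lipschitz bounds can be chained.\<close>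

lemma lipschitz_along_segments:
  fixes f :: "'a::euclidean_space \<Rightarrow> real"
  assumes fin: "finite \<T>" and cl: "\<And>T. T \<in> \<T> \<Longrightarrow> closed T"
    and lip: "\<And>T. T \<in> \<T> \<Longrightarrow> L-lipschitz_on T f"
    and seg: "closed_segment x y \<subseteq> \<Union>\<T>"
  shows "\<bar>f y - f x\<bar> \<le> L * dist x y"
proof -
  define p where "p s = x + s *\<^sub>R (y - x)" for s :: real
  have "x \<in> \<Union>\<T>" using seg by auto
  then have L: "0 \<le> L" using lip by (auto dest: lipschitz_on_nonneg)
  have p_seg: "p s \<in> closed_segment x y" if "s \<in> {0..1}" for s
    using that unfolding in_segment p_def by (intro exI[of _ s]) (auto simp: algebra_simps)
  have "(L * dist x y)-lipschitz_on {0..1} (f \<circ> p)"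
  proof (rule lipschitz_on_closed_Union)
    fix T assume T: "T \<in> \<T>"
    show "(L * dist x y)-lipschitz_on (p -` T) (f \<circ> p)"
    proof (rule lipschitz_onI)
      fix s t assume "s \<in> p -` T" "t \<in> p -` T"
      then have "dist (f (p s)) (f (p t)) \<le> L * dist (p s) (p t)"
        using lipschitz_onD[OF lip[OF T]] by simp
      also have "dist (p s) (p t) = dist x y * dist s t"
        by (simp add: p_def dist_norm scaleR_diff_left[symmetric] norm_minus_commute)
      finally show "dist ((f \<circ> p) s) ((f \<circ> p) t) \<le> L * dist x y * dist s t"
        by (simp add: mult.assoc)
    qed (use L in simp)
    show "closed (p -` T)"
      using cl[OF T] by (rule closed_vimage) (auto simp: p_def intro!: continuous_intros)
  next
    show "{0..1} \<subseteq> (\<Union>T\<in>\<T>. p -` T)" using p_seg seg by blast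
  qed (use fin L in auto)
  then have "dist ((f \<circ> p) 0) ((f \<circ> p) 1) \<le> L * dist x y * dist (0::real) 1"
    by (rule lipschitz_onD) auto
  then show ?thesis by (simp add: p_def dist_real_def abs_minus_commute)
qed

lemma difference_quotient_tendsto:
  fixes f :: "'a::euclidean_space \<Rightarrow> real"
  assumes f: "(f has_derivative (\<lambda>h. a \<bullet> h)) (at x)" and t: "t \<longlonglongrightarrow> 0" "\<And>n. t n \<noteq> (0::real)"
  shows "(\<lambda>n. (f (x + t n *\<^sub>R e) - f x) / t n) \<longlonglongrightarrow> a \<bullet> e"
proof -
  have "((\<lambda>s::real. x + s *\<^sub>R e) has_derivative (\<lambda>s. s *\<^sub>R e)) (at 0)"
    by (auto intro!: derivative_eq_intros)
  from has_derivative_compose[OF this, of f "\<lambda>h. a \<bullet> h"] f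
  have "((\<lambda>s. f (x + s *\<^sub>R e)) has_real_derivative a \<bullet> e) (at 0)"
    unfolding has_field_derivative_def by (simp add: mult_commute_abs)
  then have "((\<lambda>h. (f (x + h *\<^sub>R e) - f x) / h) \<longlongrightarrow> a \<bullet> e) (at 0)"
    by (simp add: DERIV_def)
  moreover have "filterlim t (at 0) sequentially" using t by (simp add: filterlim_at)
  ultimately show ?thesis by (rule filterlim_compose)
qed

lemma onorm_inner_le:
  fixes a :: "'a::euclidean_space"
  assumes "norm a \<le> B" shows "onorm (\<lambda>h. a \<bullet> h) \<le> B"
proof (rule onorm_bound)
  show "0 \<le> B" using assms norm_ge_zero[of a] by linarith
  show "norm (a \<bullet> h) \<le> B * norm h" for h
    using order_trans[OF Cauchy_Schwarz_ineq2 mult_right_mono[OF assms norm_ge_zero]] by simp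
qed

lemma lborel_integral_translate:
  fixes h :: "'a::euclidean_space \<Rightarrow> real"
  assumes "h \<in> borel_measurable borel"
  shows "(\<integral>x. h (c + x) \<partial>lborel) = (\<integral>x. h x \<partial>lborel)"
proof -
  have "(\<integral>x. h x \<partial>lborel) = (\<integral>x. h x \<partial>distr lborel borel ((+) c))" by (simp add: lborel_distr_plus)
  also have "\<dots> = (\<integral>x. h (c + x) \<partial>lborel)" using assms by (intro integral_distr) auto
  finally show ?thesis by simp
qed

lemma integral_lebesgue_on_eq_lborel:
  fixes h :: "'a::euclidean_space \<Rightarrow> real"
  assumes "open \<Omega>" "(\<lambda>x. indicator \<Omega> x * h x) \<in> borel_measurable borel"
  shows "(\<integral>x. h x \<partial>lebesgue_on \<Omega>) = (\<integral>x. indicator \<Omega> x * h x \<partial>lborel)"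
proof -
  have "(\<integral>x. h x \<partial>lebesgue_on \<Omega>) = (\<integral>x. indicator \<Omega> x * h x \<partial>lebesgue)"
    using assms(1) by (subst integral_restrict_space) auto
  also have "\<dots> = (\<integral>x. indicator \<Omega> x * h x \<partial>lborel)"
    using assms(2) by (intro integral_completion) auto
  finally show ?thesis .
qed

text \<open>Integration by parts without boundary terms. Shifting the variable of integration moves a
difference quotient from the test function to \<open>f\<close>. On the side of the test function dominated
convergence gives the classical gradient. On the side of \<open>f\<close> the quotients converge wherever \<open>f\<close> is
differentiable, and they are dominated because the support of the test function stays away from
the complement of \<open>\<Omega>\<close>, so that for small shifts the segments along which \<open>f\<close> is compared lie
inside \<open>\<Omega>\<close>.\<close>

lemma has_weak_grad_if_piecewise_lipschitz:
  fixes f :: "real ^ 'd \<Rightarrow> real"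
  assumes \<Omega>: "open \<Omega>" "bounded \<Omega>"
    and fin: "finite \<T>" and cl: "\<And>T. T \<in> \<T> \<Longrightarrow> closed T" and cover: "\<Omega> \<subseteq> \<Union>\<T>"
    and lip: "\<And>T. T \<in> \<T> \<Longrightarrow> L-lipschitz_on T f"
    and bdd: "\<And>x. x \<in> \<Omega> \<Longrightarrow> \<bar>f x\<bar> \<le> c"
    and g: "g \<in> L2 (lebesgue_on \<Omega>)"
    and der: "AE x in lebesgue_on \<Omega>. (f has_derivative (\<lambda>h. g x \<bullet> h)) (at x)"
  shows "f \<in> L2 (lebesgue_on \<Omega>)" "has_weak_grad \<Omega> f g"
proof -
  let ?M = "lebesgue_on \<Omega>"
  have cont: "continuous_on \<Omega> f"
  proof -
    have "continuous_on (\<Union>T\<in>\<T>. T) f"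
      by (rule continuous_on_closed_Union) (use fin cl lip in \<open>auto intro: lipschitz_on_continuous_on\<close>)
    then show ?thesis using cover by (auto intro: continuous_on_subset)
  qed
  show fL: "f \<in> L2 ?M"
    using \<Omega> cont bdd
    by (intro L2_bounded[of _ _ c] finite_measure_lebesgue_on_bounded_open continuous_imp_measurable_on_sets_lebesgue)
      (auto intro: AE_I2)
  \<comment> \<open>Extended by zero, the function can be translated on the whole space.\<close>
  define F where "F x = indicator \<Omega> x * f x" for x
  have F [measurable]: "F \<in> borel_measurable borel"
    using borel_measurable_continuous_on_indicator[OF _ cont] \<Omega> by (simp add: F_def[abs_def])
  have "\<bar>F x\<bar> \<le> \<bar>c\<bar>" for x using bdd[of x] by (auto simp: F_def indicator_def)
  note Fb = this
  have \<Omega>fin: "emeasure lborel \<Omega> < \<infinity>" using emeasure_bounded_finite[OF \<Omega>(2)] by simp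
  have Fi: "integrable lborel F"
  proof (rule Bochner_Integration.integrable_bound)
    show "integrable lborel (\<lambda>x. \<bar>c\<bar> * indicator \<Omega> x)"
      using \<Omega> \<Omega>fin by (intro integrable_mult_right integrable_real_indicator) auto
    show "AE x in lborel. norm (F x) \<le> norm (\<bar>c\<bar> * indicator \<Omega> x)"
      using bdd by (intro AE_I2) (force simp: F_def indicator_def)
  qed measurable
  have "(\<integral>x. f x * classical_grad \<phi> x $ j \<partial>?M) = - (\<integral>x. \<phi> x * g x $ j \<partial>?M)"
    if \<phi>: "\<phi> \<in> test_functions \<Omega>" for \<phi> j
  proof -
    let ?e = "axis j 1 :: real ^ 'd"
    obtain S where S: "compact S" "S \<subseteq> \<Omega>" "\<forall>x\<in>- S. \<phi> x = 0" "\<forall>x\<in>- S. classical_grad \<phi> x = 0"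
      by (rule test_support[OF \<phi>]) blast
    have cont_\<phi>: "continuous_on UNIV \<phi>" and cont_grad: "continuous_on UNIV (classical_grad \<phi>)"
      using test_continuous[OF \<phi>] test_grad_continuous[OF \<phi>] .
    have [measurable]: "\<phi> \<in> borel_measurable borel" "classical_grad \<phi> \<in> borel_measurable borel"
      using cont_\<phi> cont_grad by (auto intro: borel_measurable_continuous_onI)
    have [measurable]: "(\<lambda>x. classical_grad \<phi> x $ j) \<in> borel_measurable borel"
      by (rule borel_measurable_vec_nth_comp) measurable
    obtain A where A: "0 \<le> A" "\<And>x. norm (\<phi> x) \<le> A"
      by (rule bounded_if_compactly_supported[OF cont_\<phi> S(1,3)]) blast
    obtain B where B: "0 \<le> B" "\<And>x. norm (classical_grad \<phi> x) \<le> B"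
      by (rule bounded_if_compactly_supported[OF cont_grad S(1,4)]) blast
    obtain \<delta> where \<delta>: "0 < \<delta>" "(\<Union>x\<in>S. cball x \<delta>) \<subseteq> \<Omega>"
      by (rule compact_subset_open_imp_cball_epsilon_subset[OF S(1) \<Omega>(1) S(2)]) blast
    \<comment> \<open>Shifts of length at most \<open>\<delta>\<close> move no point of the support out of \<open>\<Omega>\<close>.\<close>
    define t where "t n = \<delta> / Suc n" for n
    have t: "0 < t n" "t n \<le> \<delta>" for n using \<delta> by (auto simp: t_def field_simps)
    have t0: "t \<longlonglongrightarrow> 0" using tendsto_mult[OF tendsto_const[of \<delta>] LIMSEQ_inverse_real_of_nat]
      by (simp add: t_def[abs_def] divide_inverse)
    have \<phi>i: "integrable lborel \<phi>"
    proof (rule Bochner_Integration.integrable_bound)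
      show "integrable lborel (\<lambda>x. A * indicator S x)"
        using S(1) emeasure_compact_finite[OF S(1)]
        by (intro integrable_mult_right integrable_real_indicator) (auto simp: borel_compact)
      show "AE x in lborel. norm (\<phi> x) \<le> norm (A * indicator S x)"
        using A S(3) by (intro AE_I2) (auto simp: indicator_def)
    qed measurable
    have shift: "(\<integral>x. F x * ((\<phi> (x + t n *\<^sub>R ?e) - \<phi> x) / t n) \<partial>lborel)
        = (\<integral>x. (F (x - t n *\<^sub>R ?e) - F x) / t n * \<phi> x \<partial>lborel)" for n
    proof -
      let ?v = "t n *\<^sub>R ?e"
      have bF: "\<bar>F x\<bar> * \<bar>\<phi> y\<bar> \<le> A * \<bar>F x\<bar>" for x y
        using mult_left_mono[OF A(2), of "\<bar>F x\<bar>" y] by (simp add: mult.commute)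
      have i1: "integrable lborel (\<lambda>x. F x * \<phi> (x + ?v))"
        by (rule Bochner_Integration.integrable_bound[OF integrable_mult_right[OF integrable_norm[OF Fi], of A]])
          (use A bF in \<open>auto simp: abs_mult\<close>)
      have i2: "integrable lborel (\<lambda>x. F (x - ?v) * \<phi> x)"
        by (rule Bochner_Integration.integrable_bound[OF integrable_mult_right[OF integrable_norm[OF \<phi>i], of "\<bar>c\<bar>"]])
          (use Fb in \<open>auto simp: abs_mult intro!: AE_I2 mult_right_mono\<close>)
      have i3: "integrable lborel (\<lambda>x. F x * \<phi> x)"
        by (rule Bochner_Integration.integrable_bound[OF integrable_mult_right[OF integrable_norm[OF Fi], of A]])
          (use A bF in \<open>auto simp: abs_mult\<close>)
      have "(\<integral>x. F x * \<phi> (x + ?v) \<partial>lborel) = (\<integral>x. F (x - ?v) * \<phi> x \<partial>lborel)"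
        using lborel_integral_translate[of "\<lambda>x. F (x - ?v) * \<phi> x" ?v] by (simp add: add.commute)
      then have "(\<integral>x. F x * \<phi> (x + ?v) - F x * \<phi> x \<partial>lborel) = (\<integral>x. F (x - ?v) * \<phi> x - F x * \<phi> x \<partial>lborel)"
        using i1 i2 i3 by simp
      then have "(\<integral>x. (F x * \<phi> (x + ?v) - F x * \<phi> x) / t n \<partial>lborel) = (\<integral>x. (F (x - ?v) * \<phi> x - F x * \<phi> x) / t n \<partial>lborel)"
        by simp
      then show ?thesis by (simp add: algebra_simps diff_divide_distrib)
    qed
    have lim1: "(\<lambda>n. \<integral>x. F x * ((\<phi> (x + t n *\<^sub>R ?e) - \<phi> x) / t n) \<partial>lborel)
        \<longlonglongrightarrow> (\<integral>x. F x * classical_grad \<phi> x $ j \<partial>lborel)"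
    proof (rule integral_dominated_convergence)
      show "integrable lborel (\<lambda>x. B * norm (F x))" using Fi by simp
      show "AE x in lborel. (\<lambda>n. F x * ((\<phi> (x + t n *\<^sub>R ?e) - \<phi> x) / t n)) \<longlonglongrightarrow> F x * classical_grad \<phi> x $ j"
      proof (intro AE_I2 tendsto_mult tendsto_const)
        fix x
        have "t n \<noteq> 0" for n using t(1)[of n] by simp
        from difference_quotient_tendsto[OF test_has_derivative[OF \<phi>] t0 this, of x ?e]
        show "(\<lambda>n. (\<phi> (x + t n *\<^sub>R ?e) - \<phi> x) / t n) \<longlonglongrightarrow> classical_grad \<phi> x $ j"
          by (simp add: inner_axis)
      qed
      show "AE x in lborel. norm (F x * ((\<phi> (x + t n *\<^sub>R ?e) - \<phi> x) / t n)) \<le> B * norm (F x)" for n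
      proof (rule AE_I2)
        fix x
        have "norm (\<phi> (x + t n *\<^sub>R ?e) - \<phi> x) \<le> B * norm ((x + t n *\<^sub>R ?e) - x)"
        proof (rule differentiable_bound[OF convex_UNIV])
          show "(\<phi> has_derivative (\<lambda>h. classical_grad \<phi> y \<bullet> h)) (at y within UNIV)" for y
            using test_has_derivative[OF \<phi>] by simp
          show "onorm (\<lambda>h. classical_grad \<phi> y \<bullet> h) \<le> B" for y
            using onorm_inner_le[OF B(2)] .
        qed auto
        then have "\<bar>(\<phi> (x + t n *\<^sub>R ?e) - \<phi> x) / t n\<bar> \<le> B" using t(1)[of n] by (simp add: field_simps)
        then show "norm (F x * ((\<phi> (x + t n *\<^sub>R ?e) - \<phi> x) / t n)) \<le> B * norm (F x)"
          unfolding real_norm_def abs_mult by (subst mult.commute) (rule mult_right_mono, simp_all)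
      qed
    qed measurable
    have lim2: "(\<lambda>n. \<integral>x. (F (x - t n *\<^sub>R ?e) - F x) / t n * \<phi> x \<partial>lborel)
        \<longlonglongrightarrow> (\<integral>x. - (\<phi> x * g x $ j) \<partial>?M)"
    proof -
      have "(\<integral>x. (F (x - t n *\<^sub>R ?e) - F x) / t n * \<phi> x \<partial>lborel) = (\<integral>x. (F (x - t n *\<^sub>R ?e) - F x) / t n * \<phi> x \<partial>?M)" for n
      proof -
        have eq: "indicator \<Omega> x * ((F (x - t n *\<^sub>R ?e) - F x) / t n * \<phi> x) = (F (x - t n *\<^sub>R ?e) - F x) / t n * \<phi> x" for x
          using S(2,3) by (cases "x \<in> \<Omega>") auto
        show ?thesis by (subst integral_lebesgue_on_eq_lborel[OF \<Omega>(1)]) (simp_all only: eq, measurable)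
      qed
      moreover have "(\<lambda>n. \<integral>x. (F (x - t n *\<^sub>R ?e) - F x) / t n * \<phi> x \<partial>?M) \<longlonglongrightarrow> (\<integral>x. - (\<phi> x * g x $ j) \<partial>?M)"
      proof (rule integral_dominated_convergence)
        have \<phi>L: "\<phi> \<in> L2 ?M" using test_L2(1)[OF \<Omega> \<phi>] .
        have \<phi>M: "\<phi> \<in> borel_measurable ?M" using \<phi>L by (rule L2_measurable)
        show "integrable ?M (\<lambda>x. L * norm (\<phi> x))"
          using L2_imp_integrable[OF finite_measure_lebesgue_on_bounded_open[OF \<Omega>] \<phi>L] by simp
        show "(\<lambda>x. - (\<phi> x * g x $ j)) \<in> borel_measurable ?M"
          using \<phi>M borel_measurable_vec_nth_comp[OF L2_measurable[OF g]] by auto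
        show "(\<lambda>x. (F (x - t n *\<^sub>R ?e) - F x) / t n * \<phi> x) \<in> borel_measurable ?M" for n
          by (intro measurable_restrict_space1 measurable_completion) measurable
        have near: "F (x - t n *\<^sub>R ?e) = f (x - t n *\<^sub>R ?e)" "closed_segment x (x - t n *\<^sub>R ?e) \<subseteq> \<Omega>" "F x = f x" if "x \<in> S" for x n
        proof -
          have "x - t n *\<^sub>R ?e \<in> cball x \<delta>" "x \<in> cball x \<delta>" using t[of n] \<delta> by (auto simp: dist_norm)
          then have "closed_segment x (x - t n *\<^sub>R ?e) \<subseteq> cball x \<delta>"
            by (intro closed_segment_subset) auto
          also have "\<dots> \<subseteq> \<Omega>" using \<delta> that by blast
          finally show 1: "closed_segment x (x - t n *\<^sub>R ?e) \<subseteq> \<Omega>" .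
          then show "F (x - t n *\<^sub>R ?e) = f (x - t n *\<^sub>R ?e)" "F x = f x"
            using ends_in_segment[of x "x - t n *\<^sub>R ?e"] by (auto simp: F_def)
        qed
        show "AE x in ?M. (\<lambda>n. (F (x - t n *\<^sub>R ?e) - F x) / t n * \<phi> x) \<longlonglongrightarrow> - (\<phi> x * g x $ j)"
          using der
        proof eventually_elim
          fix x assume d: "(f has_derivative (\<lambda>h. g x \<bullet> h)) (at x)"
          show "(\<lambda>n. (F (x - t n *\<^sub>R ?e) - F x) / t n * \<phi> x) \<longlonglongrightarrow> - (\<phi> x * g x $ j)"
          proof (cases "x \<in> S")
            case True
            have "t n \<noteq> 0" for n using t(1)[of n] by simp
            from difference_quotient_tendsto[OF d t0 this, of "- ?e"]
            have "(\<lambda>n. (f (x - t n *\<^sub>R ?e) - f x) / t n) \<longlonglongrightarrow> - (g x $ j)"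
              by (simp add: inner_axis)
            then have "(\<lambda>n. (f (x - t n *\<^sub>R ?e) - f x) / t n * \<phi> x) \<longlonglongrightarrow> - (g x $ j) * \<phi> x"
              by (intro tendsto_mult tendsto_const)
            then show ?thesis by (simp add: near[OF True] mult.commute)
          next
            case False
            then show ?thesis using S(3) by simp
          qed
        qed
        show "AE x in ?M. norm ((F (x - t n *\<^sub>R ?e) - F x) / t n * \<phi> x) \<le> L * norm (\<phi> x)" for n
        proof (rule AE_I2)
          fix x
          show "norm ((F (x - t n *\<^sub>R ?e) - F x) / t n * \<phi> x) \<le> L * norm (\<phi> x)"
          proof (cases "x \<in> S")
            case True
            have "closed_segment x (x - t n *\<^sub>R ?e) \<subseteq> \<Union>\<T>" using near(2)[OF True] cover by (rule order_trans)
            from lipschitz_along_segments[OF fin cl lip this]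
            have "\<bar>f (x - t n *\<^sub>R ?e) - f x\<bar> \<le> L * t n" using t(1)[of n] by (simp add: dist_norm)
            then have "\<bar>(f (x - t n *\<^sub>R ?e) - f x) / t n\<bar> \<le> L" using t(1)[of n] by (simp add: field_simps)
            then show ?thesis unfolding near[OF True] real_norm_def abs_mult by (rule mult_right_mono) simp
          next
            case False
            then show ?thesis using S(3) by simp
          qed
        qed
      qed
      ultimately show ?thesis by (simp only:)
    qed
    have "(\<integral>x. f x * classical_grad \<phi> x $ j \<partial>?M) = (\<integral>x. F x * classical_grad \<phi> x $ j \<partial>lborel)"
    proof -
      have eq: "indicator \<Omega> x * (f x * classical_grad \<phi> x $ j) = F x * classical_grad \<phi> x $ j" for x
        by (simp add: F_def)
      show ?thesis by (subst integral_lebesgue_on_eq_lborel[OF \<Omega>(1)]) (simp_all add: eq)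
    qed
    also have "\<dots> = (\<integral>x. - (\<phi> x * g x $ j) \<partial>?M)"
      using LIMSEQ_unique[OF lim1 lim2[folded shift]] .
    finally show ?thesis by simp
  qed
  then show "has_weak_grad \<Omega> f g" using has_weak_grad_iff[OF \<Omega> fL g] by blast
qed

text \<open>The gradient is part of the predicate because the weak gradient of a piecewise function is assembled
from the gradients of its pieces.\<close>

definition C1_with_gradient :: "('a::euclidean_space \<Rightarrow> real) \<Rightarrow> ('a \<Rightarrow> 'a) \<Rightarrow> bool" where
  "C1_with_gradient P G \<longleftrightarrow> continuous_on UNIV G \<and> (\<forall>x. (P has_derivative (\<lambda>h. G x \<bullet> h)) (at x))"

lemma C1_const: "C1_with_gradient (\<lambda>x. c) (\<lambda>x. 0)"
  by (simp add: C1_with_gradient_def)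

lemma C1_affine: "C1_with_gradient (\<lambda>x. a \<bullet> x + b) (\<lambda>x. a)"
  by (auto simp: C1_with_gradient_def intro!: derivative_eq_intros)

lemma C1_continuous: "C1_with_gradient P G \<Longrightarrow> continuous_on UNIV P"
  unfolding C1_with_gradient_def
  by (metis continuous_at_imp_continuous_on has_derivative_continuous)

lemma C1_mult:
  assumes P: "C1_with_gradient P G" and Q: "C1_with_gradient Q H"
  shows "C1_with_gradient (\<lambda>x. P x * Q x) (\<lambda>x. P x *\<^sub>R H x + Q x *\<^sub>R G x)"
proof -
  have "((\<lambda>x. P x * Q x) has_derivative (\<lambda>h. P x * (H x \<bullet> h) + (G x \<bullet> h) * Q x)) (at x)" for x
    using P Q unfolding C1_with_gradient_def by (intro has_derivative_mult) auto
  then have "((\<lambda>x. P x * Q x) has_derivative (\<lambda>h. (P x *\<^sub>R H x + Q x *\<^sub>R G x) \<bullet> h)) (at x)" for x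
    by (simp add: inner_add_left mult.commute)
  moreover have "continuous_on UNIV (\<lambda>x. P x *\<^sub>R H x + Q x *\<^sub>R G x)"
    using C1_continuous[OF P] C1_continuous[OF Q] P Q
    by (intro continuous_intros) (auto simp: C1_with_gradient_def)
  ultimately show ?thesis by (simp add: C1_with_gradient_def)
qed

lemma C1_prod:
  assumes "finite I" "\<And>i. i \<in> I \<Longrightarrow> \<exists>G. C1_with_gradient (P i) G"
  shows "\<exists>G. C1_with_gradient (\<lambda>x. \<Prod>i\<in>I. P i x) G"
  using assms
proof (induction I rule: finite_induct)
  case empty
  then show ?case using C1_const[of 1] by auto
next
  case (insert i I)
  obtain G where G: "C1_with_gradient (P i) G" using insert.prems[of i] by blast
  obtain H where "C1_with_gradient (\<lambda>x. \<Prod>i\<in>I. P i x) H" using insert.IH insert.prems by blast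
  from C1_mult[OF G this] insert.hyps show ?case by (simp, blast)
qed

text \<open>On a compact convex set the gradient is bounded, and the mean value inequality applies.\<close>

lemma C1_lipschitz_bounded:
  fixes P :: "'a::euclidean_space \<Rightarrow> real"
  assumes P: "C1_with_gradient P G" and T: "compact T" "convex T"
  shows "\<exists>B\<ge>0. B-lipschitz_on T P \<and> (\<forall>x\<in>T. \<bar>P x\<bar> \<le> B) \<and> (\<forall>x\<in>T. norm (G x) \<le> B)"
proof -
  have "bounded (P ` T)" "bounded (G ` T)"
    using T(1) P C1_continuous[OF P]
    by (auto intro!: compact_imp_bounded compact_continuous_image intro: continuous_on_subset simp: C1_with_gradient_def)
  then obtain b c where bc: "0 < b" "\<forall>x\<in>T. \<bar>P x\<bar> \<le> b" "0 < c" "\<forall>x\<in>T. norm (G x) \<le> c"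
    unfolding bounded_pos by auto
  have "c-lipschitz_on T P"
  proof (rule lipschitz_onI)
    fix x y assume xy: "x \<in> T" "y \<in> T"
    have "norm (P x - P y) \<le> c * norm (x - y)"
    proof (rule differentiable_bound[OF T(2)])
      show "(P has_derivative (\<lambda>h. G z \<bullet> h)) (at z within T)" for z
        using P unfolding C1_with_gradient_def by (blast intro: has_derivative_at_withinI)
      show "onorm (\<lambda>h. G z \<bullet> h) \<le> c" if "z \<in> T" for z
        using bc that by (intro onorm_inner_le) blast
    qed (use xy in auto)
    then show "dist (P x) (P y) \<le> c * dist x y" by (simp add: dist_norm)
  qed (use bc in simp)
  then have "(max b c)-lipschitz_on T P" by (rule lipschitz_on_le) simp
  then show ?thesis using bc by (intro exI[of _ "max b c"]) (auto simp: le_max_iff_disj)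
qed

text \<open>The pieces are closed and \<open>f\<close> agrees with each \<open>P T\<close> on all of \<open>T\<close>, which encodes continuity across the
interfaces. Boundaries of convex sets are null, so almost every point lies in the interior of
exactly one piece, where the sum reduces to the gradient belonging to that piece.\<close>

lemma has_weak_grad_if_piecewise_C1:
  fixes f :: "real ^ 'd \<Rightarrow> real"
  assumes \<Omega>: "open \<Omega>" "bounded \<Omega>"
    and fin: "finite \<T>" and T: "\<And>T. T \<in> \<T> \<Longrightarrow> compact T" "\<And>T. T \<in> \<T> \<Longrightarrow> convex T"
    and cover: "\<Omega> \<subseteq> \<Union>\<T>"
    and disj: "\<And>S T. S \<in> \<T> \<Longrightarrow> T \<in> \<T> \<Longrightarrow> S \<noteq> T \<Longrightarrow> interior S \<inter> interior T = {}"
    and P: "\<And>T. T \<in> \<T> \<Longrightarrow> C1_with_gradient (P T) (G T)"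
    and f: "\<And>T x. T \<in> \<T> \<Longrightarrow> x \<in> T \<Longrightarrow> f x = P T x"
  shows "f \<in> L2 (lebesgue_on \<Omega>)"
    and "has_weak_grad \<Omega> f (\<lambda>x. \<Sum>T\<in>\<T>. indicator (interior T) x *\<^sub>R G T x)"
proof -
  let ?g = "\<lambda>x. \<Sum>T\<in>\<T>. indicator (interior T) x *\<^sub>R G T x"
  let ?M = "lebesgue_on \<Omega>"
  have "\<forall>T\<in>\<T>. \<exists>B. 0 \<le> B \<and> B-lipschitz_on T (P T) \<and>
      (\<forall>x\<in>T. \<bar>P T x\<bar> \<le> B) \<and> (\<forall>x\<in>T. norm (G T x) \<le> B)"
  proof
    fix S assume S: "S \<in> \<T>"
    show "\<exists>B. 0 \<le> B \<and> B-lipschitz_on S (P S) \<and> (\<forall>x\<in>S. \<bar>P S x\<bar> \<le> B) \<and> (\<forall>x\<in>S. norm (G S x) \<le> B)"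
      by (rule C1_lipschitz_bounded[OF P[OF S] T(1)[OF S] T(2)[OF S]])
  qed
  from bchoice[OF this] obtain B where B: "\<And>T. T \<in> \<T> \<Longrightarrow> 0 \<le> B T \<and> (B T)-lipschitz_on T (P T) \<and>
      (\<forall>x\<in>T. \<bar>P T x\<bar> \<le> B T) \<and> (\<forall>x\<in>T. norm (G T x) \<le> B T)"
    by blast
  define L where "L = (\<Sum>T\<in>\<T>. B T)"
  have BL: "B T \<le> L" if "T \<in> \<T>" for T
    unfolding L_def using fin that B by (intro member_le_sum) auto
  have gL: "?g \<in> L2 ?M"
  proof (rule L2_sum)
    fix T assume T: "T \<in> \<T>"
    show "(\<lambda>x. indicator (interior T) x *\<^sub>R G T x) \<in> L2 ?M"
    proof (rule L2_bounded[OF finite_measure_lebesgue_on_bounded_open[OF \<Omega>]])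
      have "G T \<in> borel_measurable borel"
        using P[OF T] by (auto simp: C1_with_gradient_def intro: borel_measurable_continuous_onI)
      then show "(\<lambda>x. indicator (interior T) x *\<^sub>R G T x) \<in> borel_measurable ?M"
        by (intro measurable_restrict_space1 measurable_completion) auto
      show "AE x in ?M. norm (indicator (interior T) x *\<^sub>R G T x) \<le> B T"
        using B[OF T] interior_subset[of T] by (intro AE_I2) (auto simp: indicator_def)
    qed
  qed
  have lip: "L-lipschitz_on T f" if "T \<in> \<T>" for T
  proof -
    have "L-lipschitz_on T (P T)" using B[OF that] BL[OF that] lipschitz_on_le by blast
    then show ?thesis by (rule lipschitz_on_transform) (use f that in auto)
  qed
  have bdd: "\<bar>f x\<bar> \<le> L" if x: "x \<in> \<Omega>" for x
  proof -
    obtain T where T: "T \<in> \<T>" "x \<in> T" using cover x by blast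
    then have "\<bar>f x\<bar> \<le> B T" using B[OF T(1)] f[OF T] by auto
    then show ?thesis using BL[OF T(1)] by linarith
  qed
  have der: "AE x in ?M. (f has_derivative (\<lambda>h. ?g x \<bullet> h)) (at x)"
  proof -
    have "(\<Union>T\<in>\<T>. frontier T) \<in> null_sets lebesgue"
      using negligible_Union[of "frontier ` \<T>"] fin T(2) negligible_convex_frontier
      by (auto simp: negligible_iff_null_sets[symmetric])
    then have "AE x in lebesgue. x \<notin> (\<Union>T\<in>\<T>. frontier T)" by (rule AE_not_in)
    then have "AE x in lebesgue. x \<in> \<Omega> \<longrightarrow> (f has_derivative (\<lambda>h. ?g x \<bullet> h)) (at x)"
    proof eventually_elim
      fix x assume nf: "x \<notin> (\<Union>T\<in>\<T>. frontier T)"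
      show "x \<in> \<Omega> \<longrightarrow> (f has_derivative (\<lambda>h. ?g x \<bullet> h)) (at x)"
      proof
        assume "x \<in> \<Omega>"
        then obtain S where S: "S \<in> \<T>" "x \<in> S" using cover by blast
        then have xS: "x \<in> interior S"
          using nf closure_subset[of S] by (auto simp: frontier_def)
        have "?g x = (\<Sum>T\<in>\<T>. if T = S then G S x else 0)"
          by (rule sum.cong) (use disj[OF S(1)] xS in \<open>auto simp: indicator_def\<close>)
        then have gx: "?g x = G S x" using fin S(1) by simp
        have "(P S has_derivative (\<lambda>h. G S x \<bullet> h)) (at x)" using P[OF S(1)] by (simp add: C1_with_gradient_def)
        then show "(f has_derivative (\<lambda>h. ?g x \<bullet> h)) (at x)" unfolding gx
          by (rule has_derivative_transform_within_open[OF _ open_interior xS])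
            (use f[OF S(1)] interior_subset[of S] in auto)
      qed
    qed
    then show ?thesis using AE_lebesgue_on_open_iff[OF \<Omega>(1)] by blast
  qed
  have cl: "closed T" if "T \<in> \<T>" for T using T(1)[OF that] by (rule compact_imp_closed)
  show "f \<in> L2 ?M" "has_weak_grad \<Omega> f ?g"
    using has_weak_grad_if_piecewise_lipschitz[OF \<Omega> fin cl cover lip bdd gL der] by blast+
qed

section \<open>Barycentric coordinates and faces of a simplex\<close>

text \<open>A simplex of full dimension has as many vertices as an affine basis, which makes barycentric coordinates global.\<close>

lemma simplex_vertices:
  fixes T :: "(real ^ 'd) set"
  assumes "int CARD('d) simplex T"
  shows "\<not> affine_dependent (vertices T)" "finite (vertices T)" "T = convex hull (vertices T)"
    "affine hull (vertices T) = UNIV"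
proof -
  obtain C where C: "\<not> affine_dependent C" "int (card C) = CARD('d) + 1" "T = convex hull C"
    using assms by (auto simp: simplex_def)
  have "vertices T = C"
    using extreme_point_of_convex_hull_affine_independent[OF C(1)] C(3) by (auto simp: vertices_def)
  then show "\<not> affine_dependent (vertices T)" "T = convex hull (vertices T)" using C by auto
  show "finite (vertices T)" using C(1) \<open>vertices T = C\<close> aff_independent_finite by blast
  have "aff_dim C = DIM(real ^ 'd)" using C by (simp add: aff_dim_affine_independent)
  then show "affine hull (vertices T) = UNIV" using aff_dim_eq_full \<open>vertices T = C\<close> by blast
qed

text \<open>The affine hull of the vertices is the whole space, so the coordinates exist at every point, also outside the simplex.\<close>

lemma barycentric_coordinates:
  fixes T :: "(real ^ 'd) set"
  assumes T: "int CARD('d) simplex T"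
  shows "(\<Sum>w\<in>vertices T. barycentric T w x) = 1" "(\<Sum>w\<in>vertices T. barycentric T w x *\<^sub>R w) = x"
proof -
  have "x \<in> affine hull (vertices T)" using simplex_vertices(4)[OF T] by simp
  then have "\<exists>c. (\<Sum>w\<in>vertices T. c w) = 1 \<and> (\<Sum>w\<in>vertices T. c w *\<^sub>R w) = x"
    unfolding affine_hull_finite[OF simplex_vertices(2)[OF T]] by blast
  from someI_ex[OF this]
  show "(\<Sum>w\<in>vertices T. barycentric T w x) = 1" "(\<Sum>w\<in>vertices T. barycentric T w x *\<^sub>R w) = x"
    unfolding barycentric_def by blast+
qed

lemma barycentric_unique:
  fixes T :: "(real ^ 'd) set"
  assumes T: "int CARD('d) simplex T"
    and c: "(\<Sum>w\<in>vertices T. c w) = 1" "(\<Sum>w\<in>vertices T. c w *\<^sub>R w) = x" and v: "v \<in> vertices T"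
  shows "barycentric T v x = c v"
proof (rule ccontr)
  assume ne: "barycentric T v x \<noteq> c v"
  let ?U = "\<lambda>w. barycentric T w x - c w"
  have "sum ?U (vertices T) = 0" "(\<Sum>w\<in>vertices T. ?U w *\<^sub>R w) = 0"
    using barycentric_coordinates[OF T, of x] c by (simp_all add: sum_subtractf scaleR_diff_left)
  then have "affine_dependent (vertices T)"
    unfolding affine_dependent_explicit_finite[OF simplex_vertices(2)[OF T]] using v ne by (intro exI[of _ ?U]) auto
  then show False using simplex_vertices(1)[OF T] by simp
qed

text \<open>Affine combinations of coordinate vectors are coordinate vectors of the affine combination; uniqueness does the rest.\<close>

lemma barycentric_affine_combination:
  fixes T :: "(real ^ 'd) set"
  assumes T: "int CARD('d) simplex T" and v: "v \<in> vertices T"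
  shows "barycentric T v (a *\<^sub>R x + b *\<^sub>R y + (1 - a - b) *\<^sub>R z) =
    a * barycentric T v x + b * barycentric T v y + (1 - a - b) * barycentric T v z"
  by (rule barycentric_unique[OF T _ _ v])
    (simp_all add: sum.distrib sum_distrib_left[symmetric] barycentric_coordinates[OF T] scaleR_add_left
      scaleR_scaleR[symmetric] scaleR_sum_right[symmetric] del: scaleR_scaleR)

text \<open>Subtracting the value at the origin leaves a linear functional, by choosing suitable affine
combinations of two points and the origin.\<close>

lemma barycentric_C1:
  fixes T :: "(real ^ 'd) set"
  assumes T: "int CARD('d) simplex T" and v: "v \<in> vertices T"
  shows "\<exists>G. C1_with_gradient (barycentric T v) G"
proof -
  let ?b = "barycentric T v"
  let ?l = "\<lambda>h. ?b h - ?b 0"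
  have lin: "linear ?l"
  proof (rule linearI)
    show "?l (x + y) = ?l x + ?l y" for x y
      using barycentric_affine_combination[OF T v, of 1 x 1 y 0] by simp
    show "?l (c *\<^sub>R x) = c *\<^sub>R ?l x" for c x
      using barycentric_affine_combination[OF T v, of c x 0 0 0] by (simp add: algebra_simps)
  qed
  define a where "a = adjoint ?l 1"
  have a: "?l h = a \<bullet> h" for h
    using adjoint_works[OF lin, of h 1] by (simp add: a_def inner_commute)
  have "?b = (\<lambda>x. a \<bullet> x + ?b 0)"
  proof
    show "?b x = a \<bullet> x + ?b 0" for x using a[of x] by linarith
  qed
  from arg_cong[OF this, of "\<lambda>P. C1_with_gradient P (\<lambda>x. a)"] C1_affine[of a "?b 0"]
  have "C1_with_gradient ?b (\<lambda>x. a)" by (rule iffD2)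
  then show ?thesis by (rule exI[of _ "\<lambda>x. a"])
qed

text \<open>Coordinates with respect to a subset of the vertices, extended by zero, are coordinates; hence the
values on a face depend on the face only, and the coordinates of the remaining vertices vanish
there.\<close>

lemma barycentric_on_face:
  fixes T :: "(real ^ 'd) set"
  assumes T: "int CARD('d) simplex T" and c: "c \<subseteq> vertices T"
    and u: "sum u c = 1" "(\<Sum>w\<in>c. u w *\<^sub>R w) = x" and v: "v \<in> vertices T"
  shows "barycentric T v x = (if v \<in> c then u v else 0)"
proof (rule barycentric_unique[OF T _ _ v])
  note fin = simplex_vertices(2)[OF T]
  have e: "vertices T \<inter> {x. x \<in> c} = c" using c by auto
  show "(\<Sum>w\<in>vertices T. if w \<in> c then u w else 0) = 1" using fin u e by (simp add: sum.If_cases)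
  show "(\<Sum>w\<in>vertices T. (if w \<in> c then u w else 0) *\<^sub>R w) = x"
    using fin u e by (simp add: if_distrib[of "\<lambda>a. a *\<^sub>R _"] sum.If_cases cong: if_cong)
qed

lemma simplex_face_vertices:
  fixes T :: "(real ^ 'd) set"
  assumes T: "int CARD('d) simplex T" and F: "F face_of T"
  shows "vertices F \<subseteq> vertices T" "F = convex hull (vertices F)" "finite (vertices F)"
proof -
  note C = simplex_vertices[OF T]
  obtain c where c: "c \<subseteq> vertices T" "F = convex hull c"
    using F face_of_convex_hull_affine_independent[OF C(1)] C(3) by auto
  have "\<not> affine_dependent c" using C(1) c(1) affine_independent_subset by blast
  then have "vertices F = c"
    using extreme_point_of_convex_hull_affine_independent c(2) by (auto simp: vertices_def)
  then show "vertices F \<subseteq> vertices T" "F = convex hull (vertices F)" using c by auto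
  then show "finite (vertices F)" using C(2) finite_subset by blast
qed

lemma face_coordinates:
  fixes T :: "(real ^ 'd) set"
  assumes T: "int CARD('d) simplex T" and F: "F face_of T" and x: "x \<in> F"
  obtains u where "sum u (vertices F) = 1" "(\<Sum>w\<in>vertices F. u w *\<^sub>R w) = x"
proof -
  note f = simplex_face_vertices[OF T F]
  show ?thesis
    using x that by (subst (asm) f(2), subst (asm) convex_hull_finite[OF f(3)]) blast
qed

section \<open>The discrete displacements have weak gradients\<close>

lemma mesh_simplex: "simplicial_mesh \<Omega> \<T> \<Longrightarrow> T \<in> \<T> \<Longrightarrow> int CARD('d) simplex (T :: (real ^ 'd) set)"
  by (simp add: simplicial_mesh_def)

lemma mesh_Int_face_of: "simplicial_mesh \<Omega> \<T> \<Longrightarrow> S \<in> \<T> \<Longrightarrow> T \<in> \<T> \<Longrightarrow> S \<inter> T face_of S"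
  by (auto simp: simplicial_mesh_def triangulation_def)

text \<open>All simplices of the mesh have the same dimension, whereas a proper face has a smaller one.\<close>

lemma mesh_Int_proper:
  fixes T :: "(real ^ 'd) set"
  assumes m: "simplicial_mesh \<Omega> \<T>" and ST: "S \<in> \<T>" "T \<in> \<T>" "S \<noteq> T"
  shows "S \<inter> T \<noteq> S"
proof
  assume "S \<inter> T = S"
  moreover have "T \<inter> S face_of T" by (rule mesh_Int_face_of[OF m ST(2,1)])
  ultimately have "S face_of T" by (simp add: Int_commute)
  then have "aff_dim S < aff_dim T"
    using face_of_aff_dim_lt[OF convex_simplex[OF mesh_simplex[OF m ST(2)]]] ST(3) by blast
  then show False
    using aff_dim_simplex[OF mesh_simplex[OF m ST(1)]] aff_dim_simplex[OF mesh_simplex[OF m ST(2)]] by simp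
qed

text \<open>The intersection is a proper face, so its dimension is at most that of the facet it contains; a face
inside another one of the same dimension equals it.\<close>

lemma facet_eq_Int:
  fixes T :: "(real ^ 'd) set"
  assumes m: "simplicial_mesh \<Omega> \<T>" and ST: "S \<in> \<T>" "T \<in> \<T>" "S \<noteq> T"
    and e: "e facet_of S" "e \<subseteq> S \<inter> T"
  shows "e = S \<inter> T"
proof (rule ccontr)
  assume ne: "e \<noteq> S \<inter> T"
  note cS = convex_simplex[OF mesh_simplex[OF m ST(1)]]
  have F: "S \<inter> T face_of S" by (rule mesh_Int_face_of[OF m ST(1,2)])
  have "e face_of S \<inter> T" by (rule face_of_subset[of e S]) (use e in \<open>simp_all add: facet_of_def\<close>)
  then have "aff_dim e < aff_dim (S \<inter> T)"
    by (rule face_of_aff_dim_lt[OF face_of_imp_convex[OF F] _ ne])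
  moreover have "aff_dim (S \<inter> T) < aff_dim S"
    using face_of_aff_dim_lt[OF cS F mesh_Int_proper[OF m ST]] .
  ultimately show False using e by (simp add: facet_of_def)
qed

text \<open>Continuity of the bubble across the mesh. The definition evaluates it in an arbitrarily chosen
simplex \<open>S\<close> that contains both \<open>x\<close> and the face. If \<open>e\<close> is a facet of both \<open>S\<close> and \<open>T\<close>, then \<open>x\<close> lies on \<open>e\<close>, where
the two sets of coordinates agree. If \<open>e\<close> is not a facet of \<open>T\<close>, the common face of \<open>S\<close> and \<open>T\<close> misses
some vertex of \<open>e\<close>, and the corresponding factor vanishes at \<open>x\<close>.\<close>

lemma face_bubble_on_simplex:
  fixes T :: "(real ^ 'd) set"
  assumes m: "simplicial_mesh \<Omega> \<T>" and T: "T \<in> \<T>" and x: "x \<in> T"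
  shows "face_bubble \<T> e x = (if e facet_of T then \<Prod>v\<in>vertices e. barycentric T v x else 0)"
proof (cases "\<exists>T\<in>\<T>. e facet_of T \<and> x \<in> T")
  case False
  then show ?thesis using T x by (auto simp: face_bubble_def)
next
  case True
  define S where "S = (SOME T. T \<in> \<T> \<and> e facet_of T \<and> x \<in> T)"
  have "S \<in> \<T> \<and> e facet_of S \<and> x \<in> S" unfolding S_def by (rule someI_ex) (use True in blast)
  then have S: "S \<in> \<T>" "e facet_of S" "x \<in> S" by auto
  have b: "face_bubble \<T> e x = (\<Prod>v\<in>vertices e. barycentric S v x)"
    using True by (simp add: face_bubble_def S_def)
  note sS = mesh_simplex[OF m S(1)] and sT = mesh_simplex[OF m T]
  have eS: "e face_of S" using S(2) by (simp add: facet_of_def)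
  note vS = simplex_face_vertices[OF sS eS]
  show ?thesis
  proof (cases "S = T")
    case True
    then show ?thesis using b S by simp
  next
    case ne: False
    have F: "S \<inter> T face_of S" using mesh_Int_face_of[OF m S(1) T] .
    show ?thesis
    proof (cases "e facet_of T")
      case eT: True
      have eT': "e face_of T" using eT by (simp add: facet_of_def)
      have "e \<subseteq> S \<inter> T" using eS eT' face_of_imp_subset by blast
      then have "e = S \<inter> T" using facet_eq_Int[OF m S(1) T ne S(2)] by blast
      then have "x \<in> e" using S x by simp
      obtain u where u: "sum u (vertices e) = 1" "(\<Sum>w\<in>vertices e. u w *\<^sub>R w) = x"
        using face_coordinates[OF sS eS \<open>x \<in> e\<close>] .
      note vT = simplex_face_vertices(1)[OF sT eT']
      have "barycentric S v x = barycentric T v x" if v: "v \<in> vertices e" for v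
        using barycentric_on_face[OF sS vS(1) u subsetD[OF vS(1) v]]
          barycentric_on_face[OF sT vT u subsetD[OF vT v]] by simp
      then show ?thesis using b eT by simp
    next
      case eT: False
      have "\<not> vertices e \<subseteq> vertices (S \<inter> T)"
      proof
        assume "vertices e \<subseteq> vertices (S \<inter> T)"
        then have "e \<subseteq> S \<inter> T"
          using hull_mono[of "vertices e" "vertices (S \<inter> T)" convex] vS(2) simplex_face_vertices(2)[OF sS F] by simp
        then have eq: "e = S \<inter> T" using facet_eq_Int[OF m S(1) T ne S(2)] by blast
        then have "e face_of T" using mesh_Int_face_of[OF m T S(1)] by (simp add: Int_commute)
        moreover have "aff_dim S = aff_dim T" using aff_dim_simplex[OF sS] aff_dim_simplex[OF sT] by simp
        ultimately have "e facet_of T" using S(2) by (simp add: facet_of_def)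
        then show False using eT by simp
      qed
      then obtain v where v: "v \<in> vertices e" "v \<notin> vertices (S \<inter> T)" by blast
      have "x \<in> S \<inter> T" using S x by simp
      obtain u where u: "sum u (vertices (S \<inter> T)) = 1" "(\<Sum>w\<in>vertices (S \<inter> T). u w *\<^sub>R w) = x"
        using face_coordinates[OF sS F \<open>x \<in> S \<inter> T\<close>] .
      have "barycentric S v x = 0"
        using barycentric_on_face[OF sS simplex_face_vertices(1)[OF sS F] u, of v] v vS(1) by auto
      then have "face_bubble \<T> e x = 0" unfolding b using v(1) vS(3) by (intro prod_zero) auto
      then show ?thesis using eT by simp
    qed
  qed
qed

lemma simplicial_mesh_properties:
  fixes \<Omega> :: "(real ^ 'd) set"
  assumes m: "simplicial_mesh \<Omega> \<T>"
  shows "finite \<T>" "\<And>T. T \<in> \<T> \<Longrightarrow> compact T" "\<And>T. T \<in> \<T> \<Longrightarrow> convex T" "\<Omega> \<subseteq> \<Union>\<T>"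
    "\<And>S T. S \<in> \<T> \<Longrightarrow> T \<in> \<T> \<Longrightarrow> S \<noteq> T \<Longrightarrow> interior S \<inter> interior T = {}"
proof -
  show "finite \<T>" "\<Omega> \<subseteq> \<Union>\<T>"
    using m closure_subset[of \<Omega>] by (auto simp: simplicial_mesh_def triangulation_def)
  show "compact T" "convex T" if "T \<in> \<T>" for T
    using mesh_simplex[OF m that] compact_simplex convex_simplex by blast+
  show "interior S \<inter> interior T = {}" if ST: "S \<in> \<T>" "T \<in> \<T>" "S \<noteq> T" for S T
    using face_of_disjoint_interior[OF mesh_Int_face_of[OF m ST(1,2)] mesh_Int_proper[OF m ST]]
      interior_subset[of S] interior_subset[of T] by blast
qed

lemma face_bubble_H1:
  fixes \<Omega> :: "(real ^ 'd) set"
  assumes \<Omega>: "open \<Omega>" "bounded \<Omega>" and m: "simplicial_mesh \<Omega> \<T>"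
  shows "face_bubble \<T> e \<in> H1 \<Omega>"
proof -
  let ?P = "\<lambda>T x. if e facet_of T then \<Prod>v\<in>vertices e. barycentric T v x else 0"
  have "\<exists>G. C1_with_gradient (?P T) G" if "T \<in> \<T>" for T
  proof (cases "e facet_of T")
    case True
    note s = mesh_simplex[OF m that]
    have "e face_of T" using True by (simp add: facet_of_def)
    note f = simplex_face_vertices[OF s this]
    show ?thesis using True C1_prod[OF f(3), of "barycentric T"] barycentric_C1[OF s] f(1) by auto
  next
    case False
    then show ?thesis using C1_const[of 0] by auto
  qed
  then obtain G where G: "\<And>T. T \<in> \<T> \<Longrightarrow> C1_with_gradient (?P T) (G T)" by metis
  have "face_bubble \<T> e \<in> L2 (lebesgue_on \<Omega>) \<and>
    has_weak_grad \<Omega> (face_bubble \<T> e) (\<lambda>x. \<Sum>T\<in>\<T>. indicator (interior T) x *\<^sub>R G T x)"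
  proof (intro conjI has_weak_grad_if_piecewise_C1[OF \<Omega> simplicial_mesh_properties(1)[OF m] _ _ simplicial_mesh_properties(4)[OF m], where P = "?P" and G = G])
  qed (fact simplicial_mesh_properties(2,3,5)[OF m] G face_bubble_on_simplex[OF m])+
  then show ?thesis by (auto simp: H1_def)
qed

lemma space_Vh_subset_H1_vec:
  fixes \<Omega> :: "(real ^ 'd) set"
  assumes \<Omega>: "open \<Omega>" "bounded \<Omega>" and m: "simplicial_mesh \<Omega> \<T>"
  shows "space_Vh \<Omega> \<Gamma>t \<Gamma>c \<T> n \<subseteq> H1_vec \<Omega>"
proof
  fix u assume "u \<in> space_Vh \<Omega> \<Gamma>t \<Gamma>c \<T> n"
  then obtain v c where v: "v \<in> space_Vh1 \<Omega> \<Gamma>c \<T>"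
    and u: "u = (\<lambda>x. v x + (\<Sum>e\<in>faces_ot \<Omega> \<Gamma>t \<T>. c e *\<^sub>R (face_bubble \<T> e x *\<^sub>R n e)))"
    by (auto simp: space_Vh_def space_Vb_def)
  have "(\<lambda>x. u x $ i) \<in> H1 \<Omega>" for i
  proof -
    have "(\<lambda>x. v x $ i) \<in> H1 \<Omega>" using v by (auto simp: space_Vh1_def space_V_def H1_vec_def)
    moreover have "(\<lambda>x. \<Sum>e\<in>faces_ot \<Omega> \<Gamma>t \<T>. (c e * n e $ i) * face_bubble \<T> e x) \<in> H1 \<Omega>"
      by (intro H1_sum H1_scaleR face_bubble_H1 \<Omega> m)
    ultimately have "(\<lambda>x. v x $ i + (\<Sum>e\<in>faces_ot \<Omega> \<Gamma>t \<T>. (c e * n e $ i) * face_bubble \<T> e x)) \<in> H1 \<Omega>"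
      by (intro H1_add \<Omega>)
    then show ?thesis by (simp add: u mult_ac)
  qed
  then show "u \<in> H1_vec \<Omega>" by (simp add: H1_vec_def)
qed

section \<open>The divergence maps Raviart-Thomas fields to piecewise constants\<close>

text \<open>The field is affine, so the single piece \<open>T\<close> serves as a mesh of its own interior. The indicator is what
the piecewise gradient formula produces; on the interior of \<open>T\<close> it equals \<open>1\<close>.\<close>

lemma has_weak_div_raviart_thomas:
  fixes T :: "(real ^ 'd) set"
    and \<eta> :: real
  assumes T: "compact T" "convex T"
  shows "has_weak_div (interior T) (\<lambda>x. a + \<eta> *\<^sub>R x) (\<lambda>x. CARD('d) * \<eta> * indicator (interior T) x)"
proof -
  let ?O = "interior T"
  have O: "open ?O" "bounded ?O" using T bounded_subset[OF compact_imp_bounded interior_subset] by auto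
  have s: "C1_with_gradient (\<lambda>x. (a + \<eta> *\<^sub>R x) $ i) (\<lambda>x. \<eta> *\<^sub>R axis i 1)" for i
  proof -
    have eq: "(\<eta> *\<^sub>R axis i 1) \<bullet> x + a $ i = (a + \<eta> *\<^sub>R x) $ i" for x :: "real ^ 'd"
      by (simp add: inner_commute[of "axis i 1"] inner_axis)
    show ?thesis using C1_affine[of "\<eta> *\<^sub>R axis i 1 :: real ^ 'd" "a $ i"] unfolding eq .
  qed
  let ?g = "\<lambda>i x. \<Sum>S\<in>{T}. indicator (interior S) x *\<^sub>R (\<eta> *\<^sub>R axis i 1) :: real ^ 'd"
  have cover: "?O \<subseteq> \<Union>{T}" using interior_subset by simp
  have p: "(\<lambda>x. (a + \<eta> *\<^sub>R x) $ i) \<in> L2 (lebesgue_on ?O)" for i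
    by (rule has_weak_grad_if_piecewise_C1(1)[OF O _ _ _ cover,
          of "\<lambda>_ x. (a + \<eta> *\<^sub>R x) $ i" "\<lambda>_ x. \<eta> *\<^sub>R axis i 1"]) (use T s in auto)
  have g: "has_weak_grad ?O (\<lambda>x. (a + \<eta> *\<^sub>R x) $ i) (?g i)" for i
    by (rule has_weak_grad_if_piecewise_C1(2)[OF O _ _ _ cover,
          of "\<lambda>_ x. (a + \<eta> *\<^sub>R x) $ i" "\<lambda>_ x. \<eta> *\<^sub>R axis i 1"]) (use T s in auto)
  have "has_weak_div ?O (\<lambda>x. a + \<eta> *\<^sub>R x) (\<lambda>x. \<Sum>i\<in>UNIV. ?g i x $ i)"
    by (rule has_weak_div_of_gradients[OF O p g])
  then show ?thesis by (simp add: mult_ac)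
qed

text \<open>The weak divergence on \<open>\<Omega>\<close> restricts to one on the interior of each simplex, where it is unique and
equals the divergence of an affine field. The boundary of the simplex is a null set.\<close>

lemma weak_div_space_Wh:
  fixes \<Omega> :: "(real ^ 'd) set"
  assumes \<Omega>: "open \<Omega>" "bounded \<Omega>" and m: "simplicial_mesh \<Omega> \<T>" and w: "w \<in> space_Wh \<Omega> \<Gamma>c \<T>"
  shows "w \<in> L2 (lebesgue_on \<Omega>)" "weak_div \<Omega> w \<in> space_Qh \<Omega> \<T>"
proof -
  obtain g where wL: "w \<in> L2 (lebesgue_on \<Omega>)" and g: "has_weak_div \<Omega> w g"
    using w by (auto simp: space_Wh_def space_W_def Hdiv_def)
  show "w \<in> L2 (lebesgue_on \<Omega>)" by fact
  have d: "has_weak_div \<Omega> w (weak_div \<Omega> w)" using g by (rule has_weak_div_weak_div)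
  have "\<exists>c. AE x in lebesgue_on T. weak_div \<Omega> w x = c" if T: "T \<in> \<T>" for T
  proof -
    note cT = simplicial_mesh_properties(2,3)[OF m T]
    let ?O = "interior T"
    have O: "open ?O" "bounded ?O" using cT bounded_subset[OF compact_imp_bounded interior_subset] by auto
    have sub: "?O \<subseteq> \<Omega>" using m T by (auto simp: simplicial_mesh_def)
    have Ts: "T \<inter> space lebesgue \<in> sets lebesgue" using cT by (simp add: lmeasurable_compact fmeasurableD)
    obtain a \<eta> where "AE x in lebesgue_on T. w x = a + \<eta> *\<^sub>R x" using w T by (auto simp: space_Wh_def)
    then have "AE x in lebesgue. x \<in> T \<longrightarrow> w x = a + \<eta> *\<^sub>R x" using Ts by (simp add: AE_restrict_space_iff)
    then have ae: "AE x in lebesgue_on ?O. w x = a + \<eta> *\<^sub>R x"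
      unfolding AE_lebesgue_on_open_iff[OF O(1)] by eventually_elim (use interior_subset in auto)
    have "lebesgue_on ?O = restrict_space (lebesgue_on \<Omega>) ?O"
      using \<Omega> O sub by (simp add: restrict_restrict_space Int_absorb1)
    then have wm: "w \<in> borel_measurable (lebesgue_on ?O)" using wL by (auto intro: measurable_restrict_space1 L2_measurable)
    have "has_weak_div ?O w (weak_div \<Omega> w)" using has_weak_div_mono[OF O(1) \<Omega>(1) sub d] .
    then have "has_weak_div ?O (\<lambda>x. a + \<eta> *\<^sub>R x) (weak_div \<Omega> w)"
      by (rule has_weak_div_cong_AE[OF O _ wm _ ae])
        (intro continuous_lebesgue_on_measurable O continuous_intros)
    from has_weak_div_unique[OF O this has_weak_div_raviart_thomas[OF cT]]
    have "AE x in lebesgue. x \<in> ?O \<longrightarrow> weak_div \<Omega> w x = CARD('d) * \<eta>"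
      unfolding AE_lebesgue_on_open_iff[OF O(1)] by eventually_elim auto
    moreover have "AE x in lebesgue. x \<notin> frontier T"
      by (rule AE_not_in) (use negligible_convex_frontier[OF cT(2)] in \<open>simp add: negligible_iff_null_sets\<close>)
    ultimately have "AE x in lebesgue. x \<in> T \<longrightarrow> weak_div \<Omega> w x = CARD('d) * \<eta>"
      by eventually_elim (use closure_subset[of T] in \<open>auto simp: frontier_def\<close>)
    then show ?thesis using Ts by (auto simp: AE_restrict_space_iff)
  qed
  then show "weak_div \<Omega> w \<in> space_Qh \<Omega> \<T>" using d by (simp add: space_Qh_def has_weak_div_def)
qed

section \<open>Bounds for the permeability and the elasticity form\<close>

text \<open>The quadratic form of the inverse is positive, hence bounded below on the compact unit sphere, and
homogeneous of degree two.\<close>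

lemma spd_matrix_inv_bounds:
  fixes K :: "real ^ 'd ^ 'd"
  assumes pos: "\<And>\<xi>. \<xi> \<noteq> 0 \<Longrightarrow> \<xi> \<bullet> (K *v \<xi>) > 0"
  obtains k C where "0 < k" "0 < C" "\<And>\<xi>. k * (norm \<xi>)\<^sup>2 \<le> (matrix_inv K *v \<xi>) \<bullet> \<xi>"
    "\<And>\<xi>. norm (matrix_inv K *v \<xi>) \<le> C * norm \<xi>"
proof -
  have "K *v x = 0 \<Longrightarrow> x = 0" for x using pos[of x] by (cases "x = 0") auto
  then have "invertible K"
    unfolding invertible_left_inverse matrix_left_invertible_ker by blast
  then have "K ** matrix_inv K = mat 1 \<and> matrix_inv K ** K = mat 1"
    unfolding invertible_def matrix_inv_def by (rule someI_ex)
  then have KK: "K *v (matrix_inv K *v x) = x" for x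
    by (simp add: matrix_vector_mul_assoc)
  have ipos: "(matrix_inv K *v x) \<bullet> x > 0" if "x \<noteq> 0" for x
  proof -
    have "matrix_inv K *v x \<noteq> 0" using KK[of x] that by auto
    from pos[OF this] show ?thesis by (simp add: KK)
  qed
  have bl: "bounded_linear (\<lambda>x. matrix_inv K *v x)" by (rule matrix_vector_mul_bounded_linear)
  have "continuous_on (sphere 0 1) (\<lambda>x. (matrix_inv K *v x) \<bullet> x)"
    by (intro continuous_on_inner continuous_on_id linear_continuous_on bl)
  moreover have "sphere (0 :: real ^ 'd) 1 \<noteq> {}" by simp
  ultimately obtain z where z: "z \<in> sphere 0 1"
      "\<forall>y\<in>sphere 0 1. (matrix_inv K *v z) \<bullet> z \<le> (matrix_inv K *v y) \<bullet> y"
    using continuous_attains_inf[OF compact_sphere] by blast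
  let ?k = "(matrix_inv K *v z) \<bullet> z"
  have "z \<noteq> 0" using z(1) by auto
  then have k: "0 < ?k" by (rule ipos)
  have coer: "?k * (norm x)\<^sup>2 \<le> (matrix_inv K *v x) \<bullet> x" for x
  proof (cases "x = 0")
    case False
    define y where "y = x /\<^sub>R norm x"
    have y: "y \<in> sphere 0 1" "x = norm x *\<^sub>R y" using False by (simp_all add: y_def)
    have "matrix_inv K *v x = norm x *\<^sub>R (matrix_inv K *v y)"
      using y(2) by (metis matrix_vector_mult_scaleR)
    then have "(matrix_inv K *v x) \<bullet> x = (norm x)\<^sup>2 * ((matrix_inv K *v y) \<bullet> y)"
      using y(2) by (metis inner_scaleR_left inner_scaleR_right mult.assoc power2_eq_square)
    moreover have "?k \<le> (matrix_inv K *v y) \<bullet> y" using z(2) y(1) by (rule bspec)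
    ultimately show ?thesis by (simp add: mult.commute[of "(norm x)\<^sup>2"] mult_right_mono)
  qed simp
  obtain C where "0 < C" "\<And>x. norm (matrix_inv K *v x) \<le> norm x * C"
    using bounded_linear.pos_bounded[OF bl] by blast
  then show ?thesis using that[OF k _ coer] by (simp add: mult.commute)
qed

lemma norm_transpose: "norm (transpose A) = norm (A :: real ^ 'd ^ 'd)"
proof -
  have "transpose A \<bullet> transpose A = A \<bullet> A"
    unfolding inner_vec_def by (simp add: transpose_def) (rule sum.swap)
  then show ?thesis by (simp add: norm_eq_sqrt_inner)
qed

text \<open>Transposition preserves the Frobenius norm, so symmetrising the Jacobian does not increase it.\<close>

lemma strain_L2:
  fixes \<Omega> :: "(real ^ 'd) set"
  assumes u: "u \<in> H1_vec \<Omega>"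
  shows "strain \<Omega> u \<in> L2 (lebesgue_on \<Omega>)" "L2_norm (lebesgue_on \<Omega>) (strain \<Omega> u) \<le> H1_vec_norm \<Omega> u"
proof -
  note J = weak_jacobian_L2[OF u]
  have T: "(\<lambda>x. transpose (weak_jacobian \<Omega> u x)) \<in> L2 (lebesgue_on \<Omega>)"
  proof -
    have "(\<lambda>x. transpose (weak_jacobian \<Omega> u x) $ i $ j) \<in> L2 (lebesgue_on \<Omega>)" for i j
    proof -
      have "(\<lambda>x. weak_jacobian \<Omega> u x $ j) \<in> L2 (lebesgue_on \<Omega>)" using J by (simp only: L2_vec[of "weak_jacobian \<Omega> u"])
      then have "(\<lambda>x. weak_jacobian \<Omega> u x $ j $ i) \<in> L2 (lebesgue_on \<Omega>)"
        by (simp only: L2_vec[of "\<lambda>x. weak_jacobian \<Omega> u x $ j"])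
      then show ?thesis by (simp add: transpose_def)
    qed
    then show ?thesis by (subst L2_vec, subst L2_vec) simp
  qed
  have S: "strain \<Omega> u = (\<lambda>x. (1/2) *\<^sub>R (weak_jacobian \<Omega> u x + transpose (weak_jacobian \<Omega> u x)))"
    by (simp add: strain_def fun_eq_iff)
  show L: "strain \<Omega> u \<in> L2 (lebesgue_on \<Omega>)" unfolding S by (intro L2_scaleR L2_add J T)
  have "norm (strain \<Omega> u x) \<le> 1 * norm (weak_jacobian \<Omega> u x)" for x
    using norm_triangle_ineq[of "weak_jacobian \<Omega> u x" "transpose (weak_jacobian \<Omega> u x)"]
    by (simp add: strain_def norm_transpose)
  then have "L2_norm (lebesgue_on \<Omega>) (strain \<Omega> u) \<le> 1 * L2_norm (lebesgue_on \<Omega>) (weak_jacobian \<Omega> u)"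
    by (intro L2_dominated(2)[OF J L2_measurable[OF L]] AE_I2) auto
  also have "\<dots> \<le> H1_vec_norm \<Omega> u" unfolding H1_vec_norm_def by simp
  finally show "L2_norm (lebesgue_on \<Omega>) (strain \<Omega> u) \<le> H1_vec_norm \<Omega> u" .
qed

lemma H1_vec_norm_nonneg: "0 \<le> H1_vec_norm \<Omega> u"
  by (simp add: H1_vec_norm_def)

lemma elasticity_form_bound:
  fixes \<Omega> :: "(real ^ 'd) set"
  assumes \<Omega>: "open \<Omega>" "bounded \<Omega>" and u: "u \<in> H1_vec \<Omega>" and v: "v \<in> H1_vec \<Omega>"
    and par: "0 \<le> \<mu>" "0 \<le> lam"
  shows "\<bar>elasticity_form \<Omega> \<mu> lam u v\<bar> \<le> (2 * \<mu> + lam * (real CARD('d))\<^sup>2) * (H1_vec_norm \<Omega> u * H1_vec_norm \<Omega> v)"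
proof -
  let ?M = "lebesgue_on \<Omega>"
  have "\<bar>L2_inner ?M (strain \<Omega> u) (strain \<Omega> v)\<bar> \<le> H1_vec_norm \<Omega> u * H1_vec_norm \<Omega> v"
    using L2_Cauchy_Schwarz[OF strain_L2(1)[OF u] strain_L2(1)[OF v]]
      mult_mono[OF strain_L2(2)[OF u] strain_L2(2)[OF v] H1_vec_norm_nonneg L2_norm_nonneg] by linarith
  then have 1: "\<bar>2 * \<mu> * L2_inner ?M (strain \<Omega> u) (strain \<Omega> v)\<bar> \<le> 2 * \<mu> * (H1_vec_norm \<Omega> u * H1_vec_norm \<Omega> v)"
    using par by (simp add: abs_mult mult_left_mono)
  have "\<bar>L2_inner ?M (weak_div \<Omega> u) (weak_div \<Omega> v)\<bar> \<le> (CARD('d) * H1_vec_norm \<Omega> u) * (CARD('d) * H1_vec_norm \<Omega> v)"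
    using L2_Cauchy_Schwarz[OF weak_div_eq_trace_jacobian(1)[OF \<Omega> u] weak_div_eq_trace_jacobian(1)[OF \<Omega> v]]
      mult_mono[OF weak_div_le_H1_norm[OF \<Omega> u] weak_div_le_H1_norm[OF \<Omega> v] _ L2_norm_nonneg] H1_vec_norm_nonneg[of \<Omega> u]
    by simp
  then have 2: "\<bar>lam * L2_inner ?M (weak_div \<Omega> u) (weak_div \<Omega> v)\<bar> \<le> lam * ((CARD('d) * H1_vec_norm \<Omega> u) * (CARD('d) * H1_vec_norm \<Omega> v))"
    using par by (simp add: abs_mult mult_left_mono)
  have "\<bar>elasticity_form \<Omega> \<mu> lam u v\<bar> \<le> 2 * \<mu> * (H1_vec_norm \<Omega> u * H1_vec_norm \<Omega> v)
      + lam * ((CARD('d) * H1_vec_norm \<Omega> u) * (CARD('d) * H1_vec_norm \<Omega> v))"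
    unfolding elasticity_form_def using 1 2 by linarith
  also have "\<dots> = (2 * \<mu> + lam * (real CARD('d))\<^sup>2) * (H1_vec_norm \<Omega> u * H1_vec_norm \<Omega> v)"
    by (simp add: algebra_simps power2_eq_square)
  finally show ?thesis .
qed

section \<open>Continuity and the inf-sup condition\<close>

lemma tau_norm_power2:
  assumes "0 < \<tau>"
  shows "(tau_norm \<Omega> \<tau> (u, w, p))\<^sup>2 = (H1_vec_norm \<Omega> u)\<^sup>2 + \<tau> * (L2_norm (lebesgue_on \<Omega>) w)\<^sup>2 +
    (\<tau> * L2_norm (lebesgue_on \<Omega>) (weak_div \<Omega> w))\<^sup>2 + (L2_norm (lebesgue_on \<Omega>) p)\<^sup>2"
  using assms unfolding tau_norm_def by (simp add: power_mult_distrib)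

lemma tau_norm_nonneg: "0 < \<tau> \<Longrightarrow> 0 \<le> tau_norm \<Omega> \<tau> U"
  unfolding tau_norm_def by (auto split: prod.split)

lemma tau_norm_components:
  assumes "0 < \<tau>"
  shows "H1_vec_norm \<Omega> u \<le> tau_norm \<Omega> \<tau> (u, w, p)"
    and "sqrt \<tau> * L2_norm (lebesgue_on \<Omega>) w \<le> tau_norm \<Omega> \<tau> (u, w, p)"
    and "\<tau> * L2_norm (lebesgue_on \<Omega>) (weak_div \<Omega> w) \<le> tau_norm \<Omega> \<tau> (u, w, p)"
    and "L2_norm (lebesgue_on \<Omega>) p \<le> tau_norm \<Omega> \<tau> (u, w, p)"
  using assms
  by (rule_tac power2_le_imp_le[OF _ tau_norm_nonneg[OF assms]]; simp add: tau_norm_power2 power_mult_distrib)+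

lemma L2_inner_scaleR_left: "L2_inner M (\<lambda>x. c *\<^sub>R f x) g = c * L2_inner M f g"
  by (simp add: L2_inner_def)

lemma L2_inner_combination_right:
  fixes f :: "'a \<Rightarrow> real"
  assumes "f \<in> L2 M" "p \<in> L2 M" "q \<in> L2 M"
  shows "L2_inner M f (\<lambda>x. - p x - c * q x) = - L2_inner M f p - c * L2_inner M f q"
proof -
  have "L2_inner M f (\<lambda>x. - p x - c * q x) = (\<integral>x. - (f x * p x) - c * (f x * q x) \<partial>M)"
    unfolding L2_inner_def by (simp add: algebra_simps)
  also have "\<dots> = - L2_inner M f p - c * L2_inner M f q"
    using L2_integrable_mult[OF assms(1,2)] L2_integrable_mult[OF assms(1,3)] by (simp add: L2_inner_def)
  finally show ?thesis .
qed

lemma borel_measurable_matrix_vector_mult: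
  fixes A :: "real ^ 'n ^ 'm"
  assumes "w \<in> borel_measurable M"
  shows "(\<lambda>x. A *v (s *\<^sub>R w x)) \<in> borel_measurable M"
proof (rule borel_measurable_continuous_on[OF _ assms])
  show "continuous_on UNIV (\<lambda>y. A *v (s *\<^sub>R y))"
    by (intro linear_continuous_on bounded_linear_compose[OF matrix_vector_mul_bounded_linear bounded_linear_scaleR_right])
qed

text \<open>Each factor in Cauchy-Schwarz is dominated by the norm of its triple; in the permeability term the
weight \<open>\<tau>\<close> is shared as \<open>sqrt \<tau>\<close> between the two velocities.\<close>

lemma biot_form_bound:
  fixes \<Omega> :: "(real ^ 'd) set" and \<mu> lam M \<alpha> \<mu>f \<tau> C :: real
  assumes \<Omega>: "open \<Omega>" "bounded \<Omega>"
    and par: "0 \<le> \<mu>" "0 \<le> lam" "0 < M" "0 < \<alpha>" "0 < \<mu>f" "0 < \<tau>"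
    and K: "0 < C" "\<And>\<xi>. norm (matrix_inv K *v \<xi>) \<le> C * norm \<xi>"
    and U: "u \<in> H1_vec \<Omega>" "w \<in> L2 (lebesgue_on \<Omega>)" "weak_div \<Omega> w \<in> L2 (lebesgue_on \<Omega>)" "p \<in> L2 (lebesgue_on \<Omega>)"
    and Y: "v \<in> H1_vec \<Omega>" "r \<in> L2 (lebesgue_on \<Omega>)" "weak_div \<Omega> r \<in> L2 (lebesgue_on \<Omega>)" "q \<in> L2 (lebesgue_on \<Omega>)"
  shows "\<bar>biot_form \<Omega> \<mu> lam M \<alpha> \<mu>f K \<tau> (u, w, p) (v, r, q)\<bar> \<le>
    ((2 * \<mu> + lam * (real CARD('d))\<^sup>2) + 2 * \<alpha> * CARD('d) + C * \<mu>f + 2 + 1 / M)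
      * tau_norm \<Omega> \<tau> (u, w, p) * tau_norm \<Omega> \<tau> (v, r, q)"
proof -
  let ?L = "lebesgue_on \<Omega>" and ?N = "tau_norm \<Omega> \<tau> (u, w, p)" and ?N' = "tau_norm \<Omega> \<tau> (v, r, q)"
  let ?d = "real CARD('d)"
  note nu = tau_norm_components[OF par(6), where \<Omega> = \<Omega> and u = u and w = w and p = p]
  note ny = tau_norm_components[OF par(6), where \<Omega> = \<Omega> and u = v and w = r and p = q]
  have N0: "0 \<le> ?N" "0 \<le> ?N'" using tau_norm_nonneg[OF par(6)] by blast+
  have prod: "\<bar>x\<bar> \<le> c * (?N * ?N')" if "\<bar>x\<bar> \<le> c * (a * b)" "a \<le> ?N" "b \<le> ?N'" "0 \<le> b" "0 \<le> c" for x a b c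
    using that(1) mult_left_mono[OF mult_mono[OF that(2,3) N0(1) that(4)] that(5)] by linarith
  note CS = L2_Cauchy_Schwarz and nn = L2_norm_nonneg
  note dv = weak_div_eq_trace_jacobian(1)[OF \<Omega> Y(1)] and du = weak_div_eq_trace_jacobian(1)[OF \<Omega> U(1)]
  have 1: "\<bar>elasticity_form \<Omega> \<mu> lam u v\<bar> \<le> (2 * \<mu> + lam * ?d\<^sup>2) * (?N * ?N')"
    by (rule prod[OF elasticity_form_bound[OF \<Omega> U(1) Y(1) par(1,2)] nu(1) ny(1) H1_vec_norm_nonneg])
      (use par in simp)
  have 2: "\<bar>L2_inner ?L (\<lambda>x. \<alpha> * p x) (weak_div \<Omega> v)\<bar> \<le> (\<alpha> * ?d) * (?N * ?N')"
  proof (rule prod[OF _ nu(4) ny(1) H1_vec_norm_nonneg])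
    have "\<bar>L2_inner ?L p (weak_div \<Omega> v)\<bar> \<le> L2_norm ?L p * (?d * H1_vec_norm \<Omega> v)"
      using CS[OF U(4) dv] mult_left_mono[OF weak_div_le_H1_norm[OF \<Omega> Y(1)] nn[of ?L p]] by linarith
    from mult_left_mono[OF this, of \<alpha>]
    show "\<bar>L2_inner ?L (\<lambda>x. \<alpha> * p x) (weak_div \<Omega> v)\<bar> \<le> \<alpha> * ?d * (L2_norm ?L p * H1_vec_norm \<Omega> v)"
      using par L2_inner_scaleR_left[of ?L \<alpha> p "weak_div \<Omega> v"] by (simp add: abs_mult mult_ac)
  qed (use par in simp)
  have 3: "\<bar>\<tau> * L2_inner ?L (\<lambda>x. matrix_inv K *v (\<mu>f *\<^sub>R w x)) r\<bar> \<le> (C * \<mu>f) * (?N * ?N')"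
  proof (rule prod[OF _ nu(2) ny(2)])
    let ?k = "\<lambda>x. matrix_inv K *v (\<mu>f *\<^sub>R w x)"
    have km: "?k \<in> borel_measurable ?L"
      using L2_measurable[OF U(2)] by (rule borel_measurable_matrix_vector_mult)
    have kb: "norm (?k x) \<le> (C * \<mu>f) * norm (w x)" for x
      using K(2)[of "\<mu>f *\<^sub>R w x"] par by (simp add: mult.assoc)
    have k: "?k \<in> L2 ?L" "L2_norm ?L ?k \<le> (C * \<mu>f) * L2_norm ?L w"
      by (rule L2_dominated[OF U(2) km]; use kb K par in auto)+
    have "\<bar>L2_inner ?L ?k r\<bar> \<le> (C * \<mu>f) * L2_norm ?L w * L2_norm ?L r"
      using CS[OF k(1) Y(2)] mult_right_mono[OF k(2) nn[of ?L r]] by linarith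
    from mult_left_mono[OF this, of \<tau>]
    have "\<bar>\<tau> * L2_inner ?L ?k r\<bar> \<le> \<tau> * ((C * \<mu>f) * L2_norm ?L w * L2_norm ?L r)"
      using par by (simp add: abs_mult)
    also have "\<dots> = (sqrt \<tau> * sqrt \<tau>) * ((C * \<mu>f) * L2_norm ?L w * L2_norm ?L r)" using par by simp
    also have "\<dots> = C * \<mu>f * (sqrt \<tau> * L2_norm ?L w * (sqrt \<tau> * L2_norm ?L r))" by (simp only: mult_ac)
    finally show "\<bar>\<tau> * L2_inner ?L ?k r\<bar> \<le> C * \<mu>f * (sqrt \<tau> * L2_norm ?L w * (sqrt \<tau> * L2_norm ?L r))" .
  qed (use par K nn in \<open>auto intro!: mult_nonneg_nonneg\<close>)
  have 4: "\<bar>\<tau> * L2_inner ?L p (weak_div \<Omega> r)\<bar> \<le> 1 * (?N * ?N')"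
  proof (rule prod[OF _ nu(4) ny(3)])
    show "\<bar>\<tau> * L2_inner ?L p (weak_div \<Omega> r)\<bar> \<le> 1 * (L2_norm ?L p * (\<tau> * L2_norm ?L (weak_div \<Omega> r)))"
      using mult_left_mono[OF CS[OF U(4) Y(3)], of \<tau>] par by (simp add: abs_mult mult_ac)
  qed (use par nn in \<open>auto intro!: mult_nonneg_nonneg\<close>)
  have 5: "\<bar>L2_inner ?L (\<lambda>x. 1 / M * p x) q\<bar> \<le> (1 / M) * (?N * ?N')"
  proof (rule prod[OF _ nu(4) ny(4)])
    show "\<bar>L2_inner ?L (\<lambda>x. 1 / M * p x) q\<bar> \<le> (1 / M) * (L2_norm ?L p * L2_norm ?L q)"
      using mult_left_mono[OF CS[OF U(4) Y(4)], of "1 / M"] par L2_inner_scaleR_left[of ?L "1 / M" p q] by (simp add: abs_mult)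
  qed (use par nn in \<open>auto intro!: mult_nonneg_nonneg\<close>)
  have 6: "\<bar>L2_inner ?L (\<lambda>x. \<alpha> * weak_div \<Omega> u x) q\<bar> \<le> (\<alpha> * ?d) * (?N * ?N')"
  proof (rule prod[OF _ nu(1) ny(4)])
    have "\<bar>L2_inner ?L (weak_div \<Omega> u) q\<bar> \<le> (?d * H1_vec_norm \<Omega> u) * L2_norm ?L q"
      using CS[OF du Y(4)] mult_right_mono[OF weak_div_le_H1_norm[OF \<Omega> U(1)] nn[of ?L q]] by linarith
    from mult_left_mono[OF this, of \<alpha>]
    show "\<bar>L2_inner ?L (\<lambda>x. \<alpha> * weak_div \<Omega> u x) q\<bar> \<le> \<alpha> * ?d * (H1_vec_norm \<Omega> u * L2_norm ?L q)"
      using par L2_inner_scaleR_left[of ?L \<alpha> "weak_div \<Omega> u" q] by (simp add: abs_mult mult_ac)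
  qed (use par nn in \<open>auto intro!: mult_nonneg_nonneg\<close>)
  have 7: "\<bar>\<tau> * L2_inner ?L (weak_div \<Omega> w) q\<bar> \<le> 1 * (?N * ?N')"
  proof (rule prod[OF _ nu(3) ny(4)])
    show "\<bar>\<tau> * L2_inner ?L (weak_div \<Omega> w) q\<bar> \<le> 1 * (\<tau> * L2_norm ?L (weak_div \<Omega> w) * L2_norm ?L q)"
      using mult_left_mono[OF CS[OF U(3) Y(4)], of \<tau>] par by (simp add: abs_mult mult_ac)
  qed (use par nn in \<open>auto intro!: mult_nonneg_nonneg\<close>)
  note bounds = 1 2 3 4 5 6 7
  have "\<bar>biot_form \<Omega> \<mu> lam M \<alpha> \<mu>f K \<tau> (u, w, p) (v, r, q)\<bar> \<le> (2 * \<mu> + lam * ?d\<^sup>2) * (?N * ?N')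
      + (\<alpha> * ?d) * (?N * ?N') + (C * \<mu>f) * (?N * ?N') + 1 * (?N * ?N') + (1 / M) * (?N * ?N')
      + (\<alpha> * ?d) * (?N * ?N') + 1 * (?N * ?N')"
    unfolding biot_form_def prod.case
  proof (rule abs_leI)
  qed (use bounds[THEN abs_le_D1] bounds[THEN abs_le_D2] in linarith)+
  also have "\<dots> = ((2 * \<mu> + lam * ?d\<^sup>2) + 2 * \<alpha> * ?d + C * \<mu>f + 2 + 1 / M) * ?N * ?N'"
    by (simp add: algebra_simps)
  finally show ?thesis .
qed

text \<open>Here \<open>X\<close> stands for \<open>\<tau> \<parallel>div w\<parallel>\<close>, while \<open>pd\<close> and \<open>ud\<close> are the cross terms. Young's inequality gives away a
quarter of \<open>X\<^sup>2\<close> for each of them; the bounds on \<open>\<theta>\<close> make the resulting multiples of \<open>P\<^sup>2\<close> and \<open>U\<^sup>2\<close> at most half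
of what \<open>1 / M * P\<^sup>2\<close> and \<open>A\<close> provide.\<close>

lemma inf_sup_algebra:
  fixes U W X P A T pd ud a0 c1 M b \<theta> :: real
  assumes "a0 * U\<^sup>2 \<le> A" "c1 * W \<le> T" "\<bar>pd\<bar> \<le> P * X" "\<bar>ud\<bar> \<le> b * U * X"
    and M: "0 < M" and \<theta>: "0 \<le> \<theta>" "\<theta> \<le> M / 2" "\<theta> * b\<^sup>2 \<le> a0 / 2"
  shows "a0 / 2 * U\<^sup>2 + c1 * W + \<theta> / 2 * X\<^sup>2 + 1 / (2 * M) * P\<^sup>2 \<le> A + T + 1 / M * P\<^sup>2 + \<theta> * (1 / M * pd + ud + X\<^sup>2)"
proof -
  have "1 / M * pd \<ge> - (P / M * X)"
    using M assms(3) by (simp add: field_simps)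
  moreover have "P / M * X \<le> X\<^sup>2 / 4 + (P / M)\<^sup>2"
    using zero_le_power2[of "X / 2 - P / M"] by (simp add: power2_diff power_divide algebra_simps)
  moreover have "ud \<ge> - (b * U * X)" using assms(4) by linarith
  moreover have "b * U * X \<le> X\<^sup>2 / 4 + (b * U)\<^sup>2"
    using zero_le_power2[of "X / 2 - b * U"] by (simp add: power2_diff power_divide algebra_simps)
  ultimately have "X\<^sup>2 / 2 - (P / M)\<^sup>2 - (b * U)\<^sup>2 \<le> 1 / M * pd + ud + X\<^sup>2" by linarith
  from mult_left_mono[OF this \<theta>(1)]
  have 1: "\<theta> / 2 * X\<^sup>2 - \<theta> * (P / M)\<^sup>2 - \<theta> * (b * U)\<^sup>2 \<le> \<theta> * (1 / M * pd + ud + X\<^sup>2)"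
    by (simp add: algebra_simps)
  have "\<theta> * (P / M)\<^sup>2 \<le> M / 2 * (P / M)\<^sup>2" using \<theta>(2) by (rule mult_right_mono) simp
  then have 2: "\<theta> * (P / M)\<^sup>2 \<le> 1 / (2 * M) * P\<^sup>2" using M by (simp add: power_divide power2_eq_square field_simps)
  have "\<theta> * (b * U)\<^sup>2 = (\<theta> * b\<^sup>2) * U\<^sup>2" by (simp add: power_mult_distrib)
  also have "\<dots> \<le> a0 / 2 * U\<^sup>2" using \<theta>(3) by (rule mult_right_mono) simp
  finally have 3: "\<theta> * (b * U)\<^sup>2 \<le> a0 / 2 * U\<^sup>2" .
  have 4: "1 / M * P\<^sup>2 = 1 / (2 * M) * P\<^sup>2 + 1 / (2 * M) * P\<^sup>2" using M by (simp add: field_simps)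
  have 5: "a0 * U\<^sup>2 = a0 / 2 * U\<^sup>2 + a0 / 2 * U\<^sup>2" by (simp add: field_simps)
  show ?thesis using 1 2 3 assms(1,2) unfolding 4 using 5 by linarith
qed

text \<open>The pressure test function combines the sign change that cancels the coupling terms with a multiple
of \<open>div w\<close> that recovers the divergence part of the norm.\<close>

lemma biot_form_stabilising_test:
  fixes \<Omega> :: "(real ^ 'd) set" and \<mu> lam M \<alpha> \<mu>f \<tau> k C a0 \<theta> c :: real
  assumes \<Omega>: "open \<Omega>" "bounded \<Omega>"
    and par: "0 < M" "0 < \<alpha>" "0 < \<mu>f" "0 < \<tau>" and k: "0 < k" "\<And>\<xi>. k * (norm \<xi>)\<^sup>2 \<le> (matrix_inv K *v \<xi>) \<bullet> \<xi>"
    and C: "\<And>\<xi>. norm (matrix_inv K *v \<xi>) \<le> C * norm \<xi>"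
    and a0: "0 < a0" "a0 * (H1_vec_norm \<Omega> u)\<^sup>2 \<le> elasticity_form \<Omega> \<mu> lam u u"
    and U: "u \<in> H1_vec \<Omega>" "w \<in> L2 (lebesgue_on \<Omega>)" "weak_div \<Omega> w \<in> L2 (lebesgue_on \<Omega>)" "p \<in> L2 (lebesgue_on \<Omega>)"
    and \<theta>: "0 < \<theta>" "\<theta> \<le> M / 2" "\<theta> * (\<alpha> * CARD('d))\<^sup>2 \<le> a0 / 2"
    and c: "c \<le> a0 / 2" "c \<le> k * \<mu>f" "c \<le> \<theta> / 2" "c \<le> 1 / (2 * M)"
  defines "q \<equiv> \<lambda>x. - p x - \<theta> * \<tau> * weak_div \<Omega> w x"
  shows "c * (tau_norm \<Omega> \<tau> (u, w, p))\<^sup>2 \<le> biot_form \<Omega> \<mu> lam M \<alpha> \<mu>f K \<tau> (u, w, p) (u, w, q)"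
    and "tau_norm \<Omega> \<tau> (u, w, q) \<le> (2 + \<theta>) * tau_norm \<Omega> \<tau> (u, w, p)"
    and "q \<in> L2 (lebesgue_on \<Omega>)"
proof -
  let ?L = "lebesgue_on \<Omega>" and ?N = "tau_norm \<Omega> \<tau> (u, w, p)"
  let ?U = "H1_vec_norm \<Omega> u" and ?W = "L2_norm ?L w" and ?X = "\<tau> * L2_norm ?L (weak_div \<Omega> w)" and ?P = "L2_norm ?L p"
  let ?dw = "weak_div \<Omega> w" and ?du = "weak_div \<Omega> u"
  note du = weak_div_eq_trace_jacobian(1)[OF \<Omega> U(1)]
  note lin = L2_inner_combination_right[OF _ U(4,3)]
  have pp: "L2_inner ?L p p = ?P\<^sup>2" "L2_inner ?L ?dw ?dw = (L2_norm ?L ?dw)\<^sup>2"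
    by (simp_all add: L2_norm_def L2_inner_def)
  have sym: "L2_inner ?L p ?dw = L2_inner ?L ?dw p" "L2_inner ?L p ?du = L2_inner ?L ?du p"
    by (simp_all add: L2_inner_def mult.commute)
  let ?T = "\<tau> * L2_inner ?L (\<lambda>x. matrix_inv K *v (\<mu>f *\<^sub>R w x)) w"
  let ?pd = "\<tau> * L2_inner ?L p ?dw" and ?ud = "\<alpha> * (\<tau> * L2_inner ?L ?du ?dw)"
  have B: "biot_form \<Omega> \<mu> lam M \<alpha> \<mu>f K \<tau> (u, w, p) (u, w, q) =
      elasticity_form \<Omega> \<mu> lam u u + ?T + 1 / M * ?P\<^sup>2 + \<theta> * (1 / M * ?pd + ?ud + ?X\<^sup>2)"
    using L2_inner_scaleR_left[of ?L \<alpha> p ?du] L2_inner_scaleR_left[of ?L "1 / M" p q] L2_inner_scaleR_left[of ?L \<alpha> ?du q]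
      lin[OF U(4), of "\<theta> * \<tau>"] lin[OF U(3), of "\<theta> * \<tau>"] lin[OF du, of "\<theta> * \<tau>"] par
    unfolding biot_form_def prod.case
    by (simp add: q_def[symmetric] pp sym power_mult_distrib) (simp add: field_simps power2_eq_square)
  have T: "(k * \<mu>f) * (\<tau> * ?W\<^sup>2) \<le> ?T"
  proof -
    let ?k = "\<lambda>x. matrix_inv K *v (\<mu>f *\<^sub>R w x)"
    have km: "?k \<in> borel_measurable ?L"
      using L2_measurable[OF U(2)] by (rule borel_measurable_matrix_vector_mult)
    have kb: "norm (?k x) \<le> (max 0 C * \<mu>f) * norm (w x)" for x
    proof -
      have "norm (?k x) \<le> C * norm (\<mu>f *\<^sub>R w x)" by (rule C)
      also have "\<dots> \<le> max 0 C * norm (\<mu>f *\<^sub>R w x)" by (rule mult_right_mono) auto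
      finally show ?thesis using par by (simp add: mult.assoc)
    qed
    have kL: "?k \<in> L2 ?L" by (rule L2_dominated(1)[OF U(2) km]; use kb par in auto)
    have "(\<integral>x. (k * \<mu>f) * (norm (w x))\<^sup>2 \<partial>?L) \<le> (\<integral>x. ?k x \<bullet> w x \<partial>?L)"
    proof (rule integral_mono)
      show "integrable ?L (\<lambda>x. (k * \<mu>f) * (norm (w x))\<^sup>2)" using U(2) by (simp add: L2_def)
      show "integrable ?L (\<lambda>x. ?k x \<bullet> w x)" using kL U(2) by (rule L2_integrable_inner)
      fix x
      have "k * (norm (\<mu>f *\<^sub>R w x))\<^sup>2 \<le> (matrix_inv K *v (\<mu>f *\<^sub>R w x)) \<bullet> (\<mu>f *\<^sub>R w x)" by (rule k(2))
      then have "\<mu>f * ((k * \<mu>f) * (norm (w x))\<^sup>2) \<le> \<mu>f * (?k x \<bullet> w x)"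
        using par by (simp add: power_mult_distrib power2_eq_square mult_ac)
      then show "(k * \<mu>f) * (norm (w x))\<^sup>2 \<le> ?k x \<bullet> w x" using par by simp
    qed
    then have "(k * \<mu>f) * ?W\<^sup>2 \<le> L2_inner ?L ?k w" unfolding L2_norm_power2 by (simp add: L2_inner_def)
    from mult_left_mono[OF this, of \<tau>] show ?thesis using par by (simp add: mult_ac)
  qed
  have pd: "\<bar>?pd\<bar> \<le> ?P * ?X"
    using mult_left_mono[OF L2_Cauchy_Schwarz[OF U(4,3)], of \<tau>] par by (simp add: abs_mult mult_ac)
  have ud: "\<bar>?ud\<bar> \<le> (\<alpha> * CARD('d)) * ?U * ?X"
  proof -
    have "\<bar>L2_inner ?L ?du ?dw\<bar> \<le> (CARD('d) * ?U) * L2_norm ?L ?dw"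
      using L2_Cauchy_Schwarz[OF du U(3)] mult_right_mono[OF weak_div_le_H1_norm[OF \<Omega> U(1)] L2_norm_nonneg[of ?L ?dw]] by linarith
    from mult_left_mono[OF this, of "\<alpha> * \<tau>"] show ?thesis using par by (simp add: abs_mult mult_ac)
  qed
  have "c * ?N\<^sup>2 = c * ?U\<^sup>2 + c * (\<tau> * ?W\<^sup>2) + c * ?X\<^sup>2 + c * ?P\<^sup>2"
    by (simp add: tau_norm_power2[OF par(4)] algebra_simps)
  also have "\<dots> \<le> a0 / 2 * ?U\<^sup>2 + (k * \<mu>f) * (\<tau> * ?W\<^sup>2) + \<theta> / 2 * ?X\<^sup>2 + 1 / (2 * M) * ?P\<^sup>2"
    using c par by (intro add_mono mult_right_mono) auto
  also have "\<dots> \<le> biot_form \<Omega> \<mu> lam M \<alpha> \<mu>f K \<tau> (u, w, p) (u, w, q)"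
    unfolding B using \<theta> by (intro inf_sup_algebra[OF a0(2) T pd ud par(1)]) auto
  finally show "c * ?N\<^sup>2 \<le> biot_form \<Omega> \<mu> lam M \<alpha> \<mu>f K \<tau> (u, w, p) (u, w, q)" .
  have q: "q = (\<lambda>x. (-1) *\<^sub>R p x + (- \<theta> * \<tau>) *\<^sub>R ?dw x)" by (simp add: q_def fun_eq_iff)
  show qL: "q \<in> L2 ?L" unfolding q by (intro L2_add L2_scaleR U)
  note n = tau_norm_components[OF par(4), where \<Omega> = \<Omega> and u = u and w = w and p = p]
  have N0: "0 \<le> ?N" by (rule tau_norm_nonneg[OF par(4)])
  have "(L2_norm ?L q)\<^sup>2 = L2_inner ?L q q" by (simp add: L2_norm_def L2_inner_def)
  also have "\<dots> = - L2_inner ?L q p - \<theta> * \<tau> * L2_inner ?L q ?dw"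
    using lin[OF qL, of "\<theta> * \<tau>"] by (simp add: q_def)
  also have "\<dots> \<le> L2_norm ?L q * ?P + \<theta> * \<tau> * (L2_norm ?L q * L2_norm ?L ?dw)"
  proof -
    have "- L2_inner ?L q ?dw \<le> L2_norm ?L q * L2_norm ?L ?dw" using L2_Cauchy_Schwarz[OF qL U(3)] by linarith
    from mult_left_mono[OF this, of "\<theta> * \<tau>"] show ?thesis
      using L2_Cauchy_Schwarz[OF qL U(4)] \<theta>(1) par(4) by simp
  qed
  also have "\<dots> = L2_norm ?L q * (?P + \<theta> * ?X)" by (simp add: algebra_simps)
  finally have "L2_norm ?L q * L2_norm ?L q \<le> L2_norm ?L q * (?P + \<theta> * ?X)" by (simp add: power2_eq_square)
  then have "L2_norm ?L q \<le> ?P + \<theta> * ?X"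
    using L2_norm_nonneg[of ?L q] L2_norm_nonneg[of ?L p] L2_norm_nonneg[of ?L ?dw] \<theta> par
    by (cases "L2_norm ?L q = 0") auto
  also have "\<dots> \<le> (1 + \<theta>) * ?N"
    using n(4) mult_left_mono[OF n(3) less_imp_le[OF \<theta>(1)]] unfolding distrib_right mult_1_left by linarith
  finally have "(L2_norm ?L q)\<^sup>2 \<le> ((1 + \<theta>) * ?N)\<^sup>2" by (rule power_mono) (rule L2_norm_nonneg)
  then have "(tau_norm \<Omega> \<tau> (u, w, q))\<^sup>2 \<le> ?N\<^sup>2 + ((1 + \<theta>) * ?N)\<^sup>2"
    by (simp add: tau_norm_power2[OF par(4)] add_increasing)
  also have "\<dots> \<le> ((2 + \<theta>) * ?N)\<^sup>2"
  proof -
    have "1 + (1 + \<theta>)\<^sup>2 \<le> (2 + \<theta>)\<^sup>2" using \<theta>(1) by (simp add: power2_eq_square algebra_simps)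
    from mult_right_mono[OF this zero_le_power2[of ?N]] show ?thesis
      unfolding power_mult_distrib by (simp only: distrib_right[of 1 "(1 + \<theta>)\<^sup>2"] mult_1_left)
  qed
  finally show "tau_norm \<Omega> \<tau> (u, w, q) \<le> (2 + \<theta>) * ?N"
    by (rule power2_le_imp_le) (use N0 \<theta>(1) in simp)
qed

lemma L2_norm_eq_0: "AE x in M. f x = 0 \<Longrightarrow> L2_norm M f = 0"
  unfolding L2_norm_def L2_inner_def
  by (subst integral_eq_zero_AE) (auto elim: eventually_mono)

text \<open>A triple that vanishes almost everywhere also has vanishing weak derivatives, so a triple of nonzero
norm is a legitimate competitor in the supremum.\<close>

lemma tau_norm_zero:
  fixes \<Omega> :: "(real ^ 'd) set"
  assumes \<Omega>: "open \<Omega>" "bounded \<Omega>" and z: "triple_zero \<Omega> Y"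
  shows "tau_norm \<Omega> \<tau> Y = 0"
proof -
  let ?L = "lebesgue_on \<Omega>"
  obtain u w p where Y: "Y = (u, w, p)" by (cases Y)
  have u: "AE x in ?L. u x = 0" and w: "AE x in ?L. w x = 0" and p: "AE x in ?L. p x = 0"
    using z by (auto simp: Y triple_zero_def ae_zero_def)
  have "AE x in ?L. weak_grad \<Omega> (\<lambda>y. u y $ i) x = 0" for i
    by (rule weak_grad_zero[OF \<Omega>]) (use u in eventually_elim, simp)
  then have "AE x in ?L. \<forall>i\<in>UNIV. weak_grad \<Omega> (\<lambda>y. u y $ i) x = 0"
    by (subst AE_ball_countable) (auto intro: countable_finite)
  then have "AE x in ?L. weak_jacobian \<Omega> u x = 0"
    by eventually_elim (simp add: weak_jacobian_def vec_eq_iff)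
  then show ?thesis
    using u w p weak_div_zero[OF \<Omega> w]
    by (simp add: Y tau_norm_def H1_vec_norm_def L2_norm_eq_0)
qed

lemma constant_one_not_ae_zero:
  assumes "open \<Omega>" "\<Omega> \<noteq> {}"
  shows "\<not> ae_zero (lebesgue_on \<Omega>) (\<lambda>x :: 'a::euclidean_space. 1 :: real)"
proof
  assume "ae_zero (lebesgue_on \<Omega>) (\<lambda>x. 1 :: real)"
  then have "AE x in lebesgue. x \<notin> \<Omega>"
    unfolding ae_zero_def AE_lebesgue_on_open_iff[OF assms(1)] by simp
  then have "\<Omega> \<in> null_sets lebesgue" using assms(1) by (simp add: AE_iff_null_sets[symmetric])
  then show False using open_not_negligible[OF assms] by (simp add: negligible_iff_null_sets)
qed

lemma space_Qh_const:
  assumes "open \<Omega>" "bounded \<Omega>" shows "(\<lambda>x. c) \<in> space_Qh \<Omega> \<T>"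
  unfolding space_Qh_def
  by (auto intro!: L2_bounded[OF finite_measure_lebesgue_on_bounded_open[OF assms], of _ "\<bar>c\<bar>"] exI[of _ c])

lemma space_Qh_combination:
  assumes "p \<in> space_Qh \<Omega> \<T>" "q \<in> space_Qh \<Omega> \<T>"
  shows "(\<lambda>x. - p x - c * q x) \<in> space_Qh \<Omega> \<T>"
proof -
  have "(\<lambda>x. (-1) *\<^sub>R p x + (- c) *\<^sub>R q x) \<in> L2 (lebesgue_on \<Omega>)"
    using assms by (intro L2_add L2_scaleR) (auto simp: space_Qh_def)
  moreover have pq: "\<exists>k. AE x in lebesgue_on T. p x = k" "\<exists>k. AE x in lebesgue_on T. q x = k" if "T \<in> \<T>" for T
    using assms that by (auto simp: space_Qh_def)
  moreover have "\<exists>k. AE x in lebesgue_on T. - p x - c * q x = k" if T: "T \<in> \<T>" for T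
  proof -
    obtain a where "AE x in lebesgue_on T. p x = a"
      using pq(1)[OF T] by blast
    moreover obtain b where "AE x in lebesgue_on T. q x = b"
      using pq(2)[OF T] by blast
    ultimately have "AE x in lebesgue_on T. - p x - c * q x = - a - c * b" by eventually_elim simp
    then show ?thesis by blast
  qed
  ultimately show ?thesis by (simp add: space_Qh_def)
qed

theorem theorem3p2:
  fixes \<Omega> \<Gamma>t \<Gamma>c :: "(real ^ 'd) set"
    and \<mu> lam M \<alpha> \<mu>f :: real
    and K :: "real ^ 'd ^ 'd"
    and \<T> :: "'h \<Rightarrow> (real ^ 'd) set set"
    and n :: "'h \<Rightarrow> (real ^ 'd) set \<Rightarrow> real ^ 'd"
    and Vh Wh :: "'h \<Rightarrow> (real ^ 'd \<Rightarrow> real ^ 'd) set"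
    and Qh :: "'h \<Rightarrow> (real ^ 'd \<Rightarrow> real) set"
  assumes dim: "CARD('d) \<in> {2, 3}"
    and domain: "open \<Omega>" "connected \<Omega>" "\<Omega> \<noteq> {}" "bounded \<Omega>"
    and boundary: "frontier \<Omega> = closure \<Gamma>t \<union> closure \<Gamma>c"
      "openin (top_of_set (frontier \<Omega>)) \<Gamma>t" "openin (top_of_set (frontier \<Omega>)) \<Gamma>c"
      "emeasure (hausdorff_measure (real CARD('d) - 1)) \<Gamma>t \<noteq> 0"
      "emeasure (hausdorff_measure (real CARD('d) - 1)) \<Gamma>c \<noteq> 0"
    and parameters: "\<mu> > 0" "lam \<ge> 0" "M > 0" "\<alpha> > 0" "\<mu>f > 0"
    and permeability: "transpose K = K" "\<And>\<xi>. \<xi> \<noteq> 0 \<Longrightarrow> \<xi> \<bullet> (K *v \<xi>) > 0"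
    and mesh: "\<And>h. simplicial_mesh \<Omega> (\<T> h)" "shape_regular \<T>"
      "\<And>h. admissible_normals \<Omega> \<Gamma>t (\<T> h) (n h)"
    and Vh: "\<And>h. Vh h = space_Vh \<Omega> \<Gamma>t \<Gamma>c (\<T> h) (n h)"
    and Wh: "\<And>h. Wh h = space_Wh \<Omega> \<Gamma>c (\<T> h)"
    and Qh: "\<And>h. Qh h = space_Qh \<Omega> (\<T> h)"
    and stable: "stokes_biot_stable \<Omega> \<mu> lam Vh Wh Qh"
  shows "(\<exists>C. \<forall>h. \<forall>\<tau>>0. \<forall>U \<in> Vh h \<times> Wh h \<times> Qh h. \<forall>Y \<in> Vh h \<times> Wh h \<times> Qh h.
            \<bar>biot_form \<Omega> \<mu> lam M \<alpha> \<mu>f K \<tau> U Y\<bar> \<le> C * tau_norm \<Omega> \<tau> U * tau_norm \<Omega> \<tau> Y)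
       \<and> (\<exists>\<gamma>>0. \<forall>h. \<forall>\<tau>>0. \<forall>U \<in> Vh h \<times> Wh h \<times> Qh h.
            (SUP Y \<in> {Y \<in> Vh h \<times> Wh h \<times> Qh h. \<not> triple_zero \<Omega> Y}.
               ereal (biot_form \<Omega> \<mu> lam M \<alpha> \<mu>f K \<tau> U Y / tau_norm \<Omega> \<tau> Y))
            \<ge> ereal (\<gamma> * tau_norm \<Omega> \<tau> U))"
proof -
  let ?B = "biot_form \<Omega> \<mu> lam M \<alpha> \<mu>f K" and ?N = "tau_norm \<Omega>"
  note \<Omega> = domain(1,4)
  obtain k C0 where K: "0 < k" "0 < C0" "\<And>\<xi>. k * (norm \<xi>)\<^sup>2 \<le> (matrix_inv K *v \<xi>) \<bullet> \<xi>"
    "\<And>\<xi>. norm (matrix_inv K *v \<xi>) \<le> C0 * norm \<xi>"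
    using spd_matrix_inv_bounds[OF permeability(2)] by blast
  obtain a0 where a0: "0 < a0" "\<And>h u. u \<in> Vh h \<Longrightarrow> a0 * (H1_vec_norm \<Omega> u)\<^sup>2 \<le> elasticity_form \<Omega> \<mu> lam u u"
    using stable unfolding stokes_biot_stable_def by blast
  have V: "u \<in> H1_vec \<Omega>" if "u \<in> Vh h" for u h
    using that space_Vh_subset_H1_vec[OF \<Omega> mesh(1)] unfolding Vh by blast
  have W: "w \<in> L2 (lebesgue_on \<Omega>)" "weak_div \<Omega> w \<in> Qh h" if "w \<in> Wh h" for w h
    using weak_div_space_Wh[OF \<Omega> mesh(1)] that unfolding Wh Qh by blast+
  have Q: "q \<in> L2 (lebesgue_on \<Omega>)" if "q \<in> Qh h" for q h
    using that unfolding Qh by (simp add: space_Qh_def)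
  define C where "C = (2 * \<mu> + lam * (real CARD('d))\<^sup>2) + 2 * \<alpha> * CARD('d) + C0 * \<mu>f + 2 + 1 / M"
  have cont: "\<bar>?B \<tau> U Y\<bar> \<le> C * ?N \<tau> U * ?N \<tau> Y"
    if \<tau>: "0 < \<tau>" and U: "U \<in> Vh h \<times> Wh h \<times> Qh h" and Y: "Y \<in> Vh h \<times> Wh h \<times> Qh h" for h \<tau> U Y
  proof -
    obtain u w p v r q where e: "U = (u, w, p)" "Y = (v, r, q)" by (cases U, cases Y)
    show ?thesis unfolding e C_def
      using U Y parameters \<tau> K(2,4) unfolding e
      by (intro biot_form_bound \<Omega>) (auto intro: V W Q)
  qed
  \<comment> \<open>The two bounds are the smallness conditions of \<open>inf_sup_algebra\<close>; the factor \<open>\<alpha> * CARD('d)\<close> bounds \<open>\<alpha> \<parallel>div u\<parallel>\<close> by the H1 norm of \<open>u\<close>.\<close>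
  define \<theta> where "\<theta> = min (M / 2) (a0 / (2 * (\<alpha> * CARD('d))\<^sup>2))"
  have \<theta>: "0 < \<theta>" "\<theta> \<le> M / 2" "\<theta> * (\<alpha> * CARD('d))\<^sup>2 \<le> a0 / 2"
  proof -
    have d: "0 < (\<alpha> * CARD('d))\<^sup>2" using parameters by simp
    then show "0 < \<theta>" "\<theta> \<le> M / 2" using parameters a0 by (auto simp: \<theta>_def)
    have "\<theta> \<le> a0 / (2 * (\<alpha> * CARD('d))\<^sup>2)" by (simp add: \<theta>_def)
    from mult_right_mono[OF this, of "(\<alpha> * CARD('d))\<^sup>2"] d
    show "\<theta> * (\<alpha> * CARD('d))\<^sup>2 \<le> a0 / 2" by simp
  qed
  define c where "c = min (min (a0 / 2) (k * \<mu>f)) (min (\<theta> / 2) (1 / (2 * M)))"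
  have c: "0 < c" "c \<le> a0 / 2" "c \<le> k * \<mu>f" "c \<le> \<theta> / 2" "c \<le> 1 / (2 * M)"
    using a0 K(1) \<theta>(1) parameters by (auto simp: c_def)
  have infsup: "(SUP Y \<in> {Y \<in> Vh h \<times> Wh h \<times> Qh h. \<not> triple_zero \<Omega> Y}. ereal (?B \<tau> U Y / ?N \<tau> Y))
      \<ge> ereal (c / (2 + \<theta>) * ?N \<tau> U)" (is "?S \<ge> _")
    if \<tau>: "0 < \<tau>" and U: "U \<in> Vh h \<times> Wh h \<times> Qh h" for h \<tau> U
  proof -
    obtain u w p where e: "U = (u, w, p)" by (cases U)
    have mem: "u \<in> Vh h" "w \<in> Wh h" "p \<in> Qh h" using U by (auto simp: e)
    have bound: "ereal x \<le> ?S" if "Y \<in> Vh h \<times> Wh h \<times> Qh h" "\<not> triple_zero \<Omega> Y" "x \<le> ?B \<tau> U Y / ?N \<tau> Y" for Y x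
    proof -
      have "ereal x \<le> ereal (?B \<tau> U Y / ?N \<tau> Y)" using that(3) by simp
      also have "\<dots> \<le> ?S" using that(1,2) by (intro SUP_upper) simp
      finally show ?thesis .
    qed
    show ?thesis
    proof (cases "?N \<tau> U = 0")
      case True
      \<comment> \<open>The quotient at a nonzero triple is \<open>0\<close>, its denominator possibly being \<open>0\<close> as well.\<close>
      let ?Y = "(u, w, \<lambda>x::real^'d. 1::real)"
      have Y: "?Y \<in> Vh h \<times> Wh h \<times> Qh h" using mem space_Qh_const[OF \<Omega>] by (simp add: Qh)
      have "?B \<tau> U ?Y = 0" using cont[OF \<tau> U Y] True by simp
      moreover have "\<not> triple_zero \<Omega> ?Y"
        using constant_one_not_ae_zero[OF domain(1,3)] by (simp add: triple_zero_def)
      ultimately show ?thesis using bound[OF Y, of 0] True by (simp add: zero_ereal_def)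
    next
      case False
      then have N: "0 < ?N \<tau> U" using tau_norm_nonneg[OF \<tau>, of \<Omega> U] by linarith
      let ?q = "\<lambda>x. - p x - \<theta> * \<tau> * weak_div \<Omega> w x"
      let ?Y = "(u, w, ?q)"
      note test = biot_form_stabilising_test[OF \<Omega> parameters(3-5) \<tau> K(1,3,4) a0(1) a0(2)[OF mem(1)]
          V[OF mem(1)] W(1)[OF mem(2)] Q[OF W(2)[OF mem(2)]] Q[OF mem(3)] \<theta> c(2-5)]
      have Y: "?Y \<in> Vh h \<times> Wh h \<times> Qh h"
        using mem W(2)[OF mem(2)] space_Qh_combination[of p \<Omega> "\<T> h" "weak_div \<Omega> w" "\<theta> * \<tau>"] by (simp add: Qh)
      have B: "c * (?N \<tau> U)\<^sup>2 \<le> ?B \<tau> U ?Y" and NY: "?N \<tau> ?Y \<le> (2 + \<theta>) * ?N \<tau> U"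
        using test(1,2) unfolding e .
      have Bpos: "0 < ?B \<tau> U ?Y" using B c(1) N by (smt (verit) mult_pos_pos zero_less_power)
      \<comment> \<open>The form is positive at the test triple and bounded by its norm, which therefore cannot vanish.\<close>
      have "?N \<tau> ?Y \<noteq> 0" using cont[OF \<tau> U Y] Bpos by auto
      then have NYpos: "0 < ?N \<tau> ?Y" using tau_norm_nonneg[OF \<tau>, of \<Omega> ?Y] by linarith
      have nz: "\<not> triple_zero \<Omega> ?Y" using tau_norm_zero[OF \<Omega>] \<open>?N \<tau> ?Y \<noteq> 0\<close> by blast
      have "c / (2 + \<theta>) * ?N \<tau> U * ?N \<tau> ?Y \<le> c / (2 + \<theta>) * ?N \<tau> U * ((2 + \<theta>) * ?N \<tau> U)"
        using NY c(1) \<theta>(1) N by (intro mult_left_mono) auto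
      also have "\<dots> = c * (?N \<tau> U)\<^sup>2" using \<theta>(1) by (simp add: power2_eq_square)
      finally have "c / (2 + \<theta>) * ?N \<tau> U \<le> ?B \<tau> U ?Y / ?N \<tau> ?Y"
        using B NYpos by (simp add: pos_le_divide_eq)
      then show ?thesis by (rule bound[OF Y nz])
    qed
  qed
  have "0 < c / (2 + \<theta>)" using c(1) \<theta>(1) by simp
  then show ?thesis using cont infsup by blast
qed

end
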